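(* Let $s$ be an arbitrary positive integer and $d = 7\cdot 2^{s}-5$. Then the Singer algebraic transfer $$\varphi_5:\mathrm{Tor}^{\mathcal A}_{5,5+d}(\mathbb F_2,\mathbb F_2)\longrightarrow (QP_5)_d^{GL_5}$$ is an epimorphism (that is, Singer's conjecture is true for $k=5$ and the degree $7\cdot 2^s-5$).
   Context: $\mathcal A$ is the mod-2 Steenrod algebra. $P_k=\mathbb F_2[x_1,\dots,x_k]$ with each $x_i$ of degree 1, identified with $H^*((\mathbb Z/2)^k;\mathbb F_2)$; $\mathcal A$ acts by $Sq^0=\mathrm{id}$, $Sq^1x_i=x_i^2$, $Sq^jx_i=0$ for $j>1$, and the Cartan formula. $GL_k=GL_k(\mathbb F_2)$ acts on $P_k$ by linear substitution of the variables; this commutes with $\mathcal A$. $QP_k=\mathbb F_2\otimes_{\mathcal A}P_k=P_k/\mathcal A^+P_k$, where $\mathcal A^+$ is the augmentation ideal; $(QP_k)_d$ is its degree $d$ part, and $(QP_k)_d^{GL_k}$ is the subspace of $GL_k$-invariants. The Singer algebraic transfer $\varphi_k:\mathrm{Tor}^{\mathcal A}_{k,k+d}(\mathbb F_2,\mathbb F_2)\to (QP_k)_d^{GL_k}$ is defined as follows. Let $\hat P_1\subset \mathbb F_2[x,x^{-1}]$ be the span of the $x^i$ with $i\ge -1$, with $\mathcal A$-action $Sq^j(x^a)=\binom{a}{j}x^{a+j}$ (for $a=-1$, $\binom{-1}{j}=(-1)^j$). There is a short exact sequence of graded $\mathcal A$-modules $0\to P_1\to\hat P_1\to\Sigma^{-1}\mathbb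 F_2\to 0$. Tensoring with $P_j$ over $\mathbb F_2$ (with diagonal $\mathcal A$-action) gives $0\to P_{j+1}\to P_j\otimes\hat P_1\to\Sigma^{-1}P_j\to 0$, hence connecting homomorphisms $\mathrm{Tor}_i^{\mathcal A}(\mathbb F_2,\Sigma^{-1}P_j)\to \mathrm{Tor}_{i-1}^{\mathcal A}(\mathbb F_2,P_{j+1})$. The composite of the (suitably desuspended) $k$ connecting homomorphisms $$\mathrm{Tor}_k^{\mathcal A}(\mathbb F_2,\Sigma^{-k}\mathbb F_2)\to \mathrm{Tor}_{k-1}^{\mathcal A}(\mathbb F_2,\Sigma^{-(k-1)}P_1)\to\cdots\to \mathrm{Tor}_0^{\mathcal A}(\mathbb F_2,P_k)=QP_k$$ in internal degree $d$, with $\mathrm{Tor}_k^{\mathcal A}(\mathbb F_2,\Sigma^{-k}\mathbb F_2)_d=\mathrm{Tor}^{\mathcal A}_{k,k+d}(\mathbb F_2,\mathbb F_2)$, has image in $(QP_k)_d^{GL_k}$ (Singer), and the resulting map is $\varphi_k$. *)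

theory Defs
  imports
    "HOL-Library.Poly_Mapping"
    "HOL-Library.Z2"
    "HOL-Computational_Algebra.Formal_Power_Series"
    "HOL-Computational_Algebra.Group_Closure"
    "Jordan_Normal_Form.Matrix"
begin

section \<open>Linear algebra over the field with two elements\<close>

text \<open>
  The type \<open>'a \<Rightarrow>\<^sub>0 bit\<close> is the \<open>\<bbbF>\<^sub>2\<close>-vector space with basis \<open>'a\<close>. All coefficients on the
  support are \<open>1\<close>, so the linear extension of a map defined on the basis is a sum over the
  support. Linear spans over \<open>\<bbbF>\<^sub>2\<close> are generated additive subgroups, i.e. \<^const>\<open>group_closure\<close>.
\<close>

abbreviation basis :: "'a \<Rightarrow> 'a \<Rightarrow>\<^sub>0 bit"
  where "basis a \<equiv> Poly_Mapping.single a 1"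

definition lin :: "('a \<Rightarrow> 'b::comm_monoid_add) \<Rightarrow> ('a \<Rightarrow>\<^sub>0 bit) \<Rightarrow> 'b"
  where "lin f x = (\<Sum>a\<in>Poly_Mapping.keys x. f a)"

declare add_bit_eq_xor [simp del] mult_bit_eq_and [simp del]

lemma bit_double [simp]: "(c::bit) + c = 0"
  by (cases c) simp_all

lemma pm_double [simp]: "(x :: 'a \<Rightarrow>\<^sub>0 bit) + x = 0"
  by (rule poly_mapping_eqI) (simp add: lookup_add)

lemma pm_minus [simp]: "- (x :: 'a \<Rightarrow>\<^sub>0 bit) = x"
  by (simp add: minus_unique)

lemma pm_diff [simp]: "(x :: 'a \<Rightarrow>\<^sub>0 bit) - y = x + y"
  by (simp only: diff_conv_add_uminus pm_minus)

lemma lin_zero [simp]: "lin f 0 = 0"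
  by (simp add: lin_def)

lemma lin_basis [simp]: "lin f (basis a) = f a"
  by (simp add: lin_def)

lemma lin_one [simp]: "lin f 1 = f 0"
  by (simp add: lin_def)

lemma lin_add:
  assumes "\<And>v :: 'b. v + v = 0"
  shows "lin (f :: 'a \<Rightarrow> 'b::comm_monoid_add) (x + y) = lin f x + lin f y"
proof -
  define g where "g c v = (if c = (1::bit) then v else (0::'b))" for c v
  have lin_g: "lin f z = (\<Sum>a\<in>Poly_Mapping.keys z. g (Poly_Mapping.lookup z a) (f a))" for z
    unfolding lin_def by (rule sum.cong) (auto simp: g_def in_keys_iff)
  have g_add: "g (c + d) v = g c v + g d v" for c d v
    by (cases c; cases d) (simp_all add: g_def assms)
  show ?thesis
    unfolding lin_g
    by (rule setsum_keys_plus_distrib) (simp_all add: g_add, simp add: g_def)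
qed

lemma lin_sum:
  assumes "\<And>v :: 'b. v + v = 0"
  shows "lin (f :: 'a \<Rightarrow> 'b::comm_monoid_add) (sum x I) = (\<Sum>i\<in>I. lin f (x i))"
  by (induction I rule: infinite_finite_induct) (simp_all add: lin_add[OF assms])

lemma basis_induct [case_names zero add]:
  assumes "P 0" and "\<And>a x. P x \<Longrightarrow> P (basis a + x)"
  shows "P (x :: 'a \<Rightarrow>\<^sub>0 bit)"
proof (induction x rule: update_induct)
  case const
  show ?case by (rule assms(1))
next
  case (update f a b)
  have "Poly_Mapping.update a b f = basis a + f"
    using update(1,2)
    by (intro poly_mapping_eqI) (auto simp: lookup_update lookup_add lookup_single when_def in_keys_iff)
  then show ?case using assms(2) update(3) by metis
qed


section \<open>Laurent polynomials over the field with two elements\<close>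

text \<open>
  Laurent polynomials in the variables \<open>x\<^sub>0, x\<^sub>1, \<dots>\<close> (numbered from 0), with monomials given by
  their exponent vectors.
\<close>

type_synonym laurent = "(nat \<Rightarrow>\<^sub>0 int) \<Rightarrow>\<^sub>0 bit"

definition lvar_pow :: "nat \<Rightarrow> int \<Rightarrow> laurent"
  where "lvar_pow i n = basis (Poly_Mapping.single i n)"

definition total_degree :: "(nat \<Rightarrow>\<^sub>0 int) \<Rightarrow> int"
  where "total_degree e = (\<Sum>i\<in>Poly_Mapping.keys e. Poly_Mapping.lookup e i)"

text \<open>\<open>binom(a,j)\<close> mod 2 for an integer \<open>a\<close>, possibly negative; the generalised binomial coefficient is
  an integer, so the floor only changes the type.\<close>

definition binom2 :: "int \<Rightarrow> nat \<Rightarrow> bit"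
  where "binom2 a j = of_int \<lfloor>(of_int a :: rat) gchoose j\<rfloor>"

text \<open>
  The series \<open>\<Sum>\<^sub>n Sq\<^sup>n(x\<^sup>e) t\<^sup>n\<close>: in one variable \<open>Sq\<^sup>j(x\<^sup>a) = binom(a,j) x\<^bsup>a+j\<^esup>\<close>, and the Cartan formula
  says that the series is multiplicative in the monomial.
\<close>

definition total_Sq1 :: "nat \<Rightarrow> int \<Rightarrow> laurent fps"
  where "total_Sq1 i a = Abs_fps (\<lambda>j. Poly_Mapping.single 0 (binom2 a j) * lvar_pow i (a + int j))"

definition total_Sq :: "(nat \<Rightarrow>\<^sub>0 int) \<Rightarrow> laurent fps"
  where "total_Sq e = (\<Prod>i\<in>Poly_Mapping.keys e. total_Sq1 i (Poly_Mapping.lookup e i))"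

definition Sq_op :: "nat \<Rightarrow> laurent \<Rightarrow> laurent"
  where "Sq_op n f = lin (\<lambda>e. fps_nth (total_Sq e) n) f"


subsection \<open>The Adem relations for the operations on Laurent polynomials\<close>

lemma gbinomial_in_Ints: "(of_int a :: rat) gchoose j \<in> \<int>"
proof (cases "a \<ge> 0")
  case True
  then have "(of_int a :: rat) gchoose j = of_nat (nat a choose j)"
    by (simp add: binomial_gbinomial)
  then show ?thesis by (metis Ints_of_nat)
next
  case False
  have eq: "of_nat j - of_int a - 1 = (of_nat (nat (int j - a - 1)) :: rat)"
    using False by (simp add: of_nat_nat)
  have "(of_int a :: rat) gchoose j = (-1) ^ j * of_nat (nat (int j - a - 1) choose j)"
    by (subst gbinomial_negated_upper) (simp only: eq binomial_gbinomial)
  then show ?thesis by (simp only:) (intro Ints_mult Ints_power Ints_minus Ints_1 Ints_of_nat)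
qed

lemma of_int_floor_gbinomial: "of_int \<lfloor>(of_int a :: rat) gchoose j\<rfloor> = (of_int a :: rat) gchoose j"
  using gbinomial_in_Ints by (rule of_int_floor)

lemma binom2_0 [simp]: "binom2 a 0 = 1"
  by (simp add: binom2_def)

lemma binom2_0_Suc [simp]: "binom2 0 (Suc j) = 0"
  by (simp add: binom2_def)

lemma binom2_Suc: "binom2 (a + 1) (Suc j) = binom2 a j + binom2 a (Suc j)"
proof -
  have "of_int \<lfloor>(of_int (a + 1) :: rat) gchoose Suc j\<rfloor>
      = (of_int (\<lfloor>(of_int a :: rat) gchoose j\<rfloor> + \<lfloor>(of_int a :: rat) gchoose Suc j\<rfloor>) :: rat)"
    unfolding of_int_floor_gbinomial[of "a + 1"]
      of_int_add[of "\<lfloor>_\<rfloor>" "\<lfloor>_\<rfloor>"] of_int_floor_gbinomial[of a]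
    using gbinomial_Suc_Suc[of "of_int a :: rat" j] by simp
  then have "\<lfloor>(of_int (a + 1) :: rat) gchoose Suc j\<rfloor>
      = \<lfloor>(of_int a :: rat) gchoose j\<rfloor> + \<lfloor>(of_int a :: rat) gchoose Suc j\<rfloor>"
    by (simp only: of_int_eq_iff)
  then show ?thesis by (simp add: binom2_def)
qed

lemma binom2_of_nat: "binom2 (int n) j = of_nat (n choose j)"
  by (simp add: binom2_def binomial_gbinomial[symmetric])

lemma binom2_central: "binom2 (- int (Suc m) - 1) (Suc m) = 0"
proof -
  have 1: "(of_nat (Suc m) - of_int (- int (Suc m) - 1) - 1 :: rat) = of_nat (2 * Suc m)"
    by simp
  have 2: "(2 * Suc m) choose (Suc m) = 2 * (Suc (2 * m) choose m)"
    using binomial_symmetric[of m "Suc (2 * m)"] by simp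
  have "(of_int (- int (Suc m) - 1) :: rat) gchoose Suc m
      = (-1) ^ Suc m * of_nat (2 * (Suc (2 * m) choose m))"
    by (subst gbinomial_negated_upper) (simp only: 1 binomial_gbinomial[symmetric] 2)
  also have "\<dots> = of_int ((-1) ^ Suc m * (2 * int (Suc (2 * m) choose m)))"
    by simp
  finally show ?thesis
    unfolding binom2_def by (simp only: floor_of_int) simp
qed

lemma total_Sq1_0: "total_Sq1 i 0 = 1"
proof (rule fps_ext)
  fix n show "fps_nth (total_Sq1 i 0) n = fps_nth 1 n"
    by (cases n) (simp_all add: total_Sq1_def lvar_pow_def)
qed

lemma lvar_pow_add: "lvar_pow i (a + b) = lvar_pow i a * lvar_pow i b"
  by (simp add: lvar_pow_def mult_single single_add)

lemma total_Sq1_Suc: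
  "total_Sq1 i (a + 1) = (fps_const (lvar_pow i 1) + fps_X * fps_const (lvar_pow i 2)) * total_Sq1 i a"
proof (rule fps_ext)
  fix n
  show "fps_nth (total_Sq1 i (a + 1)) n
    = fps_nth ((fps_const (lvar_pow i 1) + fps_X * fps_const (lvar_pow i 2)) * total_Sq1 i a) n"
  proof (cases n)
    case 0
    then show ?thesis
      by (simp add: total_Sq1_def lvar_pow_add fps_mult_nth mult_ac)
  next
    case (Suc m)
    have "lvar_pow i (a + 1 + int (Suc m)) = lvar_pow i 2 * lvar_pow i (a + int m)"
      by (simp add: lvar_pow_add[symmetric] algebra_simps)
    moreover have "lvar_pow i (a + 1 + int (Suc m)) = lvar_pow i 1 * lvar_pow i (a + int (Suc m))"
      by (simp add: lvar_pow_add[symmetric] algebra_simps)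
    ultimately have "fps_nth (total_Sq1 i (a + 1)) (Suc m)
        = Poly_Mapping.single 0 (binom2 a m) * (lvar_pow i 2 * lvar_pow i (a + int m))
        + Poly_Mapping.single 0 (binom2 a (Suc m)) * (lvar_pow i 1 * lvar_pow i (a + int (Suc m)))"
      by (simp add: total_Sq1_def binom2_Suc single_add distrib_right del: of_nat_Suc)
    also have "\<dots> = fps_nth ((fps_const (lvar_pow i 1) + fps_X * fps_const (lvar_pow i 2)) * total_Sq1 i a) (Suc m)"
      by (simp add: total_Sq1_def distrib_right mult.assoc mult_ac add.commute del: of_nat_Suc)
    finally show ?thesis
      using Suc by simp
  qed
qed

lemma total_Sq_superset:
  assumes "finite A" "Poly_Mapping.keys e \<subseteq> A"
  shows "total_Sq e = (\<Prod>i\<in>A. total_Sq1 i (Poly_Mapping.lookup e i))"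
  unfolding total_Sq_def using assms
  by (intro prod.mono_neutral_left) (auto simp: in_keys_iff total_Sq1_0)

lemma total_Sq_Suc:
  "total_Sq (Poly_Mapping.single i 1 + e)
    = (fps_const (lvar_pow i 1) + fps_X * fps_const (lvar_pow i 2)) * total_Sq e"
proof -
  define A where "A = insert i (Poly_Mapping.keys e)"
  have fin: "finite A" and i: "i \<in> A" and sub: "Poly_Mapping.keys e \<subseteq> A"
    by (auto simp: A_def)
  have sub': "Poly_Mapping.keys (Poly_Mapping.single i 1 + e) \<subseteq> A"
    using keys_add[of "Poly_Mapping.single i 1" e] by (auto simp: A_def split: if_splits)
  have rest: "(\<Prod>j\<in>A - {i}. total_Sq1 j (Poly_Mapping.lookup (Poly_Mapping.single i 1 + e) j))
      = (\<Prod>j\<in>A - {i}. total_Sq1 j (Poly_Mapping.lookup e j))"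
    by (rule prod.cong) (auto simp: lookup_add lookup_single when_def)
  show ?thesis
    unfolding total_Sq_superset[OF fin sub] total_Sq_superset[OF fin sub']
      prod.remove[OF fin i] rest
    by (simp add: lookup_add add.commute[of 1] total_Sq1_Suc mult.assoc)
qed

lemma Sq_op_add [simp]: "Sq_op n (f + g) = Sq_op n f + Sq_op n g"
  unfolding Sq_op_def by (rule lin_add) simp

lemma Sq_op_0 [simp]: "Sq_op n 0 = 0"
  by (simp add: Sq_op_def)

lemma lvar_mult_basis: "lvar_pow i 1 * basis e = basis (Poly_Mapping.single i 1 + e)"
  by (simp add: lvar_pow_def mult_single)

lemma Sq_op_lvar_mult:
  "Sq_op n (lvar_pow i 1 * f)
    = lvar_pow i 1 * Sq_op n f + lvar_pow i 2 * (if n = 0 then 0 else Sq_op (n - 1) f)"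
proof (induction f rule: basis_induct)
  case zero
  show ?case by simp
next
  case (add e f)
  have "Sq_op n (lvar_pow i 1 * basis e) = lvar_pow i 1 * Sq_op n (basis e)
      + lvar_pow i 2 * (if n = 0 then 0 else Sq_op (n - 1) (basis e))"
    by (simp add: lvar_mult_basis Sq_op_def total_Sq_Suc distrib_right mult.assoc)
  with add show ?case by (simp add: distrib_left ac_simps)
qed

lemma Sq_op_lvar_pow:
  "Sq_op j (lvar_pow i a) = Poly_Mapping.single 0 (binom2 a j) * lvar_pow i (a + int j)"
proof -
  have "total_Sq (Poly_Mapping.single i a) = total_Sq1 i a"
    by (simp add: total_Sq_def total_Sq1_0)
  then show ?thesis by (simp add: Sq_op_def lvar_pow_def[of i a] total_Sq1_def)
qed

lemma total_Sq1_add: "total_Sq1 i (a + b) = total_Sq1 i a * total_Sq1 i b"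
proof (induction b rule: int_induct[of _ 0])
  case base
  show ?case by (simp add: total_Sq1_0)
next
  case (step1 b)
  then show ?case
    using total_Sq1_Suc[of i "a + b"] total_Sq1_Suc[of i b] by (simp add: add.assoc mult_ac)
next
  case (step2 b)
  define u where "u = fps_const (lvar_pow i 1) + fps_X * fps_const (lvar_pow i 2)"
  have "total_Sq1 i (-1) * u = 1"
    using total_Sq1_Suc[of i "-1"] by (simp add: total_Sq1_0 u_def mult.commute)
  then have "u \<noteq> 0" by auto
  have 1: "u * total_Sq1 i (a + (b - 1)) = total_Sq1 i (a + b)"
    using total_Sq1_Suc[of i "a + (b - 1)"] by (simp add: u_def)
  have 2: "u * total_Sq1 i (b - 1) = total_Sq1 i b"
    using total_Sq1_Suc[of i "b - 1"] by (simp add: u_def)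
  have "u * total_Sq1 i (a + (b - 1)) = u * (total_Sq1 i a * total_Sq1 i (b - 1))"
    by (simp only: 1 step2(2) mult.left_commute[of u] 2)
  with \<open>u \<noteq> 0\<close> show ?case by simp
qed

lemma total_Sq_add: "total_Sq (e + e') = total_Sq e * total_Sq e'"
proof -
  define A where "A = Poly_Mapping.keys e \<union> Poly_Mapping.keys e'"
  have "finite A" "Poly_Mapping.keys e \<subseteq> A" "Poly_Mapping.keys e' \<subseteq> A"
    "Poly_Mapping.keys (e + e') \<subseteq> A"
    using keys_add[of e e'] by (auto simp: A_def)
  then show ?thesis
    by (simp add: total_Sq_superset lookup_add total_Sq1_add prod.distrib)
qed

lemma Sq_op_Cartan: "Sq_op n (f * g) = (\<Sum>j\<le>n. Sq_op j f * Sq_op (n - j) g)"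
proof (induction f rule: basis_induct)
  case (add e f)
  have "Sq_op n (basis e * g) = (\<Sum>j\<le>n. Sq_op j (basis e) * Sq_op (n - j) g)"
  proof (induction g rule: basis_induct)
    case (add e' g)
    have "Sq_op n (basis e * basis e') = (\<Sum>j\<le>n. Sq_op j (basis e) * Sq_op (n - j) (basis e'))"
      by (simp add: mult_single Sq_op_def total_Sq_add fps_mult_nth atMost_atLeast0)
    with add show ?case by (simp add: distrib_left sum.distrib)
  qed simp
  with add show ?case by (simp add: distrib_right sum.distrib)
qed simp

text \<open>Indexing by integers, with \<open>Sq\<^sup>n = 0\<close> for \<open>n < 0\<close>, makes the induction uniform.\<close>

definition ZSq :: "int \<Rightarrow> laurent \<Rightarrow> laurent"
  where "ZSq n f = (if n < 0 then 0 else Sq_op (nat n) f)"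

definition Zbinom2 :: "int \<Rightarrow> int \<Rightarrow> bit"
  where "Zbinom2 a j = (if j < 0 then 0 else binom2 a (nat j))"

lemma ZSq_add [simp]: "ZSq n (f + g) = ZSq n f + ZSq n g"
  by (simp add: ZSq_def)

lemma ZSq_0 [simp]: "ZSq n 0 = 0"
  by (simp add: ZSq_def)

lemma ZSq_lvar_mult:
  "ZSq n (lvar_pow i 1 * f) = lvar_pow i 1 * ZSq n f + lvar_pow i 2 * ZSq (n - 1) f"
proof -
  consider "n < 0" | "n = 0" | "n > 0" by linarith
  then show ?thesis
  proof cases
    case 3
    then have "nat (n - 1) = nat n - 1" by simp
    with 3 show ?thesis by (simp add: ZSq_def Sq_op_lvar_mult)
  qed (simp_all add: ZSq_def Sq_op_lvar_mult)
qed

lemma ZSq_lvar2_mult: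
  "ZSq n (lvar_pow i 2 * f) = lvar_pow i 2 * ZSq n f + lvar_pow i 4 * ZSq (n - 2) f"
proof -
  have 2: "lvar_pow i 2 = lvar_pow i 1 * lvar_pow i 1"
    by (simp flip: lvar_pow_add)
  have 3: "lvar_pow i 1 * (lvar_pow i 2 * g) + lvar_pow i 2 * (lvar_pow i 1 * g) = 0" for g
    by (simp add: mult.left_commute)
  have 4: "lvar_pow i 4 = lvar_pow i 2 * lvar_pow i 2"
    by (simp flip: lvar_pow_add)
  have "ZSq n (lvar_pow i 2 * f) = ZSq n (lvar_pow i 1 * (lvar_pow i 1 * f))"
    by (simp add: 2 mult.assoc)
  also have "\<dots> = lvar_pow i 1 * (lvar_pow i 1 * ZSq n f)
      + (lvar_pow i 1 * (lvar_pow i 2 * ZSq (n - 1) f) + lvar_pow i 2 * (lvar_pow i 1 * ZSq (n - 1) f))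
      + lvar_pow i 2 * (lvar_pow i 2 * ZSq (n - 2) f)"
    by (simp add: ZSq_lvar_mult distrib_left add_ac)
  also have "\<dots> = lvar_pow i 2 * ZSq n f + lvar_pow i 4 * ZSq (n - 2) f"
    by (simp only: 3) (simp add: 2 4 mult.assoc)
  finally show ?thesis .
qed

lemma ZSq_ZSq_lvar_mult:
  "ZSq a (ZSq b (lvar_pow i 1 * f)) = lvar_pow i 1 * ZSq a (ZSq b f)
    + lvar_pow i 2 * (ZSq (a - 1) (ZSq b f) + ZSq a (ZSq (b - 1) f))
    + lvar_pow i 4 * ZSq (a - 2) (ZSq (b - 1) f)"
  by (simp only: ZSq_lvar_mult ZSq_lvar2_mult ZSq_add distrib_left add_ac)

lemma Zbinom2_Suc: "Zbinom2 (a + 1) j = Zbinom2 a j + Zbinom2 a (j - 1)"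
proof -
  consider "j < 0" | "j = 0" | "j > 0" by linarith
  then show ?thesis
  proof cases
    case 3
    then have "nat j = Suc (nat (j - 1))" by simp
    with 3 binom2_Suc[of a "nat (j - 1)"] show ?thesis by (simp add: Zbinom2_def add_ac)
  qed (simp_all add: Zbinom2_def)
qed

definition scal :: "bit \<Rightarrow> laurent \<Rightarrow> laurent"
  where "scal c f = (if c = 1 then f else 0)"

lemma scal_add: "scal (c + d) f = scal c f + scal d f"
  by (cases c; cases d) (simp_all add: scal_def)

lemma scal_add_right: "scal c (f + g) = scal c f + scal c g"
  by (simp add: scal_def)

lemma scal_mult_right: "scal c (f * g) = f * scal c g"
  by (simp add: scal_def)

lemma scal_0 [simp]: "scal 0 f = 0" and scal_1 [simp]: "scal 1 f = f" and scal_0r [simp]: "scal c 0 = 0"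
  by (simp_all add: scal_def)

definition adem_sum :: "int \<Rightarrow> int \<Rightarrow> int \<Rightarrow> laurent \<Rightarrow> laurent"
  where "adem_sum N a b f = (\<Sum>j\<in>{-N..N}. scal (Zbinom2 (b - 1 - j) (a - 2 * j)) (ZSq (a + b - j) (ZSq j f)))"

lemma adem_sum_large:
  assumes "N \<ge> 0" "a \<le> 2 * N + 1"
  shows "adem_sum N a b f
    = (\<Sum>j\<in>{0..a div 2}. scal (Zbinom2 (b - 1 - j) (a - 2 * j)) (ZSq (a + b - j) (ZSq j f)))"
  unfolding adem_sum_def
  by (rule sum.mono_neutral_right) (use assms in \<open>auto simp: ZSq_def Zbinom2_def\<close>)

lemma sum_int_shift:
  "(\<Sum>j\<in>{-N..N::int}. g (j - 1)) = (\<Sum>j\<in>{-N-1..N-1}. g j)"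
  by (rule sum.reindex_bij_witness[of _ "\<lambda>j. j + 1" "\<lambda>j. j - 1"]) auto

lemma sum_shift_ZSq:
  assumes "N \<ge> 0" and g: "\<And>j. j < 0 \<Longrightarrow> g j = 0" "\<And>j. j \<ge> N \<Longrightarrow> g j = (0::laurent)"
  shows "(\<Sum>j\<in>{-N..N::int}. g (j - 1)) = (\<Sum>j\<in>{-N..N}. g j)"
proof -
  have "(\<Sum>j\<in>{-N-1..N-1}. g j) = (\<Sum>j\<in>{0..N-1}. g j)"
    by (rule sum.mono_neutral_right) (use assms in auto)
  also have "\<dots> = (\<Sum>j\<in>{-N..N}. g j)"
    by (rule sum.mono_neutral_left) (use assms in auto)
  finally show ?thesis by (simp add: sum_int_shift)
qed

lemma adem_sum_lvar_mult:
  assumes N: "N \<ge> 0" "a < 2 * N"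
  shows "adem_sum N a b (lvar_pow i 1 * f) = lvar_pow i 1 * adem_sum N a b f
    + lvar_pow i 2 * (adem_sum N (a - 1) b f + adem_sum N a (b - 1) f)
    + lvar_pow i 4 * adem_sum N (a - 2) (b - 1) f"
proof -
  define c where "c = (\<lambda>j. Zbinom2 (b - 1 - j) (a - 2 * j))"
  define T where "T = (\<lambda>d e. ZSq d (ZSq e f))"
  let ?s = "\<lambda>g. \<Sum>j\<in>{-N..N}. g j"
  have "adem_sum N a b (lvar_pow i 1 * f) =
      ?s (\<lambda>j. lvar_pow i 1 * scal (c j) (T (a + b - j) j)
        + lvar_pow i 2 * (scal (c j) (T (a + b - 1 - j) j) + scal (c j) (T (a + b - j) (j - 1)))
        + lvar_pow i 4 * scal (c j) (T (a + b - 2 - j) (j - 1)))"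
  proof -
    have i: "a + b - j - 1 = a + b - 1 - j" "a + b - j - 2 = a + b - 2 - j" for j
      by simp_all
    show ?thesis
      unfolding adem_sum_def c_def T_def
      by (simp only: ZSq_ZSq_lvar_mult scal_add_right scal_mult_right i)
  qed
  also have "\<dots> = lvar_pow i 1 * ?s (\<lambda>j. scal (c j) (T (a + b - j) j))
        + lvar_pow i 2 * (?s (\<lambda>j. scal (c j) (T (a + b - 1 - j) j))
                        + ?s (\<lambda>j. scal (c j) (T (a + b - j) (j - 1))))
        + lvar_pow i 4 * ?s (\<lambda>j. scal (c j) (T (a + b - 2 - j) (j - 1)))"
    by (simp only: sum.distrib sum_distrib_left[symmetric])
  also have "?s (\<lambda>j. scal (c j) (T (a + b - j) (j - 1)))
      = ?s (\<lambda>j. scal (c (j + 1)) (T (a + b - 1 - j) j))"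
    using sum_shift_ZSq[of N "\<lambda>j. scal (c (j + 1)) (T (a + b - 1 - j) j)"] N
    by (simp add: c_def T_def ZSq_def Zbinom2_def algebra_simps)
  also have "?s (\<lambda>j. scal (c j) (T (a + b - 2 - j) (j - 1)))
      = ?s (\<lambda>j. scal (c (j + 1)) (T (a + b - 3 - j) j))"
    using sum_shift_ZSq[of N "\<lambda>j. scal (c (j + 1)) (T (a + b - 3 - j) j)"] N
    by (simp add: c_def T_def ZSq_def Zbinom2_def algebra_simps)
  also have "?s (\<lambda>j. scal (c j) (T (a + b - 1 - j) j))
        + ?s (\<lambda>j. scal (c (j + 1)) (T (a + b - 1 - j) j))
      = ?s (\<lambda>j. scal (c j + c (j + 1)) (T (a + b - 1 - j) j))"
    by (simp add: sum.distrib scal_add)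
  also have "(\<lambda>j. c j + c (j + 1))
      = (\<lambda>j. Zbinom2 (b - 1 - j) (a - 1 - 2 * j) + Zbinom2 (b - 1 - 1 - j) (a - 2 * j))"
  proof
    fix j
    have p1: "Zbinom2 (b - 1 - j) (a - 2 * j)
        = Zbinom2 (b - 2 - j) (a - 2 * j) + Zbinom2 (b - 2 - j) (a - 2 * j - 1)"
      using Zbinom2_Suc[of "b - 2 - j" "a - 2 * j"] by (simp add: algebra_simps)
    have p2: "Zbinom2 (b - 1 - j) (a - 1 - 2 * j)
        = Zbinom2 (b - 2 - j) (a - 2 * j - 1) + Zbinom2 (b - 2 - j) (a - 2 * j - 2)"
      using Zbinom2_Suc[of "b - 2 - j" "a - 2 * j - 1"] by (simp add: algebra_simps)
    have p3: "c (j + 1) = Zbinom2 (b - 2 - j) (a - 2 * j - 2)"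
      by (simp add: c_def algebra_simps)
    have p4: "x + y + z = y + z + x" for x y z :: bit by (simp add: ac_simps)
    show "c j + c (j + 1)
        = Zbinom2 (b - 1 - j) (a - 1 - 2 * j) + Zbinom2 (b - 1 - 1 - j) (a - 2 * j)"
      unfolding p2 p3 unfolding c_def p1 by (simp add: ac_simps)
  qed
  finally have *: "adem_sum N a b (lvar_pow i 1 * f) =
      lvar_pow i 1 * ?s (\<lambda>j. scal (c j) (T (a + b - j) j))
      + lvar_pow i 2 * ?s (\<lambda>j. scal (Zbinom2 (b - 1 - j) (a - 1 - 2 * j) + Zbinom2 (b - 1 - 1 - j) (a - 2 * j))
           (T (a + b - 1 - j) j))
      + lvar_pow i 4 * ?s (\<lambda>j. scal (c (j + 1)) (T (a + b - 3 - j) j))"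
    by meson
  show ?thesis
    unfolding * unfolding adem_sum_def c_def T_def scal_add sum.distrib
    by (simp add: algebra_simps)
qed

definition adem_defect :: "int \<Rightarrow> int \<Rightarrow> laurent \<Rightarrow> laurent"
  where "adem_defect a b f = ZSq a (ZSq b f) + adem_sum (\<bar>a\<bar> + 1) a b f"

lemma adem_defect_eq:
  assumes "N \<ge> 0" "a \<le> 2 * N + 1"
  shows "adem_defect a b f = ZSq a (ZSq b f) + adem_sum N a b f"
  unfolding adem_defect_def using assms by (simp add: adem_sum_large)

lemma adem_defect_lvar_mult:
  "adem_defect a b (lvar_pow i 1 * f) = lvar_pow i 1 * adem_defect a b f
    + lvar_pow i 2 * (adem_defect (a - 1) b f + adem_defect a (b - 1) f)
    + lvar_pow i 4 * adem_defect (a - 2) (b - 1) f"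
proof -
  define N where "N = \<bar>a\<bar> + 1"
  have N: "N \<ge> 0" "a < 2 * N" by (auto simp: N_def)
  have R: "adem_defect a' b' g = ZSq a' (ZSq b' g) + adem_sum N a' b' g" if "a' \<le> a" for a' b' g
    using that N by (intro adem_defect_eq) auto
  show ?thesis
    by (simp add: R adem_sum_lvar_mult[OF N] ZSq_ZSq_lvar_mult distrib_left add_ac)
qed

lemma adem_defect_neg: "a + b < 0 \<Longrightarrow> adem_defect a b f = 0"
  unfolding adem_defect_def adem_sum_def
  by (subst sum.neutral) (auto simp: ZSq_def)

lemma ZSq_one: "ZSq n 1 = (if n = 0 then 1 else 0)"
proof -
  have "Sq_op m 1 = (if m = 0 then 1 else 0)" for m
    unfolding single_one[symmetric] by (simp add: Sq_op_def total_Sq_def)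
  then show ?thesis by (simp add: ZSq_def)
qed

lemma adem_defect_one: "adem_defect a b 1 = 0"
proof -
  have "adem_sum (\<bar>a\<bar> + 1) a b 1 = scal (Zbinom2 (b - 1) a) (ZSq (a + b) 1)"
    unfolding adem_sum_def
    by (subst sum.mono_neutral_right[of _ "{0}"]) (auto simp: ZSq_one)
  moreover have "Zbinom2 (b - 1) a = (if a = 0 then 1 else 0)" if "a + b = 0"
  proof -
    have b: "b = - a" using that by simp
    consider "a < 0" | "a = 0" | m where "a = int (Suc m)"
      using nonneg_int_cases[of a] not0_implies_Suc by (metis linorder_not_le of_nat_0)
    then show ?thesis
      by cases (use binom2_central in \<open>auto simp: Zbinom2_def b simp del: of_nat_Suc\<close>)
  qed
  ultimately show ?thesis
    unfolding adem_defect_def by (auto simp: ZSq_one)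
qed

lemma adem_defect_lvar_iff:
  "(\<forall>a b. adem_defect a b (lvar_pow i 1 * f) = 0) \<longleftrightarrow> (\<forall>a b. adem_defect a b f = 0)"
proof
  assume "\<forall>a b. adem_defect a b f = 0"
  then show "\<forall>a b. adem_defect a b (lvar_pow i 1 * f) = 0"
    by (simp add: adem_defect_lvar_mult)
next
  assume L: "\<forall>a b. adem_defect a b (lvar_pow i 1 * f) = 0"
  have "adem_defect a b f = 0" for a b
  proof (induction "nat (a + b + 1)" arbitrary: a b rule: less_induct)
    case less
    show ?case
    proof (cases "a + b < 0")
      case True
      then show ?thesis by (rule adem_defect_neg)
    next
      case False
      have "adem_defect (a - 1) b f = 0" "adem_defect a (b - 1) f = 0"
           "adem_defect (a - 2) (b - 1) f = 0"
        using False by (auto intro!: less)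
      then have "lvar_pow i 1 * adem_defect a b f = 0"
        using L[rule_format, of a b] by (simp add: adem_defect_lvar_mult)
      then have "lvar_pow i (-1) * (lvar_pow i 1 * adem_defect a b f) = 0"
        by simp
      then show ?thesis
        by (simp add: mult.assoc[symmetric] lvar_pow_add[symmetric]) (simp add: lvar_pow_def)
    qed
  qed
  then show "\<forall>a b. adem_defect a b f = 0" by blast
qed

lemma adem_defect_lvar_pow_iff:
  "(\<forall>a b. adem_defect a b (lvar_pow i n * f) = 0) \<longleftrightarrow> (\<forall>a b. adem_defect a b f = 0)"
proof (induction n rule: int_induct[of _ 0])
  case base
  show ?case by (simp add: lvar_pow_def)
next
  case (step1 n)
  have "lvar_pow i (n + 1) * f = lvar_pow i 1 * (lvar_pow i n * f)"
    by (simp add: lvar_pow_add mult_ac)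
  then show ?case using step1 adem_defect_lvar_iff by metis
next
  case (step2 n)
  have "lvar_pow i n * f = lvar_pow i 1 * (lvar_pow i (n - 1) * f)"
    by (simp add: mult.assoc[symmetric] lvar_pow_add[symmetric])
  then show ?case using step2 adem_defect_lvar_iff by metis
qed

lemma adem_defect_basis: "adem_defect a b (basis e) = 0"
proof (induction e arbitrary: a b rule: update_induct)
  case const
  show ?case by (simp add: adem_defect_one)
next
  case (update e i n)
  have "Poly_Mapping.update i n e = Poly_Mapping.single i n + e"
    using update(1,2)
    by (intro poly_mapping_eqI) (auto simp: lookup_update lookup_add lookup_single when_def in_keys_iff)
  then have "basis (Poly_Mapping.update i n e) = lvar_pow i n * basis e"
    by (simp add: lvar_pow_def mult_single)
  then show ?case using update(3) adem_defect_lvar_pow_iff by metis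
qed

lemma adem_defect_add: "adem_defect a b (f + g) = adem_defect a b f + adem_defect a b g"
  by (simp add: adem_defect_def adem_sum_def scal_add_right sum.distrib add_ac)

lemma adem_defect_zero: "adem_defect a b f = 0"
proof (induction f rule: basis_induct)
  case zero
  show ?case by (simp add: adem_defect_def adem_sum_def)
next
  case (add e f)
  then show ?case by (simp add: adem_defect_add adem_defect_basis)
qed

lemma Sq_op_adem:
  assumes "b > 0" "a < 2 * b"
  shows "Sq_op a (Sq_op b f)
    = (\<Sum>j\<le>a div 2. if odd ((b - 1 - j) choose (a - 2 * j)) then Sq_op (a + b - j) (Sq_op j f) else 0)"
proof -
  have "ZSq (int a) (ZSq (int b) f) = adem_sum (int a) (int a) (int b) f"
    using adem_defect_zero[of "int a" "int b" f] adem_defect_eq[of "int a" "int a" "int b" f]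
    by (simp add: eq_neg_iff_add_eq_0[symmetric])
  also have "\<dots> = (\<Sum>j\<in>{0..int a div 2}. scal (Zbinom2 (int b - 1 - j) (int a - 2 * j))
      (ZSq (int a + int b - j) (ZSq j f)))"
    by (rule adem_sum_large) auto
  also have "\<dots> = (\<Sum>j\<le>a div 2. if odd ((b - 1 - j) choose (a - 2 * j))
      then Sq_op (a + b - j) (Sq_op j f) else 0)"
  proof (rule sum.reindex_bij_witness[of _ int nat])
    fix j assume "j \<in> {0..int a div 2}"
    then obtain m where j: "j = int m" and m: "m \<le> a div 2"
      by (metis atLeastAtMost_iff nonneg_int_cases of_nat_div of_nat_le_iff of_nat_numeral)
    have e: "int b - 1 - j = int (b - 1 - m)" "int a - 2 * j = int (a - 2 * m)"
      "int a + int b - j = int (a + b - m)"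
      using m assms by (auto simp: j)
    have "scal (of_nat k) g = (if odd k then g else 0)" for k :: nat and g
      by (cases "odd k") (auto simp: scal_def elim!: evenE oddE)
    then show "(if odd ((b - 1 - nat j) choose (a - 2 * nat j))
        then Sq_op (a + b - nat j) (Sq_op (nat j) f) else 0)
      = scal (Zbinom2 (int b - 1 - j) (int a - 2 * j)) (ZSq (int a + int b - j) (ZSq j f))"
      unfolding e by (simp add: Zbinom2_def ZSq_def binom2_of_nat j)
  qed (auto simp: of_nat_div[symmetric] nat_le_iff zdiv_int)
  finally show ?thesis by (simp add: ZSq_def)
qed


section \<open>The mod-2 Steenrod algebra\<close>

text \<open>
  The free associative \<open>\<bbbF>\<^sub>2\<close>-algebra on letters \<open>Sq\<^sup>0, Sq\<^sup>1, \<dots>\<close> is the monoid algebra of the words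
  in these letters (the product of \<^typ>\<open>'a \<Rightarrow>\<^sub>0 bit\<close> is convolution along \<open>+\<close>).
\<close>

datatype sq_word = Sq_Word (letters: "nat list")

instantiation sq_word :: monoid_add
begin

definition zero_sq_word :: sq_word
  where "0 = Sq_Word []"

definition plus_sq_word :: "sq_word \<Rightarrow> sq_word \<Rightarrow> sq_word"
  where "u + v = Sq_Word (letters u @ letters v)"

instance
  by standard (simp_all add: zero_sq_word_def plus_sq_word_def)

end

type_synonym free_sq = "sq_word \<Rightarrow>\<^sub>0 bit"

definition adem_relator :: "nat \<Rightarrow> nat \<Rightarrow> free_sq"
  where "adem_relator a b = basis (Sq_Word [a, b]) -
    (\<Sum>j\<le>a div 2. Poly_Mapping.single (Sq_Word [a + b - j, j]) (of_nat ((b - 1 - j) choose (a - 2 * j))))"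

definition steenrod_relators :: "free_sq set"
  where "steenrod_relators = insert (basis (Sq_Word [0]) - 1) {adem_relator a b | a b. 0 < a \<and> a < 2 * b}"

definition adem_ideal :: "free_sq set"
  where "adem_ideal = group_closure {u * r * v | u r v. r \<in> steenrod_relators}"

lemma adem_ideal_add: "x \<in> adem_ideal \<Longrightarrow> y \<in> adem_ideal \<Longrightarrow> x + y \<in> adem_ideal"
  unfolding adem_ideal_def by (rule group_closure_add)

lemma adem_ideal_induct [consumes 1, case_names zero relator add]:
  assumes "x \<in> adem_ideal" and "P 0"
    and "\<And>u r v. r \<in> steenrod_relators \<Longrightarrow> P (u * r * v)"
    and "\<And>x y. P x \<Longrightarrow> P y \<Longrightarrow> P (x + y)"
  shows "P x"
  using assms(1) unfolding adem_ideal_def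
proof (induction rule: group_closure.induct)
  case (base s)
  then show ?case using assms(2,3) by auto
next
  case (diff s t)
  then show ?case using assms(4) by simp
qed

lemma adem_ideal_mult_left: "x \<in> adem_ideal \<Longrightarrow> z * x \<in> adem_ideal"
proof (induction rule: adem_ideal_induct)
  case (relator u r v)
  have "z * (u * r * v) = (z * u) * r * v" by (simp add: mult.assoc)
  with relator show ?case
    unfolding adem_ideal_def by (intro group_closure.base) blast
next
  case (add x y)
  then show ?case by (simp add: distrib_left adem_ideal_add)
qed (simp add: adem_ideal_def)

lemma adem_ideal_mult_right: "x \<in> adem_ideal \<Longrightarrow> x * z \<in> adem_ideal"
proof (induction rule: adem_ideal_induct)
  case (relator u r v)
  have "(u * r * v) * z = u * r * (v * z)" by (simp add: mult.assoc)
  with relator show ?case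
    unfolding adem_ideal_def by (intro group_closure.base) blast
next
  case (add x y)
  then show ?case by (simp add: distrib_right adem_ideal_add)
qed (simp add: adem_ideal_def)


subsection \<open>Augmentation and action on Laurent polynomials, before passing to the quotient\<close>

definition free_augment :: "free_sq \<Rightarrow> bit"
  where "free_augment = lin (\<lambda>w. if set (letters w) \<subseteq> {0} then 1 else 0)"

lemma free_augment_add: "free_augment (x + y) = free_augment x + free_augment y"
  unfolding free_augment_def by (rule lin_add) simp

lemma free_augment_mult: "free_augment (x * y) = free_augment x * free_augment y"
proof (induction x rule: basis_induct)
  case (add u x)
  have "free_augment (basis u * y) = free_augment (basis u) * free_augment y"
  proof (induction y rule: basis_induct)
    case (add v y)
    have "free_augment (basis u * basis v) = free_augment (basis u) * free_augment (basis v)"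
      by (simp add: mult_single free_augment_def plus_sq_word_def)
    with add show ?case by (simp add: free_augment_add distrib_left)
  qed (simp add: free_augment_def)
  with add show ?case by (simp add: free_augment_add distrib_right)
qed (simp add: free_augment_def)

lemma free_augment_single:
  "free_augment (Poly_Mapping.single w c) = (if set (letters w) \<subseteq> {0} then c else 0)"
  by (cases c) (simp_all add: free_augment_def)

lemma free_augment_relator:
  assumes "r \<in> steenrod_relators"
  shows "free_augment r = 0"
  using assms unfolding steenrod_relators_def
proof (elim insertE CollectE exE conjE)
  assume "r = basis (Sq_Word [0]) - 1"
  then show ?thesis
    by (simp add: free_augment_add free_augment_single)
       (simp add: free_augment_def zero_sq_word_def)
next
  fix a b assume r: "r = adem_relator a b" and ab: "0 < a" "a < 2 * b"
  have "free_augment (\<Sum>j\<in>J. Poly_Mapping.single (Sq_Word [a + b - j, j]) (c j)) = 0"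
    if "J \<subseteq> {..a div 2}" for J c
    using that ab
    by (induction J rule: infinite_finite_induct)
       (auto simp: free_augment_add free_augment_single, simp_all add: free_augment_def)
  from this[of "{..a div 2}"] show ?thesis
    unfolding r adem_relator_def using ab
    by (simp add: free_augment_add free_augment_single)
qed

lemma free_augment_ideal: "x \<in> adem_ideal \<Longrightarrow> free_augment x = 0"
proof (induction rule: adem_ideal_induct)
  case zero
  show ?case by (simp add: free_augment_def)
qed (simp_all add: free_augment_add free_augment_mult free_augment_relator)

definition free_act :: "free_sq \<Rightarrow> laurent \<Rightarrow> laurent"
  where "free_act x f = lin (\<lambda>w. foldr Sq_op (letters w) f) x"

lemma free_act_add: "free_act (x + y) f = free_act x f + free_act y f"
  unfolding free_act_def by (rule lin_add) simp

lemma free_act_0 [simp]: "free_act 0 f = 0"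
  by (simp add: free_act_def)

lemma free_act_basis: "free_act (basis w) f = foldr Sq_op (letters w) f"
  by (simp add: free_act_def)

lemma free_act_single: "free_act (Poly_Mapping.single w c) f = scal c (foldr Sq_op (letters w) f)"
  by (cases c) (simp_all add: free_act_basis)

lemma free_act_add_right: "free_act x (f + g) = free_act x f + free_act x g"
proof (induction x rule: basis_induct)
  case (add w x)
  have "foldr Sq_op ns (f + g) = foldr Sq_op ns f + foldr Sq_op ns g" for ns
    by (induction ns) simp_all
  with add show ?case by (simp add: free_act_add free_act_basis)
qed simp

lemma free_act_0_right [simp]: "free_act x 0 = 0"
  using free_act_add_right[of x 0 0] by simp

lemma free_act_mult: "free_act (x * y) f = free_act x (free_act y f)"
proof (induction x rule: basis_induct)
  case (add u x)
  have "free_act (basis u * y) f = free_act (basis u) (free_act y f)"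
  proof (induction y rule: basis_induct)
    case (add v y)
    have "free_act (basis u * basis v) f = free_act (basis u) (free_act (basis v) f)"
      by (simp add: mult_single free_act_basis plus_sq_word_def)
    with add show ?case by (simp add: free_act_add free_act_add_right distrib_left)
  qed simp
  with add show ?case by (simp add: free_act_add distrib_right)
qed simp

lemma Sq_op_0_id [simp]: "Sq_op 0 f = f"
proof (induction f rule: basis_induct)
  case (add e f)
  have "fps_nth (\<Prod>i\<in>I. total_Sq1 i (a i)) 0 = (\<Prod>i\<in>I. lvar_pow i (a i))" for I a
    by (induction I rule: infinite_finite_induct) (simp_all add: total_Sq1_def)
  then have "fps_nth (total_Sq e) 0 = (\<Prod>i\<in>Poly_Mapping.keys e. lvar_pow i (Poly_Mapping.lookup e i))"
    by (simp add: total_Sq_def)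
  also have "\<dots> = basis (\<Sum>i\<in>Poly_Mapping.keys e. Poly_Mapping.single i (Poly_Mapping.lookup e i))"
  proof -
    have "(\<Prod>i\<in>I. lvar_pow i (a i)) = basis (\<Sum>i\<in>I. Poly_Mapping.single i (a i))" for I a
      by (induction I rule: infinite_finite_induct) (simp_all add: lvar_pow_def mult_single)
    then show ?thesis .
  qed
  also have "(\<Sum>i\<in>Poly_Mapping.keys e. Poly_Mapping.single i (Poly_Mapping.lookup e i)) = e"
    by (rule poly_mapping_eqI) (auto simp: lookup_sum lookup_single when_def in_keys_iff)
  finally have "Sq_op 0 (basis e) = basis e" by (simp add: Sq_op_def)
  with add show ?case by (simp only: Sq_op_add)
qed simp

lemma free_act_relator:
  assumes "r \<in> steenrod_relators"
  shows "free_act r f = 0"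
  using assms unfolding steenrod_relators_def
proof (elim insertE CollectE exE conjE)
  assume "r = basis (Sq_Word [0]) - 1"
  then show ?thesis
    by (simp add: free_act_add free_act_basis) (simp add: free_act_def zero_sq_word_def)
next
  fix a b assume r: "r = adem_relator a b" and ab: "0 < a" "a < 2 * b"
  have "free_act (\<Sum>j\<in>J. x j) f = (\<Sum>j\<in>J. free_act (x j) f)" for x and J :: "nat set"
    by (induction J rule: infinite_finite_induct) (simp_all add: free_act_add)
  moreover have "scal (of_nat k) g = (if odd k then g else 0)" for k :: nat and g
    by (cases "odd k") (auto simp: scal_def elim!: evenE oddE)
  ultimately show ?thesis
    unfolding r adem_relator_def using Sq_op_adem[of b a f] ab
    by (simp add: free_act_add free_act_basis free_act_single)
qed

lemma free_act_ideal: "x \<in> adem_ideal \<Longrightarrow> free_act x f = 0"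
  by (induction rule: adem_ideal_induct) (simp_all add: free_act_add free_act_mult free_act_relator)


subsection \<open>The quotient by the Adem relations\<close>

definition steenrod_eq :: "free_sq \<Rightarrow> free_sq \<Rightarrow> bool"
  where "steenrod_eq x y \<longleftrightarrow> x - y \<in> adem_ideal"

quotient_type steenrod = free_sq / steenrod_eq
proof (rule equivpI)
  show "reflp steenrod_eq"
    by (simp add: reflp_def steenrod_eq_def adem_ideal_def)
  show "symp steenrod_eq"
    by (simp add: symp_def steenrod_eq_def add.commute)
  show "transp steenrod_eq"
  proof (rule transpI)
    fix x y z assume "steenrod_eq x y" "steenrod_eq y z"
    then have "(x + y) + (y + z) \<in> adem_ideal"
      by (simp add: steenrod_eq_def adem_ideal_add)
    moreover have "(x + y) + (y + z) = x + (y + y) + z" by (simp only: add.assoc)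
    ultimately show "steenrod_eq x z" by (simp add: steenrod_eq_def)
  qed
qed

instantiation steenrod :: ring_1
begin

lift_definition zero_steenrod :: steenrod is 0 .
lift_definition one_steenrod :: steenrod is 1 .

lift_definition plus_steenrod :: "steenrod \<Rightarrow> steenrod \<Rightarrow> steenrod" is "(+)"
proof -
  fix x x' y y' assume "steenrod_eq x x'" "steenrod_eq y y'"
  then have "(x + x') + (y + y') \<in> adem_ideal"
    by (simp add: steenrod_eq_def adem_ideal_add)
  then show "steenrod_eq (x + y) (x' + y')" by (simp add: steenrod_eq_def add_ac)
qed

lift_definition uminus_steenrod :: "steenrod \<Rightarrow> steenrod" is uminus
  by simp

lift_definition minus_steenrod :: "steenrod \<Rightarrow> steenrod \<Rightarrow> steenrod" is "(-)"
proof -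
  fix x x' y y' assume "steenrod_eq x x'" "steenrod_eq y y'"
  then have "(x + x') + (y + y') \<in> adem_ideal"
    by (simp add: steenrod_eq_def adem_ideal_add)
  then show "steenrod_eq (x - y) (x' - y')" by (simp add: steenrod_eq_def add_ac)
qed

lift_definition times_steenrod :: "steenrod \<Rightarrow> steenrod \<Rightarrow> steenrod" is "(*)"
proof -
  fix x x' y y' assume "steenrod_eq x x'" "steenrod_eq y y'"
  then have "(x + x') * y + x' * (y + y') \<in> adem_ideal"
    by (simp add: steenrod_eq_def adem_ideal_add adem_ideal_mult_left adem_ideal_mult_right)
  moreover have "(x + x') * y + x' * (y + y') = x * y + (x' * y + x' * y) + x' * y'"
    by (simp only: distrib_left distrib_right add.assoc)
  ultimately show "steenrod_eq (x * y) (x' * y')" by (simp add: steenrod_eq_def)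
qed

instance
proof
  have refl: "steenrod_eq x x" for x by (simp add: steenrod_eq_def adem_ideal_def)
  fix a b c :: steenrod
  show "a * b * c = a * (b * c)" by transfer (simp add: mult.assoc refl)
  show "a + b + c = a + (b + c)" by transfer (simp add: add.assoc refl)
  show "a + b = b + a" by transfer (simp add: add.commute refl del: pm_double)
  show "0 + a = a" by transfer (simp add: refl del: pm_double)
  show "- a + a = 0" by transfer (simp add: steenrod_eq_def adem_ideal_def)
  show "a - b = a + - b" by transfer (simp add: refl)
  show "(a + b) * c = a * c + b * c" by transfer (simp only: distrib_right refl)
  show "a * (b + c) = a * b + a * c" by transfer (simp only: distrib_left refl)
  show "1 * a = a" by transfer (simp add: refl)
  show "a * 1 = a" by transfer (simp add: refl)
  show "(0::steenrod) \<noteq> 1"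
  proof transfer
    have "free_augment 1 = 1" by (simp add: free_augment_def zero_sq_word_def)
    then show "\<not> steenrod_eq 0 1"
      using free_augment_ideal[of 1] by (auto simp: steenrod_eq_def)
  qed
qed

end

lift_definition Sq :: "nat \<Rightarrow> steenrod" is "\<lambda>n. basis (Sq_Word [n])" .

lift_definition augment :: "steenrod \<Rightarrow> bit" is free_augment
proof -
  fix x y assume "steenrod_eq x y"
  then have "free_augment (x + y) = 0" by (simp add: steenrod_eq_def free_augment_ideal)
  then show "free_augment x = free_augment y"
    by (cases "free_augment x"; cases "free_augment y") (simp_all add: free_augment_add)
qed

lift_definition act :: "steenrod \<Rightarrow> laurent \<Rightarrow> laurent" is free_act
proof -
  fix x y assume "steenrod_eq x y"
  then have "free_act (x + y) f = 0" for f by (simp add: steenrod_eq_def free_act_ideal)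
  then have "free_act x f + free_act y f = 0" for f by (simp add: free_act_add)
  then show "free_act x = free_act y"
    by (metis (no_types) ext add.assoc add.right_neutral pm_double)
qed

definition steenrod_part :: "int \<Rightarrow> steenrod set"
  where "steenrod_part d = group_closure {prod_list (map Sq ns) | ns. int (sum_list ns) = d}"

lemma Sq_0: "Sq 0 = 1"
proof transfer
  have "1 * (basis (Sq_Word [0]) - 1) * 1 \<in> adem_ideal"
    unfolding adem_ideal_def steenrod_relators_def by (intro group_closure.base) blast
  then show "steenrod_eq (basis (Sq_Word [0])) 1" by (simp add: steenrod_eq_def)
qed

lemma Sq_adem:
  assumes "0 < a" "a < 2 * b"
  shows "Sq a * Sq b = (\<Sum>j\<le>a div 2. of_nat ((b - 1 - j) choose (a - 2 * j)) * (Sq (a + b - j) * Sq j))"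
proof -
  have add: "abs_steenrod (x + y) = abs_steenrod x + abs_steenrod y" for x y
    by (simp add: plus_steenrod.abs_eq)
  have zero: "abs_steenrod 0 = 0" by (simp add: zero_steenrod_def)
  have sum: "abs_steenrod (\<Sum>j\<in>J. x j) = (\<Sum>j\<in>J. abs_steenrod (x j))" for x and J :: "nat set"
    by (induction J rule: infinite_finite_induct) (simp_all add: add zero)
  have single: "abs_steenrod (Poly_Mapping.single w (of_nat k)) = of_nat k * abs_steenrod (basis w)" for w k
    by (induction k) (simp_all add: zero add single_add distrib_right)
  have word: "abs_steenrod (basis (Sq_Word [m, n])) = Sq m * Sq n" for m n
    by (simp add: Sq.abs_eq times_steenrod.abs_eq mult_single plus_sq_word_def)
  have "1 * adem_relator a b * 1 \<in> adem_ideal"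
    unfolding adem_ideal_def steenrod_relators_def using assms by (intro group_closure.base) blast
  then have "abs_steenrod (basis (Sq_Word [a, b])) = abs_steenrod
      (\<Sum>j\<le>a div 2. Poly_Mapping.single (Sq_Word [a + b - j, j]) (of_nat ((b - 1 - j) choose (a - 2 * j))))"
    by (simp add: steenrod.abs_eq_iff steenrod_eq_def adem_relator_def)
  then show ?thesis by (simp add: sum single word)
qed

lemma act_Sq: "act (Sq n) f = Sq_op n f"
  by transfer (simp add: free_act_basis)

lemma act_one: "act 1 f = f"
  by transfer (simp add: free_act_def zero_sq_word_def)

lemma act_mult: "act (a * b) f = act a (act b f)"
  by transfer (rule free_act_mult)

lemma act_add_left: "act (a + b) f = act a f + act b f"
  by transfer (rule free_act_add)

lemma act_add_right: "act a (f + g) = act a f + act a g"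
  by transfer (rule free_act_add_right)

section \<open>Tor over the Steenrod algebra\<close>

text \<open>
  A graded left module is given by an action on an ambient abelian group and a family \<open>M\<close> of
  homogeneous parts. \<open>Tor\<^sub>n(\<bbbF>\<^sub>2, M)\<^sub>d\<close> is the homology of the (unnormalised) bar complex
  \<open>B\<^sub>n(M) = \<bbbF>\<^sub>2 \<otimes>\<^sub>A (A \<otimes> A\<^bsup>\<otimes>n\<^esup> \<otimes> M) = A\<^bsup>\<otimes>n\<^esup> \<otimes> M\<close> in internal degree \<open>d\<close>. The tensor product is the quotient of
  the space \<open>bar_chains\<close> of formal sums of symbols \<open>[a\<^sub>1|\<dots>|a\<^sub>n]m\<close> by the space \<open>bar_relations\<close> of
  multilinearity relations. We do not form this quotient: a homology class is a coset in
  \<open>bar_chains\<close>, of the formal cycles modulo the sum of the boundaries and the relations.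
\<close>

type_synonym 'm bar = "(steenrod list \<times> 'm) \<Rightarrow>\<^sub>0 bit"

definition bar_symbols :: "(int \<Rightarrow> 'm set) \<Rightarrow> nat \<Rightarrow> int \<Rightarrow> (steenrod list \<times> 'm) set"
  where "bar_symbols M n d = {(as, m). length as = n \<and>
    (\<exists>ds e. list_all2 (\<lambda>a i. a \<in> steenrod_part i) as ds \<and> m \<in> M e \<and> sum_list ds + e = d)}"

definition bar_chains :: "(int \<Rightarrow> 'm set) \<Rightarrow> nat \<Rightarrow> int \<Rightarrow> 'm bar set"
  where "bar_chains M n d = {x. Poly_Mapping.keys x \<subseteq> bar_symbols M n d}"

definition bar_relations :: "(int \<Rightarrow> 'm::ab_group_add set) \<Rightarrow> nat \<Rightarrow> int \<Rightarrow> 'm bar set"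
  where "bar_relations M n d = group_closure
    ({basis (us @ (a + b) # vs, m) - basis (us @ a # vs, m) - basis (us @ b # vs, m) | us a b vs m.
        {(us @ (a + b) # vs, m), (us @ a # vs, m), (us @ b # vs, m)} \<subseteq> bar_symbols M n d} \<union>
     {basis (as, m + m') - basis (as, m) - basis (as, m') | as m m'.
        {(as, m + m'), (as, m), (as, m')} \<subseteq> bar_symbols M n d})"

text \<open>
  \<open>\<partial>[a\<^sub>1|\<dots>|a\<^sub>n]m = \<epsilon>(a\<^sub>1)[a\<^sub>2|\<dots>|a\<^sub>n]m + \<Sum>\<^sub>i [a\<^sub>1|\<dots>|a\<^sub>i a\<^sub>i\<^sub>+\<^sub>1|\<dots>|a\<^sub>n]m + [a\<^sub>1|\<dots>|a\<^sub>n\<^sub>-\<^sub>1](a\<^sub>n m)\<close>; there are no signs in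
  characteristic 2.
\<close>

definition bar_boundary :: "(steenrod \<Rightarrow> 'm \<Rightarrow> 'm) \<Rightarrow> 'm bar \<Rightarrow> 'm bar"
  where "bar_boundary ac = lin (\<lambda>(as, m). if as = [] then 0 else
      Poly_Mapping.single (tl as, m) (augment (hd as))
      + (\<Sum>i<length as - 1. basis (take i as @ (as ! i * as ! Suc i) # drop (i + 2) as, m))
      + basis (butlast as, ac (last as) m))"

definition bar_cycles :: "(steenrod \<Rightarrow> 'm::ab_group_add \<Rightarrow> 'm) \<Rightarrow> (int \<Rightarrow> 'm set) \<Rightarrow> nat \<Rightarrow> int \<Rightarrow> 'm bar set"
  where "bar_cycles ac M n d = {z \<in> bar_chains M n d. bar_boundary ac z \<in> bar_relations M (n - 1) d}"

definition bar_boundaries :: "(steenrod \<Rightarrow> 'm::ab_group_add \<Rightarrow> 'm) \<Rightarrow> (int \<Rightarrow> 'm set) \<Rightarrow> nat \<Rightarrow> int \<Rightarrow> 'm bar set"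
  where "bar_boundaries ac M n d =
    {bar_boundary ac y + r | y r. y \<in> bar_chains M (Suc n) d \<and> r \<in> bar_relations M n d}"

definition Tor :: "(steenrod \<Rightarrow> 'm::ab_group_add \<Rightarrow> 'm) \<Rightarrow> (int \<Rightarrow> 'm set) \<Rightarrow> nat \<Rightarrow> int \<Rightarrow> 'm bar set set"
  where "Tor ac M n d = {(+) z ` bar_boundaries ac M n d | z. z \<in> bar_cycles ac M n d}"

definition desuspend :: "nat \<Rightarrow> (int \<Rightarrow> 'm set) \<Rightarrow> int \<Rightarrow> 'm set"
  where "desuspend n M d = M (d + int n)"

lemma bar_symbols_desuspend: "bar_symbols (desuspend k M) n d = bar_symbols M n (d + int k)"
proof -
  have "(\<exists>ds e. L ds \<and> m \<in> M (e + int k) \<and> sum_list ds + e = d) \<longleftrightarrow>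
      (\<exists>ds e. L ds \<and> m \<in> M e \<and> sum_list ds + e = d + int k)" for L m
    by (metis (no_types, opaque_lifting) add.assoc add_right_imp_eq diff_add_cancel)
  then show ?thesis unfolding bar_symbols_def desuspend_def by simp
qed

lemma Tor_desuspend: "Tor ac (desuspend k M) n d = Tor ac M n (d + int k)"
  by (simp add: Tor_def bar_cycles_def bar_boundaries_def bar_chains_def bar_relations_def
      bar_symbols_desuspend)

text \<open>
  For a short exact sequence \<open>0 \<rightarrow> L \<rightarrow> M \<rightarrow> N \<rightarrow> 0\<close> with \<open>L\<close> a submodule of \<open>M\<close> and quotient map \<open>p\<close>,
  the connecting homomorphism \<open>Tor\<^sub>n\<^sub>+\<^sub>1(\<bbbF>\<^sub>2, N)\<^sub>d \<rightarrow> Tor\<^sub>n(\<bbbF>\<^sub>2, L)\<^sub>d\<close> of the snake lemma: lift a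
  representative of the class \<open>c\<close> along \<open>p\<close> to a chain \<open>y\<close> of \<open>M\<close> and take its boundary. The
  elements obtained from all representatives and all lifts form exactly the image coset.
\<close>

definition connecting :: "(steenrod \<Rightarrow> 'm::ab_group_add \<Rightarrow> 'm) \<Rightarrow> (int \<Rightarrow> 'm set) \<Rightarrow> (int \<Rightarrow> 'm set) \<Rightarrow>
    ('m \<Rightarrow> 'n) \<Rightarrow> nat \<Rightarrow> int \<Rightarrow> 'n bar set \<Rightarrow> 'm bar set"
  where "connecting ac L M p n d c =
    {x \<in> bar_cycles ac L n d. \<exists>y \<in> bar_chains M (Suc n) d.
       lin (\<lambda>(as, m). basis (as, p m)) y \<in> c \<and> x - bar_boundary ac y \<in> bar_relations M n d}"


section \<open>The hit problem and the Singer transfer\<close>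

definition poly_part :: "nat \<Rightarrow> int \<Rightarrow> laurent set"
  where "poly_part k d = {f. \<forall>e\<in>Poly_Mapping.keys f.
    Poly_Mapping.keys e \<subseteq> {..<k} \<and> (\<forall>i<k. 0 \<le> Poly_Mapping.lookup e i) \<and> total_degree e = d}"

text \<open>The homogeneous part of \<open>A\<^sup>+ P\<^sub>k\<close>, where \<open>A\<^sup>+\<close> is the augmentation ideal.\<close>

definition hit_part :: "nat \<Rightarrow> int \<Rightarrow> laurent set"
  where "hit_part k d =
    group_closure {act a f | a f. augment a = 0 \<and> (\<exists>e. f \<in> poly_part k e)} \<inter> poly_part k d"

definition QP :: "nat \<Rightarrow> int \<Rightarrow> laurent set set"
  where "QP k d = {(+) f ` hit_part k d | f. f \<in> poly_part k d}"

definition GL :: "nat \<Rightarrow> bit mat set"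
  where "GL k = {g \<in> carrier_mat k k. invertible_mat g}"

text \<open>The linear substitution \<open>x\<^sub>j \<mapsto> \<Sum>\<^sub>i g\<^sub>i\<^sub>j x\<^sub>i\<close>, used on polynomials only.\<close>

definition substitute :: "bit mat \<Rightarrow> laurent \<Rightarrow> laurent"
  where "substitute g = lin (\<lambda>e. \<Prod>j\<in>Poly_Mapping.keys e.
    (\<Sum>i<dim_row g. Poly_Mapping.single 0 (g $$ (i, j)) * lvar_pow i 1) ^ nat (Poly_Mapping.lookup e j))"

definition QP_invariants :: "nat \<Rightarrow> int \<Rightarrow> laurent set set"
  where "QP_invariants k d = {c \<in> QP k d. \<forall>g\<in>GL k. substitute g ` c = c}"

text \<open>
  \<open>P\<^sub>j \<otimes> Q\<close>, where \<open>Q\<close> is the span of the powers \<open>x\<^sup>i\<close> of one variable with \<open>i \<ge> -1\<close>, realised as the span of the Laurent monomials in \<open>x\<^sub>0, \<dots>, x\<^sub>j\<close> whose exponents are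
  nonnegative except that of \<open>x\<^sub>j\<close>, which may also be \<open>-1\<close>. Its quotient map onto \<open>\<Sigma>\<^sup>-\<^sup>1P\<^sub>j\<close> extracts
  the coefficient of \<open>x\<^sub>j\<^sup>-\<^sup>1\<close>; the kernel is \<open>P\<^sub>j\<^sub>+\<^sub>1\<close>.
\<close>

definition poly_hat_part :: "nat \<Rightarrow> int \<Rightarrow> laurent set"
  where "poly_hat_part j d = {f. \<forall>e\<in>Poly_Mapping.keys f.
    Poly_Mapping.keys e \<subseteq> {..j} \<and> (\<forall>i<j. 0 \<le> Poly_Mapping.lookup e i) \<and>
    -1 \<le> Poly_Mapping.lookup e j \<and> total_degree e = d}"

definition residue_at :: "nat \<Rightarrow> laurent \<Rightarrow> laurent"
  where "residue_at j = lin (\<lambda>e. if Poly_Mapping.lookup e j = -1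
    then basis (e + Poly_Mapping.single j 1) else 0)"

text \<open>
  \<open>transfer_chain k d j\<close> is the composite of the first \<open>j\<close> connecting homomorphisms, from
  \<open>Tor\<^sub>k(\<bbbF>\<^sub>2, \<Sigma>\<^sup>-\<^sup>k\<bbbF>\<^sub>2)\<^sub>d\<close> to \<open>Tor\<^sub>k\<^sub>-\<^sub>j(\<bbbF>\<^sub>2, \<Sigma>\<^sup>-\<^sup>(\<^sup>k\<^sup>-\<^sup>j\<^sup>)P\<^sub>j)\<^sub>d\<close>; the module \<open>\<bbbF>\<^sub>2\<close> is \<open>P\<^sub>0\<close>.
\<close>

primrec transfer_chain :: "nat \<Rightarrow> int \<Rightarrow> nat \<Rightarrow> laurent bar set \<Rightarrow> laurent bar set"
  where
    "transfer_chain k d 0 c = c"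
  | "transfer_chain k d (Suc j) c =
      connecting act (desuspend (k - Suc j) (poly_part (Suc j)))
        (desuspend (k - Suc j) (poly_hat_part j)) (residue_at j) (k - Suc j) d
        (transfer_chain k d j c)"

text \<open>
  \<open>Tor\<^sub>0(\<bbbF>\<^sub>2, P\<^sub>k) = QP\<^sub>k\<close> is induced by \<open>[]f \<mapsto> f\<close>, which maps cosets of \<open>bar_boundaries\<close> onto cosets
  of \<^const>\<open>hit_part\<close>.
\<close>

definition singer_transfer :: "nat \<Rightarrow> int \<Rightarrow> laurent bar set \<Rightarrow> laurent set"
  where "singer_transfer k d c = lin snd ` transfer_chain k d k c"

definition Tor_F2 :: "nat \<Rightarrow> int \<Rightarrow> laurent bar set set"
  where "Tor_F2 = Tor act (poly_part 0)"

end

theory Submission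
  imports Defs "HOL-Library.Code_Binary_Nat"
begin

text \<open>
  On the bar complex the connecting homomorphisms can be followed explicitly: every class in the
  image of the transfer is represented by a polynomial \<open>f\<close> such that \<open>v f + f\<close> is hit for the
  standard generators \<open>v\<close> of \<open>GL\<^sub>5\<close>. It turns out that every such \<open>f\<close> of degree \<open>d = 7 * 2\<^sup>s - 5\<close> is
  hit, so both sides consist of the zero class only.

  For \<open>s \<ge> 3\<close> every monomial of degree \<open>d\<close> with an even exponent is hit, because
  \<open>x\<^sub>S g\<^sup>2 = x\<^sub>S Sq\<^sup>m g\<close> with \<open>m = deg g\<close>, and moving \<open>Sq\<^sup>m\<close> onto \<open>x\<^sub>S\<close> leaves nothing
  unless \<open>m\<close> is a sum of \<open>|S|\<close> numbers of the form \<open>2\<^sup>j - 1\<close>. Hence Kameko's homomorphism reduces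
  degree \<open>d\<close> to \<open>(d - 5) / 2 = 7 * 2\<^sup>s\<^sup>-\<^sup>1 - 5\<close>.

  In the remaining degrees 9 and 23 extend scalars to the field with 32 elements, where the normaliser
  of a Singer cycle in \<open>GL\<^sub>5\<close>, of odd order 155, acts on suitable coordinates by scaling and by
  cyclic shifts. Averaging turns \<open>f\<close> into a combination of orbit sums of monomials \<open>y\<^sup>m\<close> with
  \<open>31\<close> dividing \<open>\<Sum> m\<^sub>i 2\<^sup>i\<close>. A certificate expresses these modulo hit elements by two (degree 9) or
  eight (degree 23) of them, and since coefficients of spikes vanish on hit elements, comparing
  them for \<open>f\<close> and for \<open>f\<close> with permuted variables shows that the combination is zero.
\<close>

section \<open>Polynomials and hit polynomials\<close>

text \<open>Since the target turns out to be zero, no class in Tor has to be constructed. The bar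
  complex is still essential: the transfer is a composite of relations between sets of formal
  chains, and its value on each class must be shown to be one full coset, fixed by the generators.
  Degrees 9 and 23 escape the halving step because of monomials with three odd exponents: there
  \<open>m\<close> is 3 = 3 + 0 + 0 or 10 = 7 + 3 + 0, a sum of three numbers
  \<open>2^j - 1\<close>. There are 17550 monomials of degree 23 in five variables. Averaging over
  all of GL_5 is impossible in characteristic 2, since its order is even; a subgroup of odd order is
  the substitute, and 155 shrinks the linear algebra by roughly this factor. Its elements of order
  31 have no eigenvectors over F_2, and F_32 is the field containing their eigenvalues. The price is
  that invariance under the rest of GL_5 is lost and has to be brought back, which the comparison
  under permuted variables does.\<close>

abbreviation xv :: "nat \<Rightarrow> laurent"
  where "xv i \<equiv> lvar_pow i 1"

lemma group_closure_pm_induct [consumes 1, case_names zero base add]: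
  assumes "x \<in> group_closure S" and "P 0" and "\<And>s. s \<in> S \<Longrightarrow> P s"
    and "\<And>x y. P x \<Longrightarrow> P y \<Longrightarrow> P (x + y)"
  shows "P (x :: 'a \<Rightarrow>\<^sub>0 bit)"
  using assms(1)
proof (induction rule: group_closure.induct)
  case (base s)
  then show ?case using assms(2,3) by auto
next
  case (diff s t)
  then show ?case using assms(4) by simp
qed

lemma group_closure_sum: "(\<And>i. i \<in> I \<Longrightarrow> f i \<in> group_closure S) \<Longrightarrow> sum f I \<in> group_closure S"
  by (induction I rule: infinite_finite_induct) (auto intro: group_closure_add)

lemma pm_add_cancel [simp]: "(x :: 'a \<Rightarrow>\<^sub>0 bit) + (x + y) = y"
  by (simp add: add.assoc[symmetric])

lemma pm_eq_iff: "(x :: 'a \<Rightarrow>\<^sub>0 bit) = y \<longleftrightarrow> x + y = 0"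
  by (metis add.right_neutral pm_add_cancel pm_double)

lemma total_degree_add: "total_degree (e + e') = total_degree e + total_degree e'"
  unfolding total_degree_def by (rule setsum_keys_plus_distrib) simp_all

lemma total_degree_single [simp]: "total_degree (Poly_Mapping.single i a) = a"
  by (simp add: total_degree_def)

lemma total_degree_zero [simp]: "total_degree 0 = 0"
  by (simp add: total_degree_def)

section \<open>Polynomials inside the Laurent polynomials, and their induction principles\<close>

definition poly_exp :: "nat \<Rightarrow> (nat \<Rightarrow>\<^sub>0 int) \<Rightarrow> bool"
  where "poly_exp k e \<longleftrightarrow> Poly_Mapping.keys e \<subseteq> {..<k} \<and> (\<forall>i. 0 \<le> Poly_Mapping.lookup e i)"

text \<open>No degree is fixed here: most arguments run in \<open>PP k\<close>, and degrees are
  recovered afterwards through \<open>poly_part\<close> or \<open>deg_proj\<close>.\<close>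

definition PP :: "nat \<Rightarrow> laurent set"
  where "PP k = {f. \<forall>e\<in>Poly_Mapping.keys f. poly_exp k e}"

lemma poly_part_iff:
  "f \<in> poly_part k d \<longleftrightarrow> (\<forall>e\<in>Poly_Mapping.keys f. poly_exp k e \<and> total_degree e = d)"
proof -
  have "(\<forall>i<k. 0 \<le> Poly_Mapping.lookup e i) \<longleftrightarrow> (\<forall>i. 0 \<le> Poly_Mapping.lookup e i)"
    if "Poly_Mapping.keys e \<subseteq> {..<k}" for e :: "nat \<Rightarrow>\<^sub>0 int"
    using that by (metis in_keys_iff lessThan_iff order_refl subsetD)
  then show ?thesis unfolding poly_part_def poly_exp_def by blast
qed

lemma poly_exp_zero [simp]: "poly_exp k 0"
  by (simp add: poly_exp_def)

lemma poly_exp_add: "poly_exp k e \<Longrightarrow> poly_exp k e' \<Longrightarrow> poly_exp k (e + e')"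
  using keys_add[of e e'] by (auto simp: poly_exp_def lookup_add)

lemma poly_exp_single: "poly_exp k (Poly_Mapping.single i a) \<longleftrightarrow> a = 0 \<or> (i < k \<and> 0 \<le> a)"
  by (auto simp: poly_exp_def lookup_single when_def)

lemma poly_exp_mono: "poly_exp k e \<Longrightarrow> k \<le> l \<Longrightarrow> poly_exp l e"
  by (auto simp: poly_exp_def)

lemma poly_exp_induct [consumes 1, case_names zero step]:
  assumes "poly_exp k e" and "Q 0"
    and "\<And>i e. i < k \<Longrightarrow> poly_exp k e \<Longrightarrow> Q e \<Longrightarrow> Q (Poly_Mapping.single i 1 + e)"
  shows "Q e"
  using assms(1)
proof (induction "nat (total_degree e)" arbitrary: e rule: less_induct)
  case less
  show ?case
  proof (cases "e = 0")
    case False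
    then obtain i where i: "Poly_Mapping.lookup e i \<noteq> 0"
      by (metis lookup_zero poly_mapping_eqI)
    define e' where "e' = e - Poly_Mapping.single i 1"
    have e: "e = Poly_Mapping.single i 1 + e'" by (simp add: e'_def)
    have "i < k" "0 \<le> Poly_Mapping.lookup e i"
      using less(2) i by (auto simp: poly_exp_def in_keys_iff subset_iff)
    with i have "1 \<le> Poly_Mapping.lookup e i" by linarith
    have "Poly_Mapping.lookup e' j = (if j = i then Poly_Mapping.lookup e i - 1 else Poly_Mapping.lookup e j)" for j
      by (simp add: e'_def lookup_minus lookup_single when_def)
    then have e': "poly_exp k e'"
      using less(2) \<open>1 \<le> _\<close> by (auto simp: poly_exp_def in_keys_iff subset_iff split: if_splits)
    have "0 \<le> total_degree e'"
      using e' unfolding total_degree_def poly_exp_def by (simp add: sum_nonneg)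
    then have "nat (total_degree e') < nat (total_degree e)"
      by (simp add: e total_degree_add)
    with less(1) e' have "Q e'" by blast
    then show ?thesis using assms(3) e e' \<open>i < k\<close> by simp
  qed (simp add: assms(2))
qed

lemma zero_poly_part [simp]: "0 \<in> poly_part k d" by (simp add: poly_part_iff)

lemma add_poly_part: "f \<in> poly_part k d \<Longrightarrow> g \<in> poly_part k d \<Longrightarrow> f + g \<in> poly_part k d"
  using keys_add[of f g] by (auto simp: poly_part_iff)

lemma sum_poly_part: "(\<And>i. i \<in> I \<Longrightarrow> f i \<in> poly_part k d) \<Longrightarrow> sum f I \<in> poly_part k d"
  by (induction I rule: infinite_finite_induct) (auto intro: add_poly_part)

lemma one_poly_part [simp]: "1 \<in> poly_part k 0"
  by (simp add: poly_part_iff)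

lemma mult_poly_part: "f \<in> poly_part k d \<Longrightarrow> g \<in> poly_part k d' \<Longrightarrow> f * g \<in> poly_part k (d + d')"
  using keys_mult[of f g] by (fastforce simp: poly_part_iff poly_exp_add total_degree_add)

lemma basis_poly_part [simp]: "basis e \<in> poly_part k d \<longleftrightarrow> poly_exp k e \<and> total_degree e = d"
  by (simp add: poly_part_iff)

lemma lvar_pow_poly_part: "i < k \<Longrightarrow> 0 \<le> a \<Longrightarrow> lvar_pow i a \<in> poly_part k a"
  by (simp add: lvar_pow_def poly_exp_single)

lemma poly_part_mono: "f \<in> poly_part k d \<Longrightarrow> k \<le> l \<Longrightarrow> f \<in> poly_part l d"
  by (auto simp: poly_part_iff poly_exp_mono)

lemma zero_PP [simp]: "0 \<in> PP k" by (simp add: PP_def)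

lemma add_PP: "f \<in> PP k \<Longrightarrow> g \<in> PP k \<Longrightarrow> f + g \<in> PP k"
  using keys_add[of f g] by (auto simp: PP_def)

lemma sum_PP: "(\<And>i. i \<in> I \<Longrightarrow> f i \<in> PP k) \<Longrightarrow> sum f I \<in> PP k"
  by (induction I rule: infinite_finite_induct) (auto intro: add_PP)

lemma one_PP [simp]: "1 \<in> PP k" by (simp add: PP_def)

lemma mult_PP: "f \<in> PP k \<Longrightarrow> g \<in> PP k \<Longrightarrow> f * g \<in> PP k"
  using keys_mult[of f g] by (fastforce simp: PP_def poly_exp_add)

lemma power_PP: "f \<in> PP k \<Longrightarrow> f ^ n \<in> PP k"
  by (induction n) (auto intro: mult_PP)

lemma basis_PP [simp]: "basis e \<in> PP k \<longleftrightarrow> poly_exp k e"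
  by (simp add: PP_def)

lemma lvar_pow_PP: "i < k \<Longrightarrow> 0 \<le> a \<Longrightarrow> lvar_pow i a \<in> PP k"
  by (simp add: lvar_pow_def poly_exp_single)

lemma PP_mono: "f \<in> PP k \<Longrightarrow> k \<le> l \<Longrightarrow> f \<in> PP l"
  by (auto simp: PP_def poly_exp_mono)

lemma poly_part_PP: "f \<in> poly_part k d \<Longrightarrow> f \<in> PP k"
  by (auto simp: PP_def poly_part_iff)

lemma pm_sum_basis: "(f :: 'a \<Rightarrow>\<^sub>0 bit) = (\<Sum>e\<in>Poly_Mapping.keys f. basis e)"
proof (rule poly_mapping_eqI)
  fix a
  have bit: "b \<noteq> 0 \<Longrightarrow> b = 1" for b :: bit by (cases b) auto
  have "(\<Sum>e\<in>Poly_Mapping.keys f. Poly_Mapping.lookup (basis e) a) = (if a \<in> Poly_Mapping.keys f then 1 else 0)"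
    by (simp add: lookup_single when_def)
  then show "Poly_Mapping.lookup f a = Poly_Mapping.lookup (\<Sum>e\<in>Poly_Mapping.keys f. basis e) a"
    by (auto simp: lookup_sum in_keys_iff intro: bit)
qed

text \<open>Unlike \<open>basis_induct\<close>, this keeps a condition on the support, such as
  nonnegative exponents or a fixed degree.\<close>

lemma keys_induct [consumes 1, case_names zero basis add]:
  assumes "\<forall>e\<in>Poly_Mapping.keys f. C e" "P 0" "\<And>e. C e \<Longrightarrow> P (basis e)"
    "\<And>f g. P f \<Longrightarrow> P g \<Longrightarrow> P (f + g)"
  shows "P (f :: 'a \<Rightarrow>\<^sub>0 bit)"
proof -
  have "P (\<Sum>e\<in>E. basis e)" if "\<forall>e\<in>E. C e" for E
    using that by (induction E rule: infinite_finite_induct) (auto intro: assms)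
  from this[OF assms(1)] show ?thesis using pm_sum_basis[of f] by simp
qed

text \<open>Together with \<open>Sq_op_lvar_mult\<close> this reduces statements about Steenrod
  operations to multiplication by one variable, without binomial coefficients.\<close>

lemma PP_induct [consumes 1, case_names zero one lvar add]:
  assumes "f \<in> PP k" "P 0" "P 1" "\<And>i f. i < k \<Longrightarrow> f \<in> PP k \<Longrightarrow> P f \<Longrightarrow> P (xv i * f)"
    "\<And>f g. P f \<Longrightarrow> P g \<Longrightarrow> P (f + g)"
  shows "P f"
  using assms(1) unfolding PP_def mem_Collect_eq
proof (induction rule: keys_induct)
  case (basis e)
  then show ?case
  proof (induction rule: poly_exp_induct)
    case (step i e)
    then show ?case using assms(4)[of i "basis e"] by (simp add: lvar_mult_basis)
  qed (simp add: assms(3))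
qed (simp_all add: assms)

lemma PP_homogeneous_induct [consumes 1, case_names zero hom add]:
  assumes "f \<in> PP k" "P 0" "\<And>d f. f \<in> poly_part k d \<Longrightarrow> P f" "\<And>f g. P f \<Longrightarrow> P g \<Longrightarrow> P (f + g)"
  shows "P f"
  using assms(1) unfolding PP_def mem_Collect_eq
proof (induction rule: keys_induct)
  case (basis e)
  then show ?case by (intro assms(3)) simp
qed (simp_all add: assms)

lemma Sq_op_one: "Sq_op n 1 = (if n = 0 then 1 else 0)"
  unfolding single_one[symmetric] by (simp add: Sq_op_def total_Sq_def)

lemma Sq_op_poly_part: "f \<in> poly_part k d \<Longrightarrow> Sq_op n f \<in> poly_part k (d + int n)"
  unfolding poly_part_iff[of f]
proof (induction rule: keys_induct)
  case (basis e)
  then have "poly_exp k e" and d: "total_degree e = d" by auto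
  from this(1) have "Sq_op n (basis e) \<in> poly_part k (total_degree e + int n)"
  proof (induction arbitrary: n rule: poly_exp_induct)
    case (step i e)
    have 1: "xv i * Sq_op n (basis e) \<in> poly_part k (1 + (total_degree e + int n))"
      using step by (intro mult_poly_part lvar_pow_poly_part) auto
    have 2: "lvar_pow i 2 * Sq_op (n - 1) (basis e) \<in> poly_part k (2 + (total_degree e + int (n - 1)))"
      using step by (intro mult_poly_part lvar_pow_poly_part) auto
    show ?case
      unfolding lvar_mult_basis[symmetric] Sq_op_lvar_mult
      using 1 2 by (cases "n = 0") (auto simp: total_degree_add of_nat_diff algebra_simps intro!: add_poly_part)
  qed (simp add: Sq_op_one)
  then show ?case using d by simp
qed (simp_all add: add_poly_part)

lemma Sq_op_PP: "f \<in> PP k \<Longrightarrow> Sq_op n f \<in> PP k"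
  by (induction rule: PP_homogeneous_induct) (auto intro: add_PP poly_part_PP Sq_op_poly_part)

subsection \<open>Induction over the Steenrod algebra\<close>

abbreviation sq_prod :: "nat list \<Rightarrow> steenrod"
  where "sq_prod ns \<equiv> prod_list (map Sq ns)"

lemma steenrod_span: "a \<in> group_closure (range sq_prod)"
proof (induction a rule: steenrod.abs_induct)
  case (1 x)
  show ?case
  proof (induction x rule: basis_induct)
    case zero
    show ?case by (simp add: zero_steenrod_def[symmetric])
  next
    case (add w x)
    have "abs_steenrod (basis (Sq_Word ns)) = sq_prod ns" for ns
    proof (induction ns)
      case Nil
      show ?case by (simp add: one_steenrod_def zero_sq_word_def[symmetric])
    next
      case (Cons n ns)
      have "basis (Sq_Word (n # ns)) = basis (Sq_Word [n]) * basis (Sq_Word ns)"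
        by (simp add: mult_single plus_sq_word_def)
      then have "abs_steenrod (basis (Sq_Word (n # ns))) = Sq n * abs_steenrod (basis (Sq_Word ns))"
        by (simp only: Sq.abs_eq times_steenrod.abs_eq)
      then show ?case by (simp add: Cons)
    qed
    from this[of "letters w"] have "abs_steenrod (basis w) \<in> group_closure (range sq_prod)"
      by (simp add: group_closure.base)
    with add show ?case by (simp add: plus_steenrod.abs_eq[symmetric] group_closure_add)
  qed
qed

lemma steenrod_double [simp]: "(a :: steenrod) + a = 0"
  by transfer (simp add: steenrod_eq_def adem_ideal_def)

lemma steenrod_minus [simp]: "- (a :: steenrod) = a"
  by (simp add: minus_unique)

lemma steenrod_diff [simp]: "(a :: steenrod) - b = a + b"
  by (simp only: diff_conv_add_uminus steenrod_minus)

lemma group_closure_steenrod_induct [consumes 1, case_names zero base add]: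
  assumes "a \<in> group_closure S" "P 0" "\<And>a. a \<in> S \<Longrightarrow> P a" "\<And>a b. P a \<Longrightarrow> P b \<Longrightarrow> P (a + b)"
  shows "P (a :: steenrod)"
  using assms(1)
proof (induction rule: group_closure.induct)
  case (base s)
  then show ?case using assms(2,3) by auto
next
  case (diff s t)
  then show ?case using assms(4) by simp
qed

text \<open>Words in the letters \<open>Sq n\<close> span the algebra, so it suffices to prepend one
  letter and to add.\<close>

lemma steenrod_induct [case_names zero one Sq add]:
  assumes "P 0" "P 1" "\<And>n a. P a \<Longrightarrow> P (Sq n * a)" "\<And>a b. P a \<Longrightarrow> P b \<Longrightarrow> P (a + b)"
  shows "P a"
  using steenrod_span[of a]
proof (induction rule: group_closure_steenrod_induct)
  case (base a)
  then obtain ns where a: "a = sq_prod ns" by auto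
  show ?case unfolding a by (induction ns) (auto intro: assms)
qed (auto intro: assms)

lemma act_0 [simp]: "act 0 f = 0"
  using act_add_left[of 0 0 f] by simp

lemma act_0_right [simp]: "act a 0 = 0"
  using act_add_right[of a 0 0] by simp

lemma act_PP: "f \<in> PP k \<Longrightarrow> act a f \<in> PP k"
proof (induction a arbitrary: f rule: steenrod_induct)
  case (Sq n a)
  then show ?case by (simp add: act_mult act_Sq Sq_op_PP)
qed (simp_all add: act_one act_add_left add_PP)

lemma augment_add: "augment (a + b) = augment a + augment b"
  by transfer (rule free_augment_add)

lemma augment_mult: "augment (a * b) = augment a * augment b"
  by transfer (rule free_augment_mult)

lemma augment_Sq: "augment (Sq n) = (if n = 0 then 1 else 0)"
  by transfer (simp add: free_augment_def)

lemma augment_one [simp]: "augment 1 = 1"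
  by (simp add: augment_Sq flip: Sq_0)

lemma augment_zero [simp]: "augment 0 = 0"
  by transfer (simp add: free_augment_def)

subsection \<open>Hit polynomials\<close>

definition hits :: "nat \<Rightarrow> laurent set"
  where "hits k = group_closure {Sq_op n g | n g. 0 < n \<and> g \<in> PP k}"

lemma zero_hits [simp]: "0 \<in> hits k" by (simp add: hits_def)

lemma add_hits: "f \<in> hits k \<Longrightarrow> g \<in> hits k \<Longrightarrow> f + g \<in> hits k"
  unfolding hits_def by (rule group_closure_add)

lemma sum_hits: "(\<And>i. i \<in> I \<Longrightarrow> f i \<in> hits k) \<Longrightarrow> sum f I \<in> hits k"
  unfolding hits_def by (rule group_closure_sum)

lemma Sq_op_hits: "0 < n \<Longrightarrow> g \<in> PP k \<Longrightarrow> Sq_op n g \<in> hits k"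
  unfolding hits_def by (intro group_closure.base) blast

lemma hits_induct [consumes 1, case_names zero Sq add]:
  assumes "f \<in> hits k" "P 0" "\<And>n g. 0 < n \<Longrightarrow> g \<in> PP k \<Longrightarrow> P (Sq_op n g)"
    "\<And>f g. P f \<Longrightarrow> P g \<Longrightarrow> P (f + g)"
  shows "P f"
  using assms(1) unfolding hits_def by (induction rule: group_closure_pm_induct) (auto intro: assms)

text \<open>Modulo hit polynomials the algebra acts through its augmentation: in
  \<open>Sq n * a\<close> with \<open>n > 0\<close> the outer square makes the value hit at once,
  and \<open>Sq 0\<close> is the identity.\<close>

lemma act_augment_hits: "f \<in> PP k \<Longrightarrow> act a f + scal (augment a) f \<in> hits k"
proof (induction a arbitrary: f rule: steenrod_induct)
  case zero
  then show ?case by simp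
next
  case one
  then show ?case by (simp add: act_one)
next
  case (Sq n a)
  then show ?case
    by (cases "n = 0") (simp_all add: Sq_0 augment_mult augment_Sq act_mult act_Sq Sq_op_hits act_PP)
next
  case (add a b)
  have "(act a f + scal (augment a) f) + (act b f + scal (augment b) f) \<in> hits k"
    by (rule add_hits[OF add(1) add(2)]) (rule add(3))+
  then show ?case by (simp add: act_add_left augment_add scal_add add_ac)
qed

lemma hit_part_eq: "hit_part k d = hits k \<inter> poly_part k d"
proof -
  let ?G = "group_closure {act a f | a f. augment a = 0 \<and> (\<exists>e. f \<in> poly_part k e)}"
  have "f \<in> ?G" if "f \<in> hits k" for f
    using that
  proof (induction rule: hits_induct)
    case (Sq n g)
    from Sq(2) show ?case
    proof (induction rule: PP_homogeneous_induct)
      case (hom d f)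
      then show ?case using Sq(1)
        by (intro group_closure.base insertI2 CollectI exI[of _ "Sq n"] exI[of _ f]) (auto simp: act_Sq augment_Sq)
    qed (auto intro: group_closure_add)
  qed (auto intro: group_closure_add)
  moreover have "f \<in> hits k" if "f \<in> ?G" for f
    using that
  proof (induction rule: group_closure_pm_induct)
    case (base f)
    then obtain a g e where "f = act a g" "augment a = 0" "g \<in> poly_part k e" by blast
    then show ?case using act_augment_hits[OF poly_part_PP, of g k e a] by simp
  qed (auto intro: add_hits)
  ultimately show ?thesis unfolding hit_part_def by blast
qed

definition deg_proj :: "int \<Rightarrow> laurent \<Rightarrow> laurent"
  where "deg_proj d = lin (\<lambda>e. if total_degree e = d then basis e else 0)"

lemma deg_proj_add: "deg_proj d (f + g) = deg_proj d f + deg_proj d g"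
  unfolding deg_proj_def by (rule lin_add) simp

lemma deg_proj_zero [simp]: "deg_proj d 0 = 0" by (simp add: deg_proj_def)

lemma deg_proj_hom: "f \<in> poly_part k e \<Longrightarrow> deg_proj d f = (if d = e then f else 0)"
  unfolding poly_part_iff
proof (induction rule: keys_induct)
  case (basis e')
  then show ?case by (auto simp: deg_proj_def)
qed (auto simp: deg_proj_add)

text \<open>Operations are homogeneous, so projecting each generator to degree \<open>d\<close>
  keeps its form. Homogeneous preimages are required where a chain of the transfer is modified by a
  hit polynomial.\<close>

lemma hits_homogeneous:
  assumes "f \<in> hits k" "f \<in> poly_part k d"
  shows "f \<in> group_closure {Sq_op n g | n g. 0 < n \<and> g \<in> poly_part k (d - int n)}"
proof -
  have "deg_proj d f \<in> group_closure {Sq_op n g | n g. 0 < n \<and> g \<in> poly_part k (d - int n)}"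
    using assms(1)
  proof (induction rule: hits_induct)
    case (Sq n g)
    from Sq(2) show ?case
    proof (induction rule: PP_homogeneous_induct)
      case (hom e g)
      then have "deg_proj d (Sq_op n g) = (if d = e + int n then Sq_op n g else 0)"
        by (intro deg_proj_hom Sq_op_poly_part)
      moreover have "Sq_op n g \<in> {Sq_op n g | n g. 0 < n \<and> g \<in> poly_part k (d - int n)}" if "d = e + int n"
        using hom Sq(1) that by (intro CollectI exI[of _ n] exI[of _ g]) simp
      ultimately show ?case by (auto intro: group_closure.base)
    qed (auto simp: deg_proj_add intro: group_closure_add)
  qed (auto simp: deg_proj_add intro: group_closure_add)
  then show ?thesis using deg_proj_hom[OF assms(2), of d] by simp
qed

section \<open>Linear substitutions\<close>

text \<open>In terms of total squares: Sq(l f) = (l + l^2) Sq(f). Squaring is additive, so the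
  condition passes from the variables to their sums.\<close>

definition linear_form :: "laurent \<Rightarrow> bool"
  where "linear_form l \<longleftrightarrow> (\<forall>n f. Sq_op n (l * f) = l * Sq_op n f + l * l * (if n = 0 then 0 else Sq_op (n - 1) f))"

lemma pm_square_add: "(x + y) * (x + y) = x * x + y * (y :: 'a::comm_monoid_add \<Rightarrow>\<^sub>0 bit)"
proof -
  have "(x + y) * (x + y) = x * x + y * y + (x * y + x * y)"
    by (simp only: distrib_left distrib_right mult.commute[of y x] add_ac)
  then show ?thesis by simp
qed

lemma linear_form_lvar [simp]: "linear_form (xv i)"
proof -
  have "xv i * xv i = lvar_pow i 2" by (simp flip: lvar_pow_add)
  then show ?thesis by (simp add: linear_form_def Sq_op_lvar_mult)
qed

lemma linear_form_add: "linear_form l \<Longrightarrow> linear_form l' \<Longrightarrow> linear_form (l + l')"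
  unfolding linear_form_def pm_square_add by (simp add: distrib_right add_ac)

definition subst :: "(nat \<Rightarrow> laurent) \<Rightarrow> laurent \<Rightarrow> laurent"
  where "subst v = lin (\<lambda>e. \<Prod>j\<in>Poly_Mapping.keys e. v j ^ nat (Poly_Mapping.lookup e j))"

lemma subst_add [simp]: "subst v (f + g) = subst v f + subst v g"
  unfolding subst_def by (rule lin_add) simp

lemma subst_zero [simp]: "subst v 0 = 0" by (simp add: subst_def)

lemma subst_one [simp]: "subst v 1 = 1" by (simp add: subst_def)

lemma subst_sum: "subst v (sum f I) = (\<Sum>i\<in>I. subst v (f i))"
  by (induction I rule: infinite_finite_induct) simp_all

lemma subst_basis_superset:
  assumes "finite A" "Poly_Mapping.keys e \<subseteq> A"
  shows "subst v (basis e) = (\<Prod>j\<in>A. v j ^ nat (Poly_Mapping.lookup e j))"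
  unfolding subst_def lin_basis using assms
  by (intro prod.mono_neutral_left) (auto simp: in_keys_iff)

lemma subst_basis_add:
  assumes "poly_exp k e" "poly_exp k e'"
  shows "subst v (basis (e + e')) = subst v (basis e) * subst v (basis e')"
proof -
  have "poly_exp k (e + e')" using assms by (rule poly_exp_add)
  with assms show ?thesis
    by (simp add: subst_basis_superset[of "{..<k}"] poly_exp_def lookup_add nat_add_distrib power_add prod.distrib)
qed

text \<open>\<open>subst\<close> truncates negative exponents by \<open>nat\<close>, which confines
  multiplicativity to polynomials.\<close>

lemma subst_mult:
  assumes "f \<in> PP k" "g \<in> PP k"
  shows "subst v (f * g) = subst v f * subst v g"
  using assms(1) unfolding PP_def mem_Collect_eq
proof (induction rule: keys_induct)
  case (basis e)
  from assms(2) show ?case unfolding PP_def mem_Collect_eq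
  proof (induction rule: keys_induct)
    case (basis e')
    then show ?case using subst_basis_add[OF \<open>poly_exp k e\<close>] by (simp add: mult_single)
  qed (simp_all add: distrib_left)
qed (simp_all add: distrib_right)

lemma subst_lvar [simp]: "subst v (xv i) = v i"
  by (simp add: subst_def lvar_pow_def)

lemma subst_lvar_pow: "0 \<le> a \<Longrightarrow> subst v (lvar_pow i a) = v i ^ nat a"
  by (simp add: subst_def lvar_pow_def)

lemma subst_lvar_mult: "i < k \<Longrightarrow> f \<in> PP k \<Longrightarrow> subst v (xv i * f) = v i * subst v f"
  by (subst subst_mult[of _ k]) (simp_all add: lvar_pow_PP)

lemma subst_cong:
  assumes "\<And>i. i < k \<Longrightarrow> v i = v' i" and "f \<in> PP k"
  shows "subst v f = subst v' f"
  using assms(2) by (induction rule: PP_induct) (simp_all add: subst_lvar_mult assms(1))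

lemma subst_id: "f \<in> PP k \<Longrightarrow> (\<And>i. i < k \<Longrightarrow> v i = xv i) \<Longrightarrow> subst v f = f"
  by (induction rule: PP_induct) (simp_all add: subst_lvar_mult)

lemma subst_PP:
  assumes "\<And>i. i < k \<Longrightarrow> v i \<in> PP l" and "f \<in> PP k"
  shows "subst v f \<in> PP l"
  using assms(2)
  by (induction rule: PP_induct) (simp_all add: subst_lvar_mult assms(1) mult_PP add_PP)

lemma subst_poly_part:
  assumes "\<And>i. i < k \<Longrightarrow> v i \<in> poly_part l 1" and "f \<in> poly_part k d"
  shows "subst v f \<in> poly_part l d"
proof -
  have "subst v (basis e) \<in> poly_part l (total_degree e)" if "poly_exp k e" for e
    using that
  proof (induction rule: poly_exp_induct)
    case (step i e)
    have "v i * subst v (basis e) \<in> poly_part l (1 + total_degree e)"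
      using step assms(1) by (intro mult_poly_part) auto
    then show ?case
      using subst_lvar_mult[of i k "basis e" v] step by (simp add: lvar_mult_basis total_degree_add)
  qed simp
  with assms(2) show ?thesis unfolding poly_part_iff[of f]
    by (induction rule: keys_induct) (auto intro: add_poly_part)
qed

lemma subst_Sq_op:
  assumes "\<And>i. i < k \<Longrightarrow> linear_form (v i)" and "f \<in> PP k"
  shows "subst v (Sq_op n f) = Sq_op n (subst v f)"
  using assms(2)
proof (induction arbitrary: n rule: PP_induct)
  case one
  show ?case by (simp add: Sq_op_one)
next
  case (lvar i f)
  have x2: "lvar_pow i 2 = xv i * xv i" by (simp flip: lvar_pow_add)
  have PP: "xv i \<in> PP k" "Sq_op m f \<in> PP k" for m using lvar by (simp_all add: lvar_pow_PP Sq_op_PP)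
  have "Sq_op n (subst v (xv i * f)) = v i * subst v (Sq_op n f)
      + v i * v i * (if n = 0 then 0 else subst v (Sq_op (n - 1) f))"
    using assms(1)[of i] lvar by (simp add: subst_lvar_mult linear_form_def)
  also have "\<dots> = subst v (Sq_op n (xv i * f))"
    using PP by (auto simp: Sq_op_lvar_mult x2 mult.assoc subst_mult[of _ k] mult_PP)
  finally show ?case by simp
qed simp_all

lemma subst_act:
  assumes "\<And>i. i < k \<Longrightarrow> linear_form (v i)" and "f \<in> PP k"
  shows "subst v (act a f) = act a (subst v f)"
  using assms(2)
proof (induction a arbitrary: f rule: steenrod_induct)
  case (Sq n a)
  then show ?case
    by (simp add: act_mult act_Sq subst_Sq_op[OF assms(1)] act_PP)
qed (simp_all add: act_one act_add_left)

lemma subst_hits: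
  assumes "\<And>i. i < k \<Longrightarrow> linear_form (v i)" "\<And>i. i < k \<Longrightarrow> v i \<in> PP l" and "f \<in> hits k"
  shows "subst v f \<in> hits l"
  using assms(3)
proof (induction rule: hits_induct)
  case (Sq n g)
  then show ?case
    using subst_Sq_op[OF assms(1) Sq(2)] subst_PP[OF assms(2) Sq(2)] by (simp add: Sq_op_hits)
qed (auto intro: add_hits)

subsection \<open>Generators of the general linear group\<close>

definition swap_sub :: "nat \<Rightarrow> nat \<Rightarrow> laurent"
  where "swap_sub j i = xv (if i = j then Suc j else if i = Suc j then j else i)"

definition trans_sub :: "nat \<Rightarrow> nat \<Rightarrow> laurent"
  where "trans_sub j i = (if i = j then xv j + xv (Suc j) else xv i)"

definition gens :: "nat \<Rightarrow> (nat \<Rightarrow> laurent) set"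
  where "gens k = {swap_sub j | j. Suc j < k} \<union> {trans_sub j | j. Suc j < k}"

lemma gens_linear_form: "v \<in> gens k \<Longrightarrow> linear_form (v i)"
  by (auto simp: gens_def swap_sub_def trans_sub_def linear_form_add)

lemma gens_poly_part: "v \<in> gens k \<Longrightarrow> i < k \<Longrightarrow> v i \<in> poly_part k 1"
  by (auto simp: gens_def swap_sub_def trans_sub_def intro!: add_poly_part lvar_pow_poly_part)

lemma gens_PP: "v \<in> gens k \<Longrightarrow> i < k \<Longrightarrow> v i \<in> PP k"
  by (rule poly_part_PP) (rule gens_poly_part)

lemma substitute_eq_subst:
  "substitute g = subst (\<lambda>j. \<Sum>i<dim_row g. Poly_Mapping.single 0 (g $$ (i, j)) * xv i)"
  by (simp add: substitute_def subst_def)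

lemma invertible_matI:
  assumes "A \<in> carrier_mat n n" "A * A = 1\<^sub>m n"
  shows "invertible_mat A"
  using assms by (auto simp: invertible_mat_def inverts_mat_def square_mat.simps)

text \<open>Both kinds of generators are involutions over F_2. Each matrix is therefore its own
  inverse, and \<open>cond\<close> asks only for its columns and its square.\<close>

lemma gens_substitute:
  assumes "v \<in> gens k"
  shows "\<exists>g\<in>GL k. \<forall>f\<in>PP k. substitute g f = subst v f"
proof -
  have cond: ?thesis
    if M: "\<And>j. j < k \<Longrightarrow> (\<Sum>i<k. Poly_Mapping.single 0 (c i j) * xv i) = v j"
      and inv: "\<And>i j. i < k \<Longrightarrow> j < k \<Longrightarrow> (\<Sum>m<k. c i m * c m j) = (if i = j then 1 else 0)" for c
  proof
    let ?g = "mat k k (\<lambda>(i, j). c i j)"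
    have "?g * ?g = 1\<^sub>m k"
      by (rule eq_matI) (simp_all add: scalar_prod_def inv atLeast0LessThan)
    then have "invertible_mat ?g" by (intro invertible_matI[of _ k]) simp_all
    then show "?g \<in> GL k" by (simp add: GL_def)
    show "\<forall>f\<in>PP k. substitute ?g f = subst v f"
      unfolding substitute_eq_subst
      by (intro ballI subst_cong[of k]) (auto simp: M[symmetric] intro!: sum.cong)
  qed
  from assms consider j where "Suc j < k" "v = swap_sub j" | j where "Suc j < k" "v = trans_sub j"
    by (auto simp: gens_def)
  then show ?thesis
  proof cases
    case (1 j)
    define p where "p = (\<lambda>i. if i = j then Suc j else if i = Suc j then j else i)"
    have p: "p i < k \<longleftrightarrow> i < k" "p (p i) = i" for i using 1 by (auto simp: p_def)
    show ?thesis
    proof (rule cond[of "\<lambda>i l. if i = p l then 1 else 0"])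
      show "(\<Sum>i<k. Poly_Mapping.single 0 (if i = p l then 1 else 0) * xv i) = v l" if "l < k" for l
        using that p by (subst sum.remove[of _ "p l"]) (auto simp: 1 swap_sub_def p_def intro!: sum.neutral)
      show "(\<Sum>m<k. (if i = p m then 1 else 0) * (if m = p l then 1 else 0)) = (if i = l then 1 else (0::bit))"
        if "i < k" "l < k" for i l
        using that p by (subst sum.remove[of _ "p l"]) (auto intro!: sum.neutral)
    qed
  next
    case (2 j)
    define c :: "nat \<Rightarrow> nat \<Rightarrow> bit"
      where "c = (\<lambda>i l. (if i = l then 1 else 0) + (if i = Suc j \<and> l = j then 1 else 0))"
    have s: "(\<Sum>i<k. if i = a then x i else 0) = x a" if "a < k" for a and x :: "nat \<Rightarrow> 'a::comm_monoid_add"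
      using that by simp
    show ?thesis
    proof (rule cond[of c])
      show "(\<Sum>i<k. Poly_Mapping.single 0 (c i l) * xv i) = v l" if "l < k" for l
      proof -
        have "Poly_Mapping.single 0 (c i l) * xv i = (if i = l then xv l else 0)
            + (if i = Suc j then if l = j then xv i else 0 else 0)" for i
          by (simp add: c_def single_add distrib_right)
        then show ?thesis using that 2 by (simp add: sum.distrib trans_sub_def)
      qed
      show "(\<Sum>m<k. c i m * c m l) = (if i = l then 1 else 0)" if "i < k" "l < k" for i l
      proof -
        have "c i m * c m l = (if m = i then c m l else 0) + (if m = j then if i = Suc j then c m l else 0 else 0)" for m
          by (auto simp: c_def distrib_right)
        then show ?thesis using that 2 by (auto simp: sum.distrib c_def)
      qed
    qed
  qed
qed

section \<open>The bar complex\<close>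

lemma lin_pm_add [simp]: "lin (f :: 'a \<Rightarrow> 'b \<Rightarrow>\<^sub>0 bit) (x + y) = lin f x + lin f y"
  by (rule lin_add) simp

lemma lin_pm_sum: "lin (f :: 'a \<Rightarrow> 'b \<Rightarrow>\<^sub>0 bit) (sum x I) = (\<Sum>i\<in>I. lin f (x i))"
  by (rule lin_sum) simp

lemma lin_plus_fun: "lin (\<lambda>w. f w + g w) x = lin f x + lin g (x :: 'a \<Rightarrow>\<^sub>0 bit)"
  by (simp add: lin_def sum.distrib)

lemma lin_lin: "lin f (lin g x) = lin (\<lambda>w. lin (f :: 'b \<Rightarrow> 'c \<Rightarrow>\<^sub>0 bit) (g w :: 'b \<Rightarrow>\<^sub>0 bit)) x"
  by (induction x rule: basis_induct) simp_all

lemma lin_cong: "(\<And>w. w \<in> Poly_Mapping.keys x \<Longrightarrow> f w = g w) \<Longrightarrow> lin f x = lin g x"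
  unfolding lin_def by (rule sum.cong) auto

lemma lin_basis_id: "lin basis x = x"
  unfolding lin_def by (rule pm_sum_basis[symmetric])

definition scb :: "bit \<Rightarrow> ('c \<Rightarrow>\<^sub>0 bit) \<Rightarrow> ('c \<Rightarrow>\<^sub>0 bit)"
  where "scb c v = (if c = 1 then v else 0)"

lemma scb_simps [simp]: "scb 0 v = 0" "scb 1 v = v" "scb c 0 = 0"
  by (simp_all add: scb_def)

lemma scb_add_left: "scb (c + c') v = scb c v + scb c' v"
  by (cases c; cases c') simp_all

lemma scb_add: "scb c (v + v') = scb c v + scb c v'"
  by (cases c) simp_all

lemma scb_scb: "scb c (scb c' v) = scb (c * c') v"
  by (cases c) simp_all

lemma lin_single: "lin (f :: 'a \<Rightarrow> 'b \<Rightarrow>\<^sub>0 bit) (Poly_Mapping.single w c) = scb c (f w)"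
  by (cases c) simp_all

section \<open>The bar boundary as an operation on functionals\<close>

type_synonym bar_symbol = "steenrod list \<times> laurent"

definition merge :: "nat \<Rightarrow> steenrod list \<Rightarrow> steenrod list"
  where "merge i as = take i as @ (as ! i * as ! Suc i) # drop (i + 2) as"

text \<open>The transpose of the boundary. Identities between chains become identities between
  functions of a single symbol, so formal sums need not be manipulated.\<close>

definition bd :: "(bar_symbol \<Rightarrow> 'c \<Rightarrow>\<^sub>0 bit) \<Rightarrow> bar_symbol \<Rightarrow> 'c \<Rightarrow>\<^sub>0 bit"
  where "bd \<Phi> w = lin \<Phi> (bar_boundary act (basis w))"

lemma bar_boundary_add [simp]:
  "bar_boundary act (x + y) = bar_boundary act x + bar_boundary act (y :: laurent bar)"
  by (simp add: bar_boundary_def)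

lemma bar_boundary_zero [simp]: "bar_boundary act (0 :: laurent bar) = 0"
  by (simp add: bar_boundary_def)

lemma lin_bar_boundary: "lin \<Phi> (bar_boundary act x) = lin (bd \<Phi>) x"
proof (induction x rule: basis_induct)
  case (add a x)
  then show ?case by (simp add: bd_def)
qed simp

lemma bd_Nil [simp]: "bd \<Phi> ([], m) = 0"
  by (simp add: bd_def bar_boundary_def)

lemma bd_unfold: "as \<noteq> [] \<Longrightarrow> bd \<Phi> (as, m) = scb (augment (hd as)) (\<Phi> (tl as, m))
    + (\<Sum>i<length as - 1. \<Phi> (merge i as, m)) + \<Phi> (butlast as, act (last as) m)"
  by (simp add: bd_def bar_boundary_def merge_def lin_pm_sum lin_single)

text \<open>If \<open>\<Phi>\<close> absorbs the last bar entry into the module by \<open>h\<close>,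
  then the faces away from the end are those of \<open>\<Psi>\<close> on the shorter symbol. For
  additive \<open>\<Psi>\<close> the three remaining terms cancel when
  \<open>h (c * b) m = act c (h b m) + h c (act b m)\<close>.\<close>

lemma bd_step:
  assumes "as \<noteq> []" and \<Phi>: "\<And>bs b m. \<Phi> (bs @ [b], m) = \<Psi> (bs, h b m)"
  shows "bd \<Phi> (as @ [b], m) = bd \<Psi> (as, h b m) + \<Psi> (butlast as, act (last as) (h b m))
    + \<Psi> (butlast as, h (last as * b) m) + \<Psi> (butlast as, h (last as) (act b m))"
proof -
  from assms(1) obtain as' c where as: "as = as' @ [c]" by (cases as rule: rev_cases) auto
  have m1: "merge i (as' @ [c, b]) = merge i (as' @ [c]) @ [b]" if "i < length as'" for i
  proof (cases "Suc i < length as'")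
    case False
    with that have "length as' = Suc i" by simp
    then show ?thesis by (simp add: merge_def nth_append)
  qed (use that in \<open>simp add: merge_def nth_append\<close>)
  have m2: "merge (length as') (as' @ [c, b]) = as' @ [c * b]"
    by (simp add: merge_def nth_append)
  have h: "hd (as' @ [c, b]) = hd (as' @ [c])" "tl (as' @ [c, b]) = tl (as' @ [c]) @ [b]"
    "butlast (as' @ [c, b]) = as' @ [c]"
    by (cases as'; simp add: butlast_append)+
  show ?thesis
    unfolding as by (simp add: bd_unfold \<Phi> m1 m2 h add_ac)
qed

fun headmul :: "steenrod \<Rightarrow> bar_symbol \<Rightarrow> bar_symbol"
  where
    "headmul a ([], m) = ([], act a m)"
  | "headmul a (c # cs, m) = ((a * c) # cs, m)"

abbreviation pre :: "(bar_symbol \<Rightarrow> 'c) \<Rightarrow> steenrod \<Rightarrow> bar_symbol \<Rightarrow> 'c"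
  where "pre \<Phi> a \<equiv> (\<lambda>(cs, n). \<Phi> (a # cs, n))"

text \<open>All faces except the one with the augmentation, by recursion from the left. This part
  alone squares to zero (\<open>bdi_bdi\<close>), which isolates the role of the
  augmentation.\<close>

fun bdi :: "(bar_symbol \<Rightarrow> 'c \<Rightarrow>\<^sub>0 bit) \<Rightarrow> steenrod list \<Rightarrow> laurent \<Rightarrow> 'c \<Rightarrow>\<^sub>0 bit"
  where
    "bdi \<Phi> [] m = 0"
  | "bdi \<Phi> (a # as) m = \<Phi> (headmul a (as, m)) + bdi (pre \<Phi> a) as m"

fun bdh :: "(bar_symbol \<Rightarrow> 'c \<Rightarrow>\<^sub>0 bit) \<Rightarrow> bar_symbol \<Rightarrow> 'c \<Rightarrow>\<^sub>0 bit"
  where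
    "bdh \<Phi> ([], m) = 0"
  | "bdh \<Phi> (a # as, m) = scb (augment a) (\<Phi> (as, m))"

lemma bd_eq: "bd \<Phi> (as, m) = bdh \<Phi> (as, m) + bdi \<Phi> as m"
proof (cases as)
  case (Cons a as')
  have "(\<Sum>i<length as'. \<Phi> (merge i (a # as'), m)) + \<Phi> (butlast (a # as'), act (last (a # as')) m)
      = bdi \<Phi> (a # as') m"
  proof (induction as' arbitrary: a \<Phi>)
    case (Cons b as')
    have m: "merge 0 (a # b # as') = (a * b) # as'" "merge (Suc i) (a # b # as') = a # merge i (b # as')" for i
      by (simp_all add: merge_def)
    have "(\<Sum>i<length as'. pre \<Phi> a (merge i (b # as'), m)) + pre \<Phi> a (butlast (b # as'), act (last (b # as')) m)
      = bdi (pre \<Phi> a) (b # as') m"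
      by (rule Cons)
    then show ?case by (simp add: sum.lessThan_Suc_shift m add_ac del: sum.lessThan_Suc)
  qed simp
  then show ?thesis by (simp add: Cons bd_unfold add_ac)
qed simp

lemma bdi_add: "bdi (\<lambda>w. \<Phi> w + \<Psi> w) as m = bdi \<Phi> as m + bdi \<Psi> as m"
proof (induction as arbitrary: \<Phi> \<Psi>)
  case (Cons a as)
  show ?case using Cons[of "pre \<Phi> a" "pre \<Psi> a"] by (simp add: case_prod_unfold add_ac)
qed simp

lemma bdi_scb: "bdi (\<lambda>w. scb c (\<Phi> w)) as m = scb c (bdi \<Phi> as m)"
proof (induction as arbitrary: \<Phi>)
  case (Cons a as)
  show ?case using Cons[of "pre \<Phi> a"] by (simp add: case_prod_unfold scb_add)
qed simp

lemma headmul_headmul: "headmul a (headmul c w) = headmul (a * c) w"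
  by (cases "(c, w)" rule: headmul.cases) (simp_all add: act_mult mult.assoc)

lemma bdi_headmul: "bdi (\<lambda>w. \<Phi> (headmul a w)) as m = (case headmul a (as, m) of (cs, n) \<Rightarrow> bdi \<Phi> cs n)"
  by (cases as) (simp_all add: headmul_headmul)

lemma bdi_bdi: "bdi (\<lambda>(cs, n). bdi \<Phi> cs n) as m = 0"
proof (induction as arbitrary: \<Phi>)
  case (Cons a as)
  have "bdi (pre (\<lambda>(cs, n). bdi \<Phi> cs n) a) as m
      = bdi (\<lambda>w. \<Phi> (headmul a w) + (\<lambda>(cs, n). bdi (pre \<Phi> a) cs n) w) as m"
    by (simp add: case_prod_unfold)
  also have "\<dots> = (case headmul a (as, m) of (cs, n) \<Rightarrow> bdi \<Phi> cs n)"
    unfolding bdi_add bdi_headmul Cons by simp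
  finally show ?case by (simp add: case_prod_unfold)
qed simp

text \<open>The inner faces are settled by \<open>bdi_bdi\<close>. The two ways of removing the
  first two entries, one after the other or merged, agree because \<open>augment\<close> is
  multiplicative; the other terms occur twice.\<close>

lemma bd_bd: "bd (bd \<Phi>) w = 0"
proof (cases w)
  case (Pair as m)
  have bd: "bd \<Phi> = (\<lambda>w. bdh \<Phi> w + (\<lambda>(cs, n). bdi \<Phi> cs n) w)"
    by (auto simp: bd_eq)
  show ?thesis
  proof (cases as)
    case (Cons a cs)
    have "pre (bdh \<Phi>) a = (\<lambda>w. scb (augment a) (\<Phi> w))" by auto
    then have *: "bdi (pre (bdh \<Phi>) a) cs m = scb (augment a) (bdi \<Phi> cs m)"
      by (simp add: bdi_scb)
    have "bdi (bd \<Phi>) (a # cs) m = bdi (bdh \<Phi>) (a # cs) m"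
      unfolding bd bdi_add bdi_bdi by simp
    moreover have "bdh \<Phi> (headmul a (cs, m)) = scb (augment a) (bdh \<Phi> (cs, m))"
      by (cases cs) (simp_all add: augment_mult scb_scb)
    ultimately show ?thesis
      unfolding Pair Cons bd_eq[of "bd \<Phi>"] using * by (simp add: bd_eq scb_add add_ac)
  qed (simp add: Pair)
qed

text \<open>The functionals that descend to the tensor product. They vanish on
  \<open>bar_relations\<close> and so take the place of the quotient that the chains do not
  form.\<close>

definition multilinear :: "(bar_symbol \<Rightarrow> 'c \<Rightarrow>\<^sub>0 bit) \<Rightarrow> bool"
  where "multilinear \<Phi> \<longleftrightarrow>
    (\<forall>us a b vs m. \<Phi> (us @ (a + b) # vs, m) = \<Phi> (us @ a # vs, m) + \<Phi> (us @ b # vs, m)) \<and>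
    (\<forall>as m m'. \<Phi> (as, m + m') = \<Phi> (as, m) + \<Phi> (as, m'))"

lemma multilinearD:
  assumes "multilinear \<Phi>"
  shows "\<Phi> (us @ (a + b) # vs, m) = \<Phi> (us @ a # vs, m) + \<Phi> (us @ b # vs, m)"
    and "\<Phi> (as, m + m') = \<Phi> (as, m) + \<Phi> (as, m')"
  using assms unfolding multilinear_def by blast+

lemma multilinear_pre: "multilinear \<Phi> \<Longrightarrow> multilinear (pre \<Phi> a)"
  unfolding multilinear_def by (simp flip: append_Cons)

lemma multilinear_relations:
  assumes "multilinear \<Phi>" "x \<in> bar_relations M n d"
  shows "lin \<Phi> x = 0"
  using assms(2) unfolding bar_relations_def
  by (induction rule: group_closure_pm_induct) (auto simp: multilinearD[OF assms(1)] add_ac)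

lemma multilinear_bdi:
  "multilinear \<Phi> \<Longrightarrow> bdi \<Phi> as (m + m') = bdi \<Phi> as m + bdi \<Phi> as m'"
  "multilinear \<Phi> \<Longrightarrow> bdi \<Phi> (us @ (a + b) # vs) m = bdi \<Phi> (us @ a # vs) m + bdi \<Phi> (us @ b # vs) m"
proof -
  assume "multilinear \<Phi>"
  then show "bdi \<Phi> as (m + m') = bdi \<Phi> as m + bdi \<Phi> as m'"
  proof (induction as arbitrary: \<Phi>)
    case (Cons a as)
    have "\<Phi> (headmul a (as, m + m')) = \<Phi> (headmul a (as, m)) + \<Phi> (headmul a (as, m'))"
      by (cases as) (simp_all add: act_add_right multilinearD[OF Cons(2)])
    then show ?case using Cons(1)[OF multilinear_pre[OF Cons(2)]] by (simp add: add_ac)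
  qed simp
next
  assume "multilinear \<Phi>"
  then show "bdi \<Phi> (us @ (a + b) # vs) m = bdi \<Phi> (us @ a # vs) m + bdi \<Phi> (us @ b # vs) m"
  proof (induction us arbitrary: \<Phi>)
    case Nil
    note ml = multilinearD[OF Nil]
    have 1: "\<Phi> (headmul (a + b) (vs, m)) = \<Phi> (headmul a (vs, m)) + \<Phi> (headmul b (vs, m))"
      by (cases vs) (simp_all add: act_add_left distrib_right ml ml(1)[of "[]", simplified])
    have "pre \<Phi> (a + b) = (\<lambda>w. pre \<Phi> a w + pre \<Phi> b w)"
      by (auto simp: ml(1)[of "[]", simplified])
    then have "bdi (pre \<Phi> (a + b)) vs m = bdi (pre \<Phi> a) vs m + bdi (pre \<Phi> b) vs m"
      by (simp only: bdi_add)
    with 1 show ?case by (simp add: add_ac)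
  next
    case (Cons u us)
    note ml = multilinearD[OF Cons(2)]
    have "\<Phi> (headmul u (us @ (a + b) # vs, m)) = \<Phi> (headmul u (us @ a # vs, m)) + \<Phi> (headmul u (us @ b # vs, m))"
      by (cases us) (simp_all add: distrib_left ml(1)[of "[]", simplified] ml(1)[of "_ # _", simplified])
    then show ?case using Cons(1)[OF multilinear_pre[OF Cons(2)]] by (simp add: add_ac)
  qed
qed

lemma multilinear_bd:
  assumes "multilinear \<Phi>"
  shows "multilinear (bd \<Phi>)"
  unfolding multilinear_def
proof (intro conjI allI)
  fix us a b vs m
  note ml = multilinearD[OF assms]
  have "bdh \<Phi> (us @ (a + b) # vs, m) = bdh \<Phi> (us @ a # vs, m) + bdh \<Phi> (us @ b # vs, m)"
    by (cases us) (simp_all add: augment_add scb_add_left ml scb_add)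
  then show "bd \<Phi> (us @ (a + b) # vs, m) = bd \<Phi> (us @ a # vs, m) + bd \<Phi> (us @ b # vs, m)"
    by (simp add: bd_eq multilinear_bdi[OF assms] add_ac)
next
  fix as m m'
  have "bdh \<Phi> (as, m + m') = bdh \<Phi> (as, m) + bdh \<Phi> (as, m')"
    by (cases as) (simp_all add: multilinearD[OF assms] scb_add)
  then show "bd \<Phi> (as, m + m') = bd \<Phi> (as, m) + bd \<Phi> (as, m')"
    by (simp add: bd_eq multilinear_bdi[OF assms] add_ac)
qed

section \<open>The connecting homomorphism on chains\<close>

abbreviation iv :: "nat \<Rightarrow> laurent"
  where "iv j \<equiv> lvar_pow j (-1)"

text \<open>The snake lemma for one bar entry: lift \<open>m\<close> to \<open>m * iv j\<close>,
  apply \<open>a\<close>, and remove the lift of \<open>act a m\<close>. The result is again a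
  polynomial (\<open>D_PP\<close>), of degree one less than \<open>act a m\<close>
  (\<open>D_poly_part\<close>).\<close>

definition D :: "nat \<Rightarrow> steenrod \<Rightarrow> laurent \<Rightarrow> laurent"
  where "D j a m = act a (m * iv j) + act a m * iv j"

lemma D_add_left: "D j (a + b) m = D j a m + D j b m"
  by (simp add: D_def act_add_left distrib_right add_ac)

lemma D_add_right: "D j a (m + m') = D j a m + D j a m'"
  by (simp add: D_def act_add_right distrib_right add_ac)

text \<open>A twisted derivation rule; it is the condition under which the correction terms of
  \<open>bd_step\<close> cancel.\<close>

lemma D_mult: "D j (a * b) m = act a (D j b m) + D j a (act b m)"
proof -
  have "act a (act b m * iv j) + (act a (act b m * iv j) + act a (act b m) * iv j) = act a (act b m) * iv j"
    by simp
  then show ?thesis by (simp add: D_def act_mult act_add_right add.assoc)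
qed

lemma D_one [simp]: "D j 1 m = 0" by (simp add: D_def act_one)
lemma D_zero [simp]: "D j 0 m = 0" "D j a 0 = 0" by (simp_all add: D_def)

lemma binom2_minus_one [simp]: "binom2 (-1) n = 1"
proof (induction n)
  case (Suc n)
  have "binom2 (-1) n + binom2 (-1) (Suc n) = 0"
    using binom2_Suc[of "-1" n] by simp
  with Suc show ?case by (cases "binom2 (-1) (Suc n)") auto
qed simp

text \<open>Sq^n(x^-1) = x^(n-1) for every n, so in the Cartan formula only the term
  \<open>i = n\<close> has a negative exponent, and that one is removed by \<open>D\<close>.\<close>

lemma D_Sq: "D j (Sq n) m = (\<Sum>i<n. Sq_op i m * lvar_pow j (int (n - Suc i)))"
proof -
  have "Sq_op n (m * iv j) = (\<Sum>i\<le>n. Sq_op i m * lvar_pow j (int (n - i) - 1))"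
    by (simp add: Sq_op_Cartan Sq_op_lvar_pow)
  also have "\<dots> = (\<Sum>i<n. Sq_op i m * lvar_pow j (int (n - i) - 1)) + Sq_op n m * iv j"
    by (simp add: lessThan_Suc_atMost[symmetric])
  also have "(\<Sum>i<n. Sq_op i m * lvar_pow j (int (n - i) - 1)) = (\<Sum>i<n. Sq_op i m * lvar_pow j (int (n - Suc i)))"
    by (intro sum.cong) (auto simp: of_nat_diff algebra_simps)
  finally show ?thesis by (simp add: D_def act_Sq add.assoc)
qed

lemma D_PP: "m \<in> PP l \<Longrightarrow> j < l \<Longrightarrow> D j a m \<in> PP l"
proof (induction a arbitrary: m rule: steenrod_induct)
  case (Sq n a)
  then show ?case
    by (auto simp: D_mult D_Sq intro!: add_PP act_PP sum_PP mult_PP Sq_op_PP lvar_pow_PP)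
qed (auto simp: D_add_left intro: add_PP)

lemma steenrod_part_induct [consumes 1, case_names zero base add]:
  assumes "a \<in> steenrod_part d" "P 0" "\<And>ns. int (sum_list ns) = d \<Longrightarrow> P (sq_prod ns)"
    "\<And>a b. P a \<Longrightarrow> P b \<Longrightarrow> P (a + b)"
  shows "P a"
  using assms(1) unfolding steenrod_part_def
  by (induction rule: group_closure_steenrod_induct) (use assms in auto)

lemma steenrod_part_add: "a \<in> steenrod_part d \<Longrightarrow> b \<in> steenrod_part d \<Longrightarrow> a + b \<in> steenrod_part d"
  unfolding steenrod_part_def by (rule group_closure_add)

lemma steenrod_part_zero [simp]: "0 \<in> steenrod_part d"
  by (simp add: steenrod_part_def)

lemma sq_prod_steenrod_part: "sq_prod ns \<in> steenrod_part (int (sum_list ns))"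
  unfolding steenrod_part_def by (intro group_closure.base insertI2) blast

lemma steenrod_part_mult:
  assumes "a \<in> steenrod_part d" "b \<in> steenrod_part d'"
  shows "a * b \<in> steenrod_part (d + d')"
  using assms(1)
proof (induction rule: steenrod_part_induct)
  case (base ns)
  from assms(2) show ?case
  proof (induction rule: steenrod_part_induct)
    case (base ns')
    then show ?case using sq_prod_steenrod_part[of "ns @ ns'"] \<open>int (sum_list ns) = d\<close> by simp
  qed (auto simp: distrib_left intro: steenrod_part_add)
qed (auto simp: distrib_right intro: steenrod_part_add)

lemma act_sq_prod_poly_part: "f \<in> poly_part k e \<Longrightarrow> act (sq_prod ns) f \<in> poly_part k (e + int (sum_list ns))"
proof (induction ns)
  case (Cons n ns)
  then have "Sq_op n (act (sq_prod ns) f) \<in> poly_part k (e + int (sum_list ns) + int n)"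
    by (intro Sq_op_poly_part) simp
  then show ?case by (simp add: act_mult act_Sq algebra_simps)
qed (simp add: act_one)

lemma act_poly_part: "a \<in> steenrod_part i \<Longrightarrow> f \<in> poly_part k e \<Longrightarrow> act a f \<in> poly_part k (e + i)"
  by (induction rule: steenrod_part_induct) (auto simp: act_add_left intro: add_poly_part act_sq_prod_poly_part)

lemma D_Sq_poly_part:
  assumes "m \<in> poly_part l e" "j < l"
  shows "D j (Sq n) m \<in> poly_part l (e + int n - 1)"
  unfolding D_Sq
proof (rule sum_poly_part)
  fix i assume "i \<in> {..<n}"
  moreover have "Sq_op i m * lvar_pow j (int (n - Suc i)) \<in> poly_part l ((e + int i) + int (n - Suc i))"
    using assms by (intro mult_poly_part Sq_op_poly_part lvar_pow_poly_part) auto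
  ultimately show "Sq_op i m * lvar_pow j (int (n - Suc i)) \<in> poly_part l (e + int n - 1)"
    by (simp add: of_nat_diff algebra_simps)
qed

lemma D_poly_part:
  assumes "a \<in> steenrod_part i" "m \<in> poly_part l e" "j < l"
  shows "D j a m \<in> poly_part l (e + i - 1)"
  using assms(1)
proof (induction rule: steenrod_part_induct)
  case (base ns)
  have "D j (sq_prod ns) m \<in> poly_part l (e + int (sum_list ns) - 1)"
  proof (induction ns)
    case (Cons n ns)
    have 1: "Sq_op n (D j (sq_prod ns) m) \<in> poly_part l (e + int (sum_list ns) - 1 + int n)"
      by (intro Sq_op_poly_part Cons)
    have 2: "D j (Sq n) (act (sq_prod ns) m) \<in> poly_part l ((e + int (sum_list ns)) + int n - 1)"
      using assms by (intro D_Sq_poly_part act_sq_prod_poly_part)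
    show ?case using add_poly_part[of _ l "e + int (sum_list (n # ns)) - 1"] 1 2
      by (simp add: D_mult act_Sq algebra_simps)
  qed simp
  then show ?case using base by simp
qed (auto simp: D_add_left intro: add_poly_part)

fun ev :: "nat \<Rightarrow> steenrod list \<Rightarrow> laurent \<Rightarrow> laurent"
  where
    "ev j [] m = m"
  | "ev j (a # as) m = ev (Suc j) as (D j a m)"

text \<open>The composite of the remaining connecting maps: the last bar entry acts first, through
  \<open>D j\<close>, the one before it through \<open>D (Suc j)\<close>, each introducing a new
  variable. On a cycle for a Tor class, \<open>V 0\<close> gives a polynomial representing its
  transfer.\<close>

definition V :: "nat \<Rightarrow> bar_symbol \<Rightarrow> laurent"
  where "V j = (\<lambda>(as, m). ev j (rev as) m)"

lemma V_Nil [simp]: "V j ([], m) = m" by (simp add: V_def)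
lemma V_snoc: "V j (as @ [b], m) = V (Suc j) (as, D j b m)" by (simp add: V_def)

lemma ev_add: "ev j as (m + m') = ev j as m + ev j as m'"
  by (induction as arbitrary: j m m') (simp_all add: D_add_right)

lemma V_add: "V j (as, m + m') = V j (as, m) + V j (as, m')"
  by (simp add: V_def ev_add)

lemma V_zero [simp]: "V j (as, 0) = 0"
  using V_add[of j as 0 0] by simp

lemma multilinear_V: "multilinear (V j)"
proof -
  have "ev j (us @ (a + b) # vs) m = ev j (us @ a # vs) m + ev j (us @ b # vs) m" for us a b vs m
    by (induction us arbitrary: j m) (simp_all add: D_add_left ev_add)
  then show ?thesis by (simp add: multilinear_def V_add) (simp add: V_def)
qed

text \<open>By \<open>D_mult\<close> all faces inside the symbol cancel; what survives are the two
  contributions of the first entry, whose sum is hit by \<open>act_augment_hits\<close>. Boundaries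
  thus have hit values.\<close>

lemma V_bd: "as \<noteq> [] \<Longrightarrow> bd (V j) (as, m) = act (hd as) (V j (tl as, m)) + scal (augment (hd as)) (V j (tl as, m))"
proof (induction as arbitrary: j m rule: rev_nonempty_induct)
  case (single a)
  show ?case by (simp add: bd_unfold scal_def scb_def add_ac)
next
  case (snoc b as)
  have "bd (V j) (as @ [b], m) = bd (V (Suc j)) (as, D j b m)
    + V (Suc j) (butlast as, act (last as) (D j b m) + D j (last as * b) m + D j (last as) (act b m))"
    using snoc(1) by (subst bd_step[of _ _ "V (Suc j)" "D j"]) (simp_all add: V_snoc V_add add_ac)
  also have "act (last as) (D j b m) + D j (last as * b) m + D j (last as) (act b m) = 0"
    by (simp add: D_mult add_ac)
  finally show ?case using snoc by (simp add: V_snoc)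
qed

lemma V_PP: "m \<in> PP j \<Longrightarrow> V j (as, m) \<in> PP (j + length as)"
proof (induction as arbitrary: j m rule: rev_induct)
  case (snoc b as)
  have "D j b m \<in> PP (Suc j)" using snoc(2) by (intro D_PP) (auto intro: PP_mono)
  from snoc(1)[OF this] show ?case by (simp add: V_snoc)
qed simp

lemma V_bd_hits: "m \<in> PP j \<Longrightarrow> bd (V j) (as, m) \<in> hits (j + (length as - 1))"
  by (cases as) (auto simp: V_bd intro!: act_augment_hits V_PP)

section \<open>Values of the transfer\<close>

abbreviation Lp :: "nat \<Rightarrow> nat \<Rightarrow> int \<Rightarrow> laurent set"
  where "Lp k j \<equiv> desuspend (k - j) (poly_part j)"

abbreviation Hp :: "nat \<Rightarrow> nat \<Rightarrow> int \<Rightarrow> laurent set"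
  where "Hp k j \<equiv> desuspend (k - Suc j) (poly_hat_part j)"

lemma residue_at_add [simp]: "residue_at j (f + g) = residue_at j f + residue_at j g"
  by (simp add: residue_at_def)

lemma residue_at_zero [simp]: "residue_at j 0 = 0"
  by (simp add: residue_at_def)

lemma basis_mult_iv: "basis (e + Poly_Mapping.single j 1) * iv j = basis e"
  by (simp add: lvar_pow_def mult_single add.assoc flip: single_add)

lemma poly_hat_partD:
  assumes "m \<in> poly_hat_part j e"
  shows "m + residue_at j m * iv j \<in> PP (Suc j)"
  using assms unfolding poly_hat_part_def mem_Collect_eq
proof (induction rule: keys_induct)
  case (basis a)
  show ?case
  proof (cases "Poly_Mapping.lookup a j = -1")
    case False
    have "Poly_Mapping.lookup a i \<ge> 0" for i
    proof (cases i j rule: linorder_cases)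
      case greater
      then have "i \<notin> Poly_Mapping.keys a" using basis by auto
      then show ?thesis by (simp add: in_keys_iff)
    qed (use basis False in auto)
    with basis False show ?thesis by (auto simp: residue_at_def poly_exp_def)
  qed (simp add: residue_at_def basis_mult_iv)
next
  case (add f g)
  then have "(f + residue_at j f * iv j) + (g + residue_at j g * iv j) \<in> PP (Suc j)"
    by (rule add_PP)
  then show ?case by (simp add: distrib_right add_ac)
qed simp

lemma residue_at_mult_iv: "m \<in> PP j \<Longrightarrow> residue_at j (m * iv j) = m"
  unfolding PP_def mem_Collect_eq
proof (induction rule: keys_induct)
  case (basis e)
  then have "Poly_Mapping.lookup e j = 0" by (auto simp: poly_exp_def subset_iff in_keys_iff)
  then show ?case
    by (simp add: residue_at_def lvar_pow_def mult_single lookup_add add.assoc flip: single_add)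
qed (simp_all add: distrib_right)

lemma residue_at_PP: "m \<in> PP k \<Longrightarrow> residue_at j m = 0"
  unfolding PP_def mem_Collect_eq
proof (induction rule: keys_induct)
  case (basis e)
  then have "Poly_Mapping.lookup e j \<noteq> -1" by (metis neg_0_le_iff_le not_one_le_zero poly_exp_def)
  then show ?case by (simp add: residue_at_def)
qed simp_all

lemma poly_hat_part_add: "f \<in> poly_hat_part j d \<Longrightarrow> g \<in> poly_hat_part j d \<Longrightarrow> f + g \<in> poly_hat_part j d"
  using keys_add[of f g] unfolding poly_hat_part_def by blast

lemma poly_hat_part_zero [simp]: "0 \<in> poly_hat_part j d"
  by (simp add: poly_hat_part_def)

lemma poly_part_hat: "f \<in> poly_part (Suc j) d \<Longrightarrow> f \<in> poly_hat_part j d"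
proof -
  have "-1 \<le> Poly_Mapping.lookup e j" if "\<forall>i. 0 \<le> Poly_Mapping.lookup e i" for e :: "nat \<Rightarrow>\<^sub>0 int"
    using that[rule_format, of j] by linarith
  then show "f \<in> poly_part (Suc j) d \<Longrightarrow> f \<in> poly_hat_part j d"
    unfolding poly_part_iff poly_hat_part_def poly_exp_def lessThan_Suc_atMost by blast
qed

lemma mult_iv_hat: "m \<in> poly_part j (e + 1) \<Longrightarrow> m * iv j \<in> poly_hat_part j e"
  unfolding poly_part_iff
proof (induction rule: keys_induct)
  case (basis a)
  have "Poly_Mapping.keys (a + Poly_Mapping.single j (-1)) \<subseteq> {..j}"
    using basis keys_add[of a "Poly_Mapping.single j (-1)"] by (auto simp: poly_exp_def)
  moreover have "Poly_Mapping.lookup a j = 0"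
    using basis by (auto simp: poly_exp_def subset_iff in_keys_iff)
  ultimately show ?case
    using basis
    by (auto simp: lvar_pow_def mult_single poly_hat_part_def lookup_add lookup_single when_def
        total_degree_add poly_exp_def)
qed (simp_all add: distrib_right poly_hat_part_add)

lemma lin_hits: "(\<And>w. w \<in> Poly_Mapping.keys x \<Longrightarrow> f w \<in> hits k) \<Longrightarrow> lin f x \<in> hits k"
  unfolding lin_def by (rule sum_hits)

text \<open>Multiplication by \<open>iv j\<close> commutes with every face but the last, where the
  defect is \<open>D j\<close>; \<open>V (Suc j)\<close> of this defect is
  \<open>V j\<close>.\<close>

lemma bd_mult_iv:
  assumes "as \<noteq> []"
  shows "bd (V (Suc j)) (as, m * iv j) = bd (\<lambda>(cs, n). V (Suc j) (cs, n * iv j)) (as, m) + V j (as, m)"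
proof -
  have "V j (as, m) = V (Suc j) (butlast as, D j (last as) m)"
    using assms V_snoc[of j "butlast as" "last as" m] by simp
  then show ?thesis
    using assms by (simp add: bd_unfold D_def V_add add_ac)
qed

text \<open>Each module entry of \<open>y\<close> splits into a polynomial and \<open>iv j\<close>
  times its residue. The polynomial part has a hit value by \<open>V_bd_hits\<close>. By
  \<open>bd_mult_iv\<close> the residue part gives \<open>V j\<close> of \<open>q\<close> and a
  multilinear functional on the boundary of \<open>q\<close>, which the cycle condition
  kills.\<close>

lemma connecting_value:
  assumes y: "y \<in> bar_chains (Hp k j) (k - j) d" and j: "j < k"
    and q: "q = lin (\<lambda>(as, m). basis (as, residue_at j m)) y"
    and cyc: "\<And>\<Phi> :: bar_symbol \<Rightarrow> laurent. multilinear \<Phi> \<Longrightarrow> lin \<Phi> (bar_boundary act q) = 0"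
  shows "lin (V (Suc j)) (bar_boundary act y) + lin (V j) q \<in> hits k"
proof -
  define \<Phi> where "\<Phi> = (\<lambda>(cs, n). V (Suc j) (cs, n * iv j))"
  have "multilinear \<Phi>"
    using multilinear_V[of "Suc j"] by (auto simp: multilinear_def \<Phi>_def distrib_right)
  then have "lin (bd \<Phi>) q = 0" using cyc by (simp add: lin_bar_boundary)
  then have "lin (V (Suc j)) (bar_boundary act y) + lin (V j) q
      = lin (bd (V (Suc j))) y + (lin (V j) q + lin (bd \<Phi>) q)"
    by (simp add: lin_bar_boundary)
  also have "\<dots> = lin (\<lambda>(as, m). bd (V (Suc j)) (as, m)
      + (V j (as, residue_at j m) + bd \<Phi> (as, residue_at j m))) y"
    unfolding q lin_lin by (simp add: lin_plus_fun[symmetric] case_prod_unfold)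
  also have "\<dots> \<in> hits k"
  proof (rule lin_hits, clarify)
    fix as m assume "(as, m) \<in> Poly_Mapping.keys y"
    then have w: "(as, m) \<in> bar_symbols (Hp k j) (k - j) d"
      using y by (auto simp: bar_chains_def)
    then have as: "as \<noteq> []" "length as = k - j" using j by (auto simp: bar_symbols_def)
    from w obtain e where "m \<in> poly_hat_part j e" by (auto simp: bar_symbols_def desuspend_def)
    then have "m + residue_at j m * iv j \<in> PP (Suc j)" by (rule poly_hat_partD)
    from V_bd_hits[OF this, of as] have "bd (V (Suc j)) (as, m + residue_at j m * iv j) \<in> hits k"
      using as j by simp
    moreover have "bd (V (Suc j)) (as, m + residue_at j m * iv j)
      = bd (V (Suc j)) (as, m) + bd (V (Suc j)) (as, residue_at j m * iv j)"
      by (rule multilinearD(2)[OF multilinear_bd[OF multilinear_V]])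
    ultimately show "bd (V (Suc j)) (as, m) + (V j (as, residue_at j m) + bd \<Phi> (as, residue_at j m)) \<in> hits k"
      using bd_mult_iv[OF as(1), of j "residue_at j m"] by (simp add: \<Phi>_def add_ac)
  qed
  finally show ?thesis .
qed

section \<open>Explicit lifts: the chain sets defining the transfer are nonempty\<close>

lemma zero_bar_relations [simp]: "0 \<in> bar_relations M n d"
  by (simp add: bar_relations_def)

lemma add_bar_relations: "x \<in> bar_relations M n d \<Longrightarrow> y \<in> bar_relations M n d \<Longrightarrow> x + y \<in> bar_relations M n d"
  unfolding bar_relations_def by (rule group_closure_add)

lemma lin_bar_relations:
  "(\<And>w. w \<in> Poly_Mapping.keys x \<Longrightarrow> f w \<in> bar_relations M n d) \<Longrightarrow> lin f x \<in> bar_relations M n d"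
  unfolding lin_def bar_relations_def by (rule group_closure_sum)

lemma bar_relations_slot:
  assumes "(us @ (a + b) # vs, m) \<in> bar_symbols M n d" "(us @ a # vs, m) \<in> bar_symbols M n d"
    "(us @ b # vs, m) \<in> bar_symbols M n d"
  shows "basis (us @ (a + b) # vs, m) + basis (us @ a # vs, m) + basis (us @ b # vs, m :: laurent)
    \<in> bar_relations M n d"
  unfolding bar_relations_def using assms
  by (intro group_closure.base insertI2 UnI1 CollectI exI[of _ us] exI[of _ a] exI[of _ b] exI[of _ vs] exI[of _ m]) auto

lemma bar_relations_module:
  assumes "(as, m + m') \<in> bar_symbols M n d" "(as, m) \<in> bar_symbols M n d" "(as, m') \<in> bar_symbols M n d"
  shows "basis (as, m + m') + basis (as, m) + basis (as, m' :: laurent) \<in> bar_relations M n d"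
  unfolding bar_relations_def using assms
  by (intro group_closure.base insertI2 UnI2 CollectI exI[of _ as] exI[of _ m] exI[of _ m']) auto

lemma bar_relations_induct [consumes 1, case_names zero slot module add]:
  assumes "x \<in> bar_relations M n d" "P 0"
    "\<And>us a b vs m. (us @ (a + b) # vs, m) \<in> bar_symbols M n d \<Longrightarrow> (us @ a # vs, m) \<in> bar_symbols M n d \<Longrightarrow>
      (us @ b # vs, m) \<in> bar_symbols M n d \<Longrightarrow>
      P (basis (us @ (a + b) # vs, m) + basis (us @ a # vs, m) + basis (us @ b # vs, m))"
    "\<And>as m m'. (as, m + m') \<in> bar_symbols M n d \<Longrightarrow> (as, m) \<in> bar_symbols M n d \<Longrightarrow>
      (as, m') \<in> bar_symbols M n d \<Longrightarrow> P (basis (as, m + m') + basis (as, m) + basis (as, m'))"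
    "\<And>x y. P x \<Longrightarrow> P y \<Longrightarrow> P (x + y)"
  shows "P (x :: laurent bar)"
  using assms(1) unfolding bar_relations_def
proof (induction rule: group_closure_pm_induct)
  case (base s)
  then show ?case using assms(3,4) by auto
qed (auto intro: assms)

lemma bar_chains_add: "x \<in> bar_chains M n d \<Longrightarrow> y \<in> bar_chains M n d \<Longrightarrow> x + y \<in> bar_chains M n d"
  using keys_add[of x y] by (auto simp: bar_chains_def)

lemma zero_bar_chains [simp]: "0 \<in> bar_chains M n d"
  by (simp add: bar_chains_def)

lemma basis_bar_chains [simp]: "basis w \<in> bar_chains M n d \<longleftrightarrow> w \<in> bar_symbols M n d"
  by (simp add: bar_chains_def)

lemma lin_bar_chains:
  assumes "\<And>w. w \<in> Poly_Mapping.keys x \<Longrightarrow> f w \<in> bar_symbols M n d"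
  shows "lin (\<lambda>w. basis (f w)) x \<in> bar_chains M n d"
proof -
  have "(\<Sum>w\<in>W. basis (f w)) \<in> bar_chains M n d" if "\<forall>w\<in>W. f w \<in> bar_symbols M n d" for W
    using that by (induction W rule: infinite_finite_induct) (auto intro: bar_chains_add)
  then show ?thesis using assms by (simp add: lin_def)
qed

lemma bar_symbols_map:
  assumes "(as, m) \<in> bar_symbols M n d" "\<And>e. m \<in> M e \<Longrightarrow> f \<in> M' e"
  shows "(as, f) \<in> bar_symbols M' n d"
  using assms unfolding bar_symbols_def by blast

lemma bar_symbols_last:
  assumes "(as @ [b], m) \<in> bar_symbols M n d"
    and "\<And>e i. m \<in> M e \<Longrightarrow> b \<in> steenrod_part i \<Longrightarrow> f \<in> M' (e + i)"
  shows "(as, f) \<in> bar_symbols M' (n - 1) d"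
proof -
  from assms(1) obtain ds e where ds: "list_all2 (\<lambda>a i. a \<in> steenrod_part i) (as @ [b]) ds"
    "m \<in> M e" "sum_list ds + e = d" "n = Suc (length as)"
    by (auto simp: bar_symbols_def)
  then obtain ds' i where "ds = ds' @ [i]" "list_all2 (\<lambda>a i. a \<in> steenrod_part i) as ds'" "b \<in> steenrod_part i"
    by (auto simp: list_all2_append1 list_all2_Cons1)
  with ds assms(2)[of e i] show ?thesis
    by (auto simp: bar_symbols_def intro!: exI[of _ ds'] exI[of _ "e + i"])
qed

lemma bar_symbols_merge_last:
  assumes "(as @ [c, b], m) \<in> bar_symbols M n d"
  shows "(as @ [c * b], m) \<in> bar_symbols M (n - 1) d"
proof -
  from assms obtain ds e where ds: "list_all2 (\<lambda>a i. a \<in> steenrod_part i) (as @ [c, b]) ds"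
    "m \<in> M e" "sum_list ds + e = d" "n = Suc (Suc (length as))"
    by (auto simp: bar_symbols_def)
  then obtain ds' i i' where "ds = ds' @ [i, i']" "list_all2 (\<lambda>a i. a \<in> steenrod_part i) as ds'"
    "c \<in> steenrod_part i" "b \<in> steenrod_part i'"
    by (auto simp: list_all2_append1 list_all2_Cons1)
  moreover from this have "list_all2 (\<lambda>a i. a \<in> steenrod_part i) (as @ [c * b]) (ds' @ [i + i'])"
    by (intro list_all2_appendI) (simp_all add: steenrod_part_mult)
  ultimately show ?thesis using ds
    unfolding bar_symbols_def by (intro CollectI case_prodI conjI exI[of _ "ds' @ [i + i']"] exI[of _ e]) auto
qed

lemma Lp_act: "m \<in> Lp k j e \<Longrightarrow> b \<in> steenrod_part i \<Longrightarrow> act b m \<in> Lp k j (e + i)"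
  using act_poly_part[of b i m j "e + int (k - j)"] by (simp add: desuspend_def algebra_simps)

lemma Lp_D: "j < k \<Longrightarrow> m \<in> Lp k j e \<Longrightarrow> b \<in> steenrod_part i \<Longrightarrow> D j b m \<in> Lp k (Suc j) (e + i)"
  using D_poly_part[of b i m "Suc j" "e + int (k - j)" j]
  by (simp add: desuspend_def poly_part_mono of_nat_diff algebra_simps)

lemma Lp_iv: "j < k \<Longrightarrow> m \<in> Lp k j e \<Longrightarrow> m * iv j \<in> Hp k j e"
  using mult_iv_hat[of m j "e + int (k - Suc j)"] by (simp add: desuspend_def of_nat_diff algebra_simps)

lemma Lp_Hp: "m \<in> Lp k (Suc j) e \<Longrightarrow> m \<in> Hp k j e"
  by (simp add: desuspend_def poly_part_hat)

lemma Hp_add: "m \<in> Hp k j e \<Longrightarrow> m' \<in> Hp k j e \<Longrightarrow> m + m' \<in> Hp k j e"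
  by (simp add: desuspend_def poly_hat_part_add)

text \<open>\<open>ivS\<close> is a chosen lift and \<open>tauS\<close> the resulting connecting
  map. Both live on formal symbols, so their compatibility with relations and boundaries has to be
  proved.\<close>

definition tauS :: "nat \<Rightarrow> bar_symbol \<Rightarrow> laurent bar"
  where "tauS j = (\<lambda>(as, m). basis (butlast as, D j (last as) m))"

definition ivS :: "nat \<Rightarrow> bar_symbol \<Rightarrow> laurent bar"
  where "ivS j = (\<lambda>(as, m). basis (as, m * iv j))"

lemma bar_symbols_D:
  "j < k \<Longrightarrow> (as @ [b], m) \<in> bar_symbols (Lp k j) n d \<Longrightarrow> (as, D j b m) \<in> bar_symbols (Lp k (Suc j)) (n - 1) d"
  by (erule bar_symbols_last) (rule Lp_D)

lemma bar_symbols_act: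
  "(as @ [b], m) \<in> bar_symbols (Lp k j) n d \<Longrightarrow> (as, act b m) \<in> bar_symbols (Lp k j) (n - 1) d"
  by (erule bar_symbols_last) (rule Lp_act)

lemma tauS_relations:
  assumes "x \<in> bar_relations (Lp k j) n d" "j < k" "0 < n"
  shows "lin (tauS j) x \<in> bar_relations (Lp k (Suc j)) (n - 1) d"
  using assms(1)
proof (induction rule: bar_relations_induct)
  case (slot us a b vs m)
  show ?case
  proof (cases vs rule: rev_cases)
    \<comment> \<open>A relation in the last slot is absorbed by \<open>D j\<close> and becomes a
      relation in the module entry.\<close>
    case Nil
    then show ?thesis using slot bar_symbols_D[OF assms(2)] unfolding Nil
      by (simp add: tauS_def D_add_left) (rule bar_relations_module; simp flip: D_add_left)
  next
    case (snoc vs' c)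
    have "(us @ e # vs', D j c m) \<in> bar_symbols (Lp k (Suc j)) (n - 1) d"
      if "(us @ e # vs, m) \<in> bar_symbols (Lp k j) n d" for e
      using bar_symbols_D[OF assms(2), of "us @ e # vs'" c] that snoc by simp
    from bar_relations_slot[OF this[OF slot(1)] this[OF slot(2)] this[OF slot(3)]]
    show ?thesis by (simp add: tauS_def snoc butlast_append)
  qed
next
  case (module as m m')
  then have "as \<noteq> []" using assms(3) by (auto simp: bar_symbols_def)
  then obtain as' b where as: "as = as' @ [b]" by (cases as rule: rev_cases) auto
  show ?case using module bar_symbols_D[OF assms(2)] unfolding as
    by (simp add: tauS_def D_add_right) (rule bar_relations_module; simp flip: D_add_right)
qed (simp_all add: add_bar_relations)

lemma ivS_relations:
  assumes "x \<in> bar_relations (Lp k j) n d" "j < k"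
  shows "lin (ivS j) x \<in> bar_relations (Hp k j) n d"
proof -
  have sym: "(as, m * iv j) \<in> bar_symbols (Hp k j) n d" if "(as, m) \<in> bar_symbols (Lp k j) n d" for as m
    using that by (rule bar_symbols_map) (rule Lp_iv[OF assms(2)])
  from assms(1) show ?thesis
  proof (induction rule: bar_relations_induct)
    case (slot us a b vs m)
    then show ?case using bar_relations_slot[OF sym sym sym] by (simp add: ivS_def)
  next
    case (module as m m')
    then show ?case using sym by (simp add: ivS_def distrib_right) (rule bar_relations_module; simp flip: distrib_right)
  qed (simp_all add: add_bar_relations)
qed

lemma bd_basis: "bd basis w = bar_boundary act (basis w)"
  by (simp add: bd_def lin_basis_id)

lemma bar_boundary_lin: "bar_boundary act (lin f x) = lin (\<lambda>w. bar_boundary act (f w :: laurent bar)) x"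
  by (induction x rule: basis_induct) simp_all

text \<open>By \<open>D_mult\<close> the merged pair contributes the module entry
  \<open>X + Z\<close>, while the neighbouring faces contribute \<open>X\<close> and
  \<open>Z\<close> as separate symbols. The defect is therefore a single module relation.\<close>

lemma tauS_boundary:
  assumes "(as, m) \<in> bar_symbols (Lp k j) n d" "j < k" "1 < n"
  shows "bar_boundary act (tauS j (as, m)) + bd (tauS j) (as, m) \<in> bar_relations (Lp k (Suc j)) (n - 2) d"
proof -
  have "length as = n" using assms(1) by (simp add: bar_symbols_def)
  with assms(3) obtain bs b where 1: "as = bs @ [b]" "bs \<noteq> []"
    by (cases as rule: rev_cases) auto
  from 1(2) obtain as' c where 2: "bs = as' @ [c]" by (cases bs rule: rev_cases) auto
  have as: "as = as' @ [c, b]" using 1 2 by simp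
  define X Z where "X = act c (D j b m)" and "Z = D j c (act b m)"
  have w: "((as' @ [c]) @ [b], m) \<in> bar_symbols (Lp k j) n d" using assms(1) as by simp
  have n: "n - 1 - 1 = n - 2" by simp
  have X: "(as', X) \<in> bar_symbols (Lp k (Suc j)) (n - 2) d"
    using bar_symbols_act[OF bar_symbols_D[OF assms(2) w]] by (simp only: X_def n)
  have Z: "(as', Z) \<in> bar_symbols (Lp k (Suc j)) (n - 2) d"
    using bar_symbols_D[OF assms(2) bar_symbols_act[OF w]] by (simp only: Z_def n)
  have "(as', D j (c * b) m) \<in> bar_symbols (Lp k (Suc j)) (n - 2) d"
    using bar_symbols_D[OF assms(2) bar_symbols_merge_last] assms(1) as by (metis n)
  then have Y: "(as', X + Z) \<in> bar_symbols (Lp k (Suc j)) (n - 2) d" by (simp add: D_mult X_def Z_def)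
  have "bd (tauS j) (bs @ [b], m) = bd basis (bs, D j b m)
      + basis (as', X) + basis (as', D j (c * b) m) + basis (as', Z)"
    using bd_step[OF 1(2), of "tauS j" basis "D j" b m] by (simp add: tauS_def 2 X_def Z_def)
  then have "bar_boundary act (tauS j (as, m)) + bd (tauS j) (as, m)
      = basis (as', X + Z) + basis (as', X) + basis (as', Z)"
    by (simp add: 1(1) bd_basis D_mult X_def Z_def add_ac) (simp add: tauS_def)
  then show ?thesis using bar_relations_module[OF Y X Z] by simp
qed

lemma bar_boundary_chains_0:
  "x \<in> bar_chains M 0 d \<Longrightarrow> bar_boundary act (x :: laurent bar) = 0"
proof -
  assume "x \<in> bar_chains M 0 d"
  then have "lin (bd basis) x = lin (\<lambda>w. 0) x"
    by (intro lin_cong) (auto simp: bar_chains_def bar_symbols_def)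
  then show ?thesis using lin_bar_boundary[of basis x] by (simp add: lin_basis_id) (simp add: lin_def)
qed

text \<open>The lift of \<open>q\<close> is \<open>ivS\<close> of \<open>q\<close>. Its boundary is
  \<open>tauS\<close> of \<open>q\<close> plus \<open>ivS\<close> of the boundary of
  \<open>q\<close>, up to relations, and the last term consists of relations because
  \<open>q\<close> is a cycle.\<close>

lemma tauS_connecting:
  assumes q: "q \<in> transfer_chain k d j c" "q \<in> bar_cycles act (Lp k j) (k - j) d" and j: "j < k"
  shows "lin (tauS j) q \<in> bar_cycles act (Lp k (Suc j)) (k - Suc j) d"
    and "lin (tauS j) q \<in> transfer_chain k d (Suc j) c"
proof -
  have sym: "w \<in> bar_symbols (Lp k j) (k - j) d" if "w \<in> Poly_Mapping.keys q" for w
    using that q(2) by (auto simp: bar_cycles_def bar_chains_def)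
  have bq: "bar_boundary act q \<in> bar_relations (Lp k j) (k - j - 1) d"
    using q(2) by (simp add: bar_cycles_def)
  have lastD: "\<exists>bs b. as = bs @ [b]" if "(as, m) \<in> bar_symbols M (k - j) d" for as and m :: laurent and M
    using that j by (cases as rule: rev_cases) (auto simp: bar_symbols_def)
  have kj: "k - j - 1 = k - Suc j" by simp
  have tau: "(butlast as, D j (last as) m) \<in> bar_symbols (Lp k (Suc j)) (k - Suc j) d"
    if w: "(as, m) \<in> bar_symbols (Lp k j) (k - j) d" for as m
  proof -
    from lastD[OF w] obtain bs b where as: "as = bs @ [b]" by blast
    show ?thesis using bar_symbols_D[OF j w[unfolded as]] by (simp only: as kj butlast_snoc last_snoc)
  qed
  have chain: "lin (tauS j) q \<in> bar_chains (Lp k (Suc j)) (k - Suc j) d"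
    using lin_bar_chains[of q "\<lambda>(as, m). (butlast as, D j (last as) m)"] sym tau
    by (auto simp: tauS_def case_prod_unfold)
  show cyc: "lin (tauS j) q \<in> bar_cycles act (Lp k (Suc j)) (k - Suc j) d"
  proof (cases "k - Suc j = 0")
    case True
    then show ?thesis using chain bar_boundary_chains_0 by (simp add: bar_cycles_def)
  next
    case False
    have "bar_boundary act (lin (tauS j) q) + lin (tauS j) (bar_boundary act q)
        = lin (\<lambda>w. bar_boundary act (tauS j w) + bd (tauS j) w) q"
      by (simp add: lin_plus_fun lin_bar_boundary bar_boundary_lin)
    also have "\<dots> \<in> bar_relations (Lp k (Suc j)) (k - j - 2) d"
      by (rule lin_bar_relations, clarify, rule tauS_boundary[OF sym j]) (use False in auto)
    finally have 1: "bar_boundary act (lin (tauS j) q) + lin (tauS j) (bar_boundary act q)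
      \<in> bar_relations (Lp k (Suc j)) (k - j - 2) d" .
    have "lin (tauS j) (bar_boundary act q) \<in> bar_relations (Lp k (Suc j)) (k - j - 2) d"
      using tauS_relations[OF bq j] False by simp
    from add_bar_relations[OF 1 this] show ?thesis
      using chain by (simp add: bar_cycles_def add.assoc)
  qed
  define y where "y = lin (ivS j) q"
  have y: "y \<in> bar_chains (Hp k j) (Suc (k - Suc j)) d"
  proof -
    have "Suc (k - Suc j) = k - j" using j by simp
    moreover have "(as, m * iv j) \<in> bar_symbols (Hp k j) (k - j) d" if "(as, m) \<in> Poly_Mapping.keys q" for as m
      by (rule bar_symbols_map[OF sym[OF that]]) (rule Lp_iv[OF j])
    ultimately show ?thesis
      using lin_bar_chains[of q "\<lambda>(as, m). (as, m * iv j)" "Hp k j" "k - j" d]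
      by (auto simp: y_def ivS_def case_prod_unfold)
  qed
  have "lin (\<lambda>(as, m). basis (as, residue_at j m)) y = lin basis q"
    unfolding y_def lin_lin
  proof (rule lin_cong, clarify)
    fix as m assume "(as, m) \<in> Poly_Mapping.keys q"
    from sym[OF this] have "m \<in> PP j" by (auto simp: bar_symbols_def desuspend_def poly_part_PP)
    then show "lin (\<lambda>(as, m). basis (as, residue_at j m)) (ivS j (as, m)) = basis (as, m)"
      by (simp add: ivS_def residue_at_mult_iv)
  qed
  then have py: "lin (\<lambda>(as, m). basis (as, residue_at j m)) y = q" by (simp add: lin_basis_id)
  \<comment> \<open>On each symbol the sum is the relation that splits
    \<open>act b (m * iv j)\<close> into \<open>D j b m\<close> and
    \<open>act b m * iv j\<close>.\<close>
  have "lin (tauS j) q + bar_boundary act y + lin (ivS j) (bar_boundary act q)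
      = lin (\<lambda>w. tauS j w + (bar_boundary act (ivS j w) + bd (ivS j) w)) q"
    by (simp add: lin_plus_fun lin_bar_boundary bar_boundary_lin y_def add.assoc)
  also have "\<dots> \<in> bar_relations (Hp k j) (k - Suc j) d"
  proof (rule lin_bar_relations, clarify)
    fix as m assume "(as, m) \<in> Poly_Mapping.keys q"
    then have w: "(as, m) \<in> bar_symbols (Lp k j) (k - j) d" by (rule sym)
    then obtain bs b where as: "as = bs @ [b]" using lastD by blast
    define X Y where "X = D j b m" and "Y = act b m * iv j"
    have X: "(bs, X) \<in> bar_symbols (Hp k j) (k - Suc j) d"
      using bar_symbols_map[OF tau[OF w] Lp_Hp] by (simp add: as X_def)
    have "(bs, act b m) \<in> bar_symbols (Lp k j) (k - Suc j) d"
      using bar_symbols_act[of bs b] w as by fastforce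
    then have Y: "(bs, Y) \<in> bar_symbols (Hp k j) (k - Suc j) d"
      unfolding Y_def by (rule bar_symbols_map) (rule Lp_iv[OF j])
    have "(bs, X + Y) \<in> bar_symbols (Hp k j) (k - j - 1) d"
      unfolding X_def Y_def
      by (rule bar_symbols_last[OF w[unfolded as]])
         (intro Hp_add Lp_Hp Lp_D Lp_iv Lp_act j; assumption)
    then have XY: "(bs, X + Y) \<in> bar_symbols (Hp k j) (k - Suc j) d" by simp
    have eq: "act b (m * iv j) = X + Y" by (simp add: X_def Y_def D_def add.assoc)
    have "tauS j (as, m) + (bar_boundary act (ivS j (as, m)) + bd (ivS j) (as, m))
        = basis (bs, X + Y) + basis (bs, X) + basis (bs, Y)"
      unfolding as ivS_def prod.case bd_basis[symmetric]
      by (simp add: bd_unfold tauS_def eq) (simp add: X_def Y_def add_ac)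
    then show "tauS j (as, m) + (bar_boundary act (ivS j (as, m)) + bd (ivS j) (as, m))
      \<in> bar_relations (Hp k j) (k - Suc j) d"
      using bar_relations_module[OF XY X Y] by simp
  qed
  finally have 1: "lin (tauS j) q + bar_boundary act y + lin (ivS j) (bar_boundary act q)
    \<in> bar_relations (Hp k j) (k - Suc j) d" .
  have "lin (ivS j) (bar_boundary act q) \<in> bar_relations (Hp k j) (k - Suc j) d"
    using ivS_relations[OF bq j] by simp
  from add_bar_relations[OF 1 this]
  have "lin (tauS j) q - bar_boundary act y \<in> bar_relations (Hp k j) (k - Suc j) d"
    by (simp add: add.assoc)
  then show "lin (tauS j) q \<in> transfer_chain k d (Suc j) c"
    using cyc y py q(1) by (auto simp: connecting_def intro!: bexI[of _ y])
qed

section \<open>Indeterminacy and value of the composite of connecting homomorphisms\<close>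

lemma sum_bar_relations:
  "(\<And>i. i \<in> I \<Longrightarrow> f i \<in> bar_relations M n d) \<Longrightarrow> sum f I \<in> bar_relations M n d"
  unfolding bar_relations_def by (rule group_closure_sum)

definition homog :: "steenrod list \<Rightarrow> bool"
  where "homog as \<longleftrightarrow> (\<forall>a\<in>set as. \<exists>i. a \<in> steenrod_part i)"

lemma zero_bar_symbols:
  assumes "homog as" "length as = n" "\<And>e. 0 \<in> M e"
  shows "(as, 0) \<in> bar_symbols M n d"
proof -
  from assms(1) obtain f where f: "\<And>a. a \<in> set as \<Longrightarrow> a \<in> steenrod_part (f a)"
    unfolding homog_def by metis
  have "list_all2 (\<lambda>a i. a \<in> steenrod_part i) as (map f as)"
    by (auto simp: list_all2_conv_all_nth f)
  moreover have "sum_list (map f as) + (d - sum_list (map f as)) = d" by simp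
  ultimately show ?thesis unfolding bar_symbols_def using assms(2,3) by blast
qed

lemma zero_bar_relations_basis:
  assumes "homog as" "length as = n" "\<And>e. 0 \<in> M e"
  shows "basis (as, 0 :: laurent) \<in> bar_relations M n d"
  using bar_relations_module[of as 0 0 M n d] zero_bar_symbols[OF assms] by simp

lemma homog_merge:
  assumes "homog as" "i < length as - 1"
  shows "homog (merge i as)"
proof -
  have "as ! i \<in> set as" "as ! Suc i \<in> set as" using assms(2) by simp_all
  with assms(1) obtain d d' where "as ! i \<in> steenrod_part d" "as ! Suc i \<in> steenrod_part d'"
    unfolding homog_def by metis
  then have "as ! i * as ! Suc i \<in> steenrod_part (d + d')" by (rule steenrod_part_mult)
  moreover have "set (merge i as) \<subseteq> insert (as ! i * as ! Suc i) (set as)"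
    using set_take_subset[of i as] set_drop_subset[of "i + 2" as] by (auto simp: merge_def)
  ultimately show ?thesis using assms(1) unfolding homog_def by blast
qed

lemma boundary_zero_relations:
  assumes "homog as" "length as = n" "\<And>e. 0 \<in> M e"
  shows "bar_boundary act (basis (as, 0 :: laurent)) \<in> bar_relations M (n - 1) d"
proof (cases "as = []")
  case False
  have rel: "basis (bs, 0 :: laurent) \<in> bar_relations M (n - 1) d" if "homog bs" "length bs = n - 1" for bs
    using that assms(3) by (rule zero_bar_relations_basis)
  have "(\<Sum>i<length as - 1. basis (merge i as, 0 :: laurent)) \<in> bar_relations M (n - 1) d"
  proof (rule sum_bar_relations, rule rel)
    fix i assume "i \<in> {..<length as - 1}"
    then show "homog (merge i as)" "length (merge i as) = n - 1"
      using assms homog_merge[of as i] by (auto simp: merge_def)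
  qed
  moreover have "homog (tl as)" "homog (butlast as)"
    using assms(1) by (auto simp: homog_def dest: in_set_butlastD list.set_sel(2)[OF False])
  then have "basis (butlast as, 0) \<in> bar_relations M (n - 1) d" "scb c (basis (tl as, 0)) \<in> bar_relations M (n - 1) d" for c
    using assms(2) rel by (auto simp: scb_def)
  ultimately show ?thesis
    unfolding bd_basis[symmetric] using False by (auto simp: bd_unfold intro!: add_bar_relations)
next
  case True
  then show ?thesis by (simp add: bar_boundary_def)
qed

text \<open>A symbol with module entry 0 is a relation, not the formal sum 0. Such symbols arise
  when a lift is changed by a chain of polynomials, whose residues are 0, and have to be
  absorbed.\<close>

lemma transfer_chain_zero_symbol:
  assumes c: "c = (+) z ` bar_boundaries act (poly_part 0) k (d + int k)"
    and x: "x \<in> transfer_chain k d j c" and as: "homog as" "length as = k - j"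
  shows "x + basis (as, 0) \<in> transfer_chain k d j c"
proof (cases j)
  case 0
  from x c 0 obtain y r where xy: "x = z + (bar_boundary act y + r)" "y \<in> bar_chains (poly_part 0) (Suc k) (d + int k)"
    "r \<in> bar_relations (poly_part 0) k (d + int k)"
    by (auto simp: bar_boundaries_def)
  have "basis (as, 0) \<in> bar_relations (poly_part 0) k (d + int k)"
    using as 0 by (intro zero_bar_relations_basis) auto
  then have "r + basis (as, 0) \<in> bar_relations (poly_part 0) k (d + int k)"
    using xy(3) by (intro add_bar_relations)
  moreover have "x + basis (as, 0) = z + (bar_boundary act y + (r + basis (as, 0)))"
    by (simp add: xy add_ac)
  ultimately show ?thesis using xy(2) unfolding 0 transfer_chain.simps c bar_boundaries_def by blast
next
  case (Suc i)
  from x obtain y where x': "x \<in> bar_cycles act (Lp k (Suc i)) (k - Suc i) d"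
    and y: "y \<in> bar_chains (Hp k i) (Suc (k - Suc i)) d"
    "lin (\<lambda>(as, m). basis (as, residue_at i m)) y \<in> transfer_chain k d i c"
    "x - bar_boundary act y \<in> bar_relations (Hp k i) (k - Suc i) d"
    unfolding Suc by (auto simp: connecting_def)
  have 0: "0 \<in> Lp k (Suc i) e" "0 \<in> Hp k i e" for e by (simp_all add: desuspend_def)
  have "bar_boundary act (basis (as, 0)) \<in> bar_relations (Lp k (Suc i)) (k - Suc i - 1) d"
    using as 0 by (intro boundary_zero_relations) (auto simp: Suc)
  then have "x + basis (as, 0) \<in> bar_cycles act (Lp k (Suc i)) (k - Suc i) d"
    using x' as 0 by (auto simp: bar_cycles_def Suc intro!: bar_chains_add add_bar_relations zero_bar_symbols)
  moreover have "basis (as, 0) \<in> bar_relations (Hp k i) (k - Suc i) d"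
    using as 0 by (intro zero_bar_relations_basis) (auto simp: Suc)
  then have "(x - bar_boundary act y) + basis (as, 0) \<in> bar_relations (Hp k i) (k - Suc i) d"
    using y(3) by (intro add_bar_relations)
  then have "(x + basis (as, 0)) - bar_boundary act y \<in> bar_relations (Hp k i) (k - Suc i) d"
    by (simp add: add_ac)
  ultimately show ?thesis using y unfolding Suc by (auto simp: connecting_def)
qed

text \<open>Adding \<open>[Sq n]g\<close> to the lift changes its residue only by a zero symbol, as
  \<open>g\<close> is a polynomial, and its boundary by \<open>Sq_op n g\<close>. This makes the
  value of the transfer a whole coset of hit polynomials.\<close>

lemma transfer_chain_add_hit:
  assumes c: "c = (+) z ` bar_boundaries act (poly_part 0) (Suc j) (d + int (Suc j))"
    and x: "x \<in> transfer_chain (Suc j) d (Suc j) c" and g: "0 < n" "g \<in> poly_part (Suc j) (d - int n)"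
  shows "x + basis ([], Sq_op n g) \<in> transfer_chain (Suc j) d (Suc j) c"
proof -
  let ?k = "Suc j"
  from x obtain y where x': "x \<in> bar_cycles act (Lp ?k ?k) 0 d"
    and y: "y \<in> bar_chains (Hp ?k j) (Suc 0) d"
    "lin (\<lambda>(as, m). basis (as, residue_at j m)) y \<in> transfer_chain ?k d j c"
    "x - bar_boundary act y \<in> bar_relations (Hp ?k j) 0 d"
    by (auto simp: connecting_def)
  have Sq: "Sq n \<in> steenrod_part (int n)" using sq_prod_steenrod_part[of "[n]"] by simp
  have "([], Sq_op n g) \<in> bar_symbols (Lp ?k ?k) 0 d"
    using Sq_op_poly_part[OF g(2), of n] by (simp add: bar_symbols_def desuspend_def)
  then have ch: "x + basis ([], Sq_op n g) \<in> bar_chains (Lp ?k ?k) 0 d"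
    using x' by (auto simp: bar_cycles_def intro!: bar_chains_add)
  then have 1: "x + basis ([], Sq_op n g) \<in> bar_cycles act (Lp ?k ?k) 0 d"
    unfolding bar_cycles_def using bar_boundary_chains_0[OF ch] by simp
  \<comment> \<open>The face with the augmentation vanishes because \<open>n > 0\<close>.\<close>
  have bg: "bar_boundary act (basis ([Sq n], g)) = basis ([], Sq_op n g)"
    using g(1) by (simp add: bar_boundary_def augment_Sq act_Sq)
  have "\<exists>ds e. list_all2 (\<lambda>a i. a \<in> steenrod_part i) [Sq n] ds \<and> g \<in> Hp ?k j e \<and> sum_list ds + e = d"
    using Sq g(2) by (intro exI[of _ "[int n]"] exI[of _ "d - int n"]) (simp add: desuspend_def poly_part_hat)
  then have "([Sq n], g) \<in> bar_symbols (Hp ?k j) (Suc 0) d" by (simp add: bar_symbols_def)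
  then have 2: "y + basis ([Sq n], g) \<in> bar_chains (Hp ?k j) (Suc 0) d"
    using y(1) by (auto intro!: bar_chains_add)
  have "residue_at j g = 0" using residue_at_PP[OF poly_part_PP[OF g(2)]] .
  then have "lin (\<lambda>(as, m). basis (as, residue_at j m)) (y + basis ([Sq n], g))
      = lin (\<lambda>(as, m). basis (as, residue_at j m)) y + basis ([Sq n], 0)"
    by simp
  moreover have "lin (\<lambda>(as, m). basis (as, residue_at j m)) y + basis ([Sq n], 0) \<in> transfer_chain ?k d j c"
    using Sq by (intro transfer_chain_zero_symbol[OF c y(2)]) (auto simp: homog_def)
  ultimately have 3: "lin (\<lambda>(as, m). basis (as, residue_at j m)) (y + basis ([Sq n], g)) \<in> transfer_chain ?k d j c"
    by simp
  have "(x + basis ([], Sq_op n g)) - bar_boundary act (y + basis ([Sq n], g)) = x - bar_boundary act y"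
    by (simp add: bg add_ac)
  then have "(x + basis ([], Sq_op n g)) - bar_boundary act (y + basis ([Sq n], g)) \<in> bar_relations (Hp ?k j) 0 d"
    using y(3) by (simp only:)
  with 1 2 3 show ?thesis
    by (auto simp: connecting_def simp del: bar_boundary_add lin_pm_add intro!: bexI[of _ "y + basis ([Sq n], g)"])
qed

lemma cycle_multilinear:
  "q \<in> bar_cycles act M n d \<Longrightarrow> multilinear \<Phi> \<Longrightarrow> lin \<Phi> (bar_boundary act q) = 0"
  by (rule multilinear_relations[of _ _ M "n - 1" d]) (simp_all add: bar_cycles_def)

text \<open>Whatever lifts are chosen, the value stays that of \<open>z\<close> modulo hits. The
  induction also carries the cycle condition that \<open>connecting_value\<close> demands; at stage
  0 it rests on \<open>bd_bd\<close>, because a member of \<open>c\<close> is \<open>z\<close> plus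
  a boundary and relations.\<close>

lemma transfer_chain_value:
  assumes c: "c = (+) z ` bar_boundaries act (poly_part 0) k (d + int k)"
    and z: "z \<in> bar_cycles act (poly_part 0) k (d + int k)"
    and x: "x \<in> transfer_chain k d j c" and j: "j \<le> k"
  shows "(\<forall>\<Phi> :: bar_symbol \<Rightarrow> laurent. multilinear \<Phi> \<longrightarrow> lin \<Phi> (bar_boundary act x) = 0)
    \<and> lin (V j) x + lin (V 0) z \<in> hits k"
  using x j
proof (induction j arbitrary: x)
  case 0
  from 0 c obtain y r where xy: "x = z + (bar_boundary act y + r)" "y \<in> bar_chains (poly_part 0) (Suc k) (d + int k)"
    "r \<in> bar_relations (poly_part 0) k (d + int k)"
    by (auto simp: bar_boundaries_def)
  have "lin \<Phi> (bar_boundary act x) = 0" if "multilinear \<Phi>" for \<Phi> :: "bar_symbol \<Rightarrow> laurent"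
  proof -
    have "lin \<Phi> (bar_boundary act (bar_boundary act y)) = lin (bd (bd \<Phi>)) y"
      by (simp only: lin_bar_boundary)
    also have "\<dots> = 0" by (simp add: bd_bd lin_def)
    finally show ?thesis
      using cycle_multilinear[OF z that] multilinear_relations[OF multilinear_bd[OF that] xy(3)]
      by (simp add: xy(1) lin_bar_boundary)
  qed
  moreover have "lin (V 0) x + lin (V 0) z = lin (bd (V 0)) y"
    using multilinear_relations[OF multilinear_V xy(3)] by (simp add: xy(1) lin_bar_boundary add_ac)
  moreover have "lin (bd (V 0)) y \<in> hits k"
  proof (rule lin_hits, clarify)
    fix as m assume "(as, m) \<in> Poly_Mapping.keys y"
    then have "(as, m) \<in> bar_symbols (poly_part 0) (Suc k) (d + int k)"
      using xy(2) by (auto simp: bar_chains_def)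
    then have "m \<in> PP 0" "length as = Suc k" by (auto simp: bar_symbols_def poly_part_PP)
    then show "bd (V 0) (as, m) \<in> hits k" using V_bd_hits[of m 0 as] by simp
  qed
  ultimately show ?case by (intro conjI allI impI) simp_all
next
  case (Suc j)
  from Suc(2) obtain y where x: "x \<in> bar_cycles act (Lp k (Suc j)) (k - Suc j) d"
    and y: "y \<in> bar_chains (Hp k j) (Suc (k - Suc j)) d"
    "lin (\<lambda>(as, m). basis (as, residue_at j m)) y \<in> transfer_chain k d j c"
    "x - bar_boundary act y \<in> bar_relations (Hp k j) (k - Suc j) d"
    by (auto simp: connecting_def)
  define q where "q = lin (\<lambda>(as, m). basis (as, residue_at j m)) y"
  have j: "j < k" "Suc (k - Suc j) = k - j" using Suc(3) by simp_all
  note IH = Suc(1)[OF y(2), folded q_def]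
  have 1: "lin (V j) q + lin (V 0) z \<in> hits k" using IH j by simp
  have 2: "lin (V (Suc j)) (bar_boundary act y) + lin (V j) q \<in> hits k"
  proof (rule connecting_value[OF _ _ q_def])
    show "lin \<Phi> (bar_boundary act q) = 0" if "multilinear \<Phi>" for \<Phi> :: "bar_symbol \<Rightarrow> laurent"
      using IH j that by simp
  qed (use y(1) j in simp_all)
  have 3: "lin (V (Suc j)) x = lin (V (Suc j)) (bar_boundary act y)"
    by (rule iffD2[OF pm_eq_iff]) (use multilinear_relations[OF multilinear_V y(3), of "Suc j"] in simp)
  have "lin (V (Suc j)) x + lin (V 0) z \<in> hits k"
    using add_hits[OF 1 2] by (simp add: 3 add_ac)
  then show ?case by (intro conjI allI impI cycle_multilinear[OF x])
qed

lemma bar_desuspend: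
  "bar_cycles ac (desuspend k M) n d = bar_cycles ac M n (d + int k)"
  "bar_chains (desuspend k M) n d = bar_chains M n (d + int k)"
  "bar_relations (desuspend k M) n d = bar_relations M n (d + int k)"
  unfolding bar_cycles_def bar_chains_def bar_relations_def bar_symbols_desuspend by (rule refl)+

lemma transfer_chain_nonempty:
  assumes c: "c = (+) z ` bar_boundaries act (poly_part 0) k (d + int k)"
    and z: "z \<in> bar_cycles act (poly_part 0) k (d + int k)" and j: "j \<le> k"
  shows "\<exists>q. q \<in> transfer_chain k d j c \<and> q \<in> bar_cycles act (Lp k j) (k - j) d"
  using j
proof (induction j)
  case 0
  have "0 = bar_boundary act 0 + (0 :: laurent bar)" by simp
  then have "0 \<in> bar_boundaries act (poly_part 0) k (d + int k)"
    unfolding bar_boundaries_def using zero_bar_chains zero_bar_relations by blast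
  then have "z \<in> c" unfolding c by (metis add.right_neutral imageI)
  with z show ?case by (auto simp: bar_desuspend)
next
  case (Suc j)
  then obtain q where "q \<in> transfer_chain k d j c" "q \<in> bar_cycles act (Lp k j) (k - j) d" "j < k" by auto
  from tauS_connecting[OF this] show ?case by blast
qed

section \<open>Invariance of the transfer\<close>

text \<open>The lift by \<open>iv l\<close> cannot be substituted, since \<open>subst\<close> is
  wrong on negative exponents; \<open>D_Sq\<close>, which contains none, is substituted
  instead.\<close>

lemma subst_D:
  assumes v: "\<And>i. i < k \<Longrightarrow> linear_form (v i)" and l: "l < k" "v l = xv l'" and n: "n \<in> PP k"
  shows "subst v (D l a n) = D l' a (subst v n)"
  using n
proof (induction a arbitrary: n rule: steenrod_induct)
  case (Sq s a)
  have PP: "D l a n \<in> PP k" "act a n \<in> PP k" using Sq l by (auto intro: D_PP act_PP)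
  have pow: "xv l' ^ t = lvar_pow l' (int t)" for t
    by (induction t) (simp_all add: lvar_pow_add[symmetric] add.commute, simp add: lvar_pow_def)
  have "subst v (D l (Sq s) (act a n)) = D l' (Sq s) (subst v (act a n))"
    unfolding D_Sq subst_sum
    by (intro sum.cong refl)
       (simp only: subst_mult[OF Sq_op_PP[OF PP(2)] lvar_pow_PP[OF l(1) of_nat_0_le_iff]]
          subst_Sq_op[OF v PP(2)] subst_lvar_pow[OF of_nat_0_le_iff] l(2) nat_int pow)
  moreover have "subst v (act (Sq s) (D l a n)) = act (Sq s) (D l' a (subst v n))"
    using PP Sq by (simp add: subst_act[OF v])
  ultimately show ?case using Sq PP by (simp add: D_mult subst_act[OF v])
qed (simp_all add: D_add_left)

lemma subst_V:
  assumes v: "\<And>i. i < k \<Longrightarrow> linear_form (v i)" and vl: "\<And>i. l \<le> i \<Longrightarrow> i < k \<Longrightarrow> v i = xv i"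
    and n: "n \<in> PP k" and "l + length as \<le> k"
  shows "subst v (V l (as, n)) = V l (as, subst v n)"
  using assms(2-4)
proof (induction as arbitrary: l n rule: rev_induct)
  case (snoc b as)
  then have "subst v (V (Suc l) (as, D l b n)) = V (Suc l) (as, subst v (D l b n))"
    by (intro snoc(1)) (auto intro: D_PP)
  also have "subst v (D l b n) = D l b (subst v n)"
    using snoc by (intro subst_D[OF v]) auto
  finally show ?case by (simp add: V_snoc)
qed simp

text \<open>\<open>V j\<close> begins with \<open>D j\<close> and \<open>D (Suc j)\<close>, the only
  steps affected by a generator in the variables \<open>j\<close> and \<open>Suc j\<close>. If it
  changes their composite by the coboundary of \<open>h\<close>, then the functional
  \<open>N\<close> built from \<open>h\<close> is a homotopy: the change of \<open>V j\<close> plus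
  \<open>bd N\<close> is hit, and \<open>bd N\<close> vanishes on cycles.\<close>

lemma transfer_homotopy:
  assumes h: "\<And>a b m. h (a + b) m = h a m + h b m" "\<And>a m m'. h a (m + m') = h a m + h a m'"
    and hPP: "\<And>a m. m \<in> PP j \<Longrightarrow> h a m \<in> PP (j + 2)"
    and E: "\<And>c b m. m \<in> PP j \<Longrightarrow> subst v (D (Suc j) c (D j b m)) + D (Suc j) c (D j b m)
      = act c (h b m) + h (c * b) m + h c (act b m)"
    and v: "\<And>i. i < k \<Longrightarrow> linear_form (v i)" "\<And>i. j + 2 \<le> i \<Longrightarrow> i < k \<Longrightarrow> v i = xv i"
    and j: "Suc j < k" and q: "q \<in> bar_chains (Lp k j) (k - j) d"
    and cyc: "\<And>\<Phi> :: bar_symbol \<Rightarrow> laurent. multilinear \<Phi> \<Longrightarrow> lin \<Phi> (bar_boundary act q) = 0"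
  shows "subst v (lin (V j) q) + lin (V j) q \<in> hits k"
proof -
  define N where "N = (\<lambda>(as, m). if as = [] then 0 else V (j + 2) (butlast as, h (last as) m))"
  have N_snoc: "N (bs @ [b], m) = V (j + 2) (bs, h b m)" for bs b m by (simp add: N_def)
  have "multilinear N"
    unfolding multilinear_def
  proof (intro conjI allI)
    fix us a b vs m
    show "N (us @ (a + b) # vs, m) = N (us @ a # vs, m) + N (us @ b # vs, m)"
    proof (cases vs rule: rev_cases)
      case Nil
      then show ?thesis by (simp add: N_snoc h V_add)
    next
      case (snoc vs' c)
      then show ?thesis
        using N_snoc[of "us @ _ # vs'" c m] by (simp add: multilinearD[OF multilinear_V])
    qed
  qed (simp add: N_def h V_add)
  then have N0: "lin (bd N) q = 0" using cyc by (simp add: lin_bar_boundary)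
  have "subst v (lin (V j) q) = lin (\<lambda>w. subst v (V j w)) q"
    by (simp add: lin_def subst_sum)
  then have "subst v (lin (V j) q) + lin (V j) q = lin (\<lambda>w. (subst v (V j w) + V j w) + bd N w) q"
    using N0 by (simp add: lin_plus_fun)
  also have "\<dots> \<in> hits k"
  proof (rule lin_hits, clarify)
    fix as m assume "(as, m) \<in> Poly_Mapping.keys q"
    then have w: "(as, m) \<in> bar_symbols (Lp k j) (k - j) d" using q by (auto simp: bar_chains_def)
    then have m: "m \<in> PP j" and len: "length as = k - j"
      by (auto simp: bar_symbols_def desuspend_def poly_part_PP)
    then have "as \<noteq> []" using j by auto
    then obtain bs b where as: "as = bs @ [b]" by (cases as rule: rev_cases) auto
    then have "bs \<noteq> []" using len j by auto
    note 1 = as this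
    from 1(2) obtain as' c where 2: "bs = as' @ [c]" by (cases bs rule: rev_cases) auto
    have len': "j + 2 + length as' = k" using len j by (simp add: 1 2)
    have mk: "m \<in> PP k" using m j by (auto intro: PP_mono)
    have VV: "V j (as, m) = V (j + 2) (as', D (Suc j) c (D j b m))"
      by (simp add: 1 2 V_snoc flip: append_assoc)
    have "subst v (V j (as, m)) + V j (as, m) = V (j + 2) (as', subst v (D (Suc j) c (D j b m)) + D (Suc j) c (D j b m))"
      unfolding VV V_add using v j mk len' by (subst subst_V[of k]) (auto intro!: D_PP)
    also have "\<dots> = V (j + 2) (as', act c (h b m)) + V (j + 2) (as', h (c * b) m) + V (j + 2) (as', h c (act b m))"
      by (simp add: E[OF m] V_add)
    also have "\<dots> + bd N (as, m) = bd (V (j + 2)) (bs, h b m)"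
      unfolding 1(1) using bd_step[OF 1(2), of N "V (j + 2)" h b m, OF N_snoc] by (simp add: 2 add_ac)
    also have "\<dots> \<in> hits k"
      using V_bd_hits[OF hPP[OF m], of bs b] len' by (simp add: 2)
    finally show "subst v (V j (as, m)) + V j (as, m) + bd N (as, m) \<in> hits k" .
  qed
  finally show ?thesis .
qed

text \<open>The swap exchanges the order of the lifts by \<open>iv j\<close> and
  \<open>iv (Suc j)\<close>. The identity \<open>step\<close> comparing both orders results from
  expanding \<open>D j\<close> alone.\<close>

lemma transfer_swap:
  assumes j: "Suc j < k" and q: "q \<in> bar_chains (Lp k j) (k - j) d"
    and cyc: "\<And>\<Phi> :: bar_symbol \<Rightarrow> laurent. multilinear \<Phi> \<Longrightarrow> lin \<Phi> (bar_boundary act q) = 0"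
  shows "subst (swap_sub j) (lin (V j) q) + lin (V j) q \<in> hits k"
proof (rule transfer_homotopy[OF _ _ _ _ _ _ j q cyc])
  \<comment> \<open>\<open>h a\<close> measures how far \<open>D (Suc j) a\<close> is from commuting
    with multiplication by \<open>iv j\<close>.\<close>
  define h where "h a m = D (Suc j) a m * iv j + D (Suc j) a (m * iv j)" for a m
  show hadd: "h (a + b) m = h a m + h b m" for a b m
    by (simp add: h_def D_add_left distrib_right add_ac)
  show "h a (m + m') = h a m + h a m'" for a m m'
    by (simp add: h_def D_add_right distrib_right add_ac)
  have step: "D j c (D (Suc j) b m) + D (Suc j) c (D j b m) = act c (h b m) + h (c * b) m + h c (act b m)" for c b m
  proof -
    have "D (Suc j) c (D j b m) = D (Suc j) c (act b (m * iv j)) + D (Suc j) c (act b m * iv j)"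
      by (simp add: D_def[of j] D_add_right)
    moreover have "D j c (D (Suc j) b m) = act c (D (Suc j) b m * iv j) + act c (D (Suc j) b m) * iv j"
      by (simp add: D_def[of j])
    ultimately show ?thesis
      by (simp add: h_def D_mult act_add_right distrib_right add_ac)
  qed
  show E: "subst (swap_sub j) (D (Suc j) c (D j b m)) + D (Suc j) c (D j b m)
      = act c (h b m) + h (c * b) m + h c (act b m)" if m: "m \<in> PP j" for c b m
  proof -
    have v: "linear_form (swap_sub j i)" for i by (simp add: swap_sub_def)
    have mk: "m \<in> PP k" using m j by (auto intro: PP_mono)
    have "subst (swap_sub j) (D (Suc j) c (D j b m)) = D j c (subst (swap_sub j) (D j b m))"
      using j mk by (intro subst_D[of k] v D_PP) (auto simp: swap_sub_def)
    also have "subst (swap_sub j) (D j b m) = D (Suc j) b (subst (swap_sub j) m)"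
      using j mk by (intro subst_D[of k] v) (auto simp: swap_sub_def)
    also have "subst (swap_sub j) m = m"
      using m by (rule subst_id) (simp add: swap_sub_def)
    finally show ?thesis using step by simp
  qed
  \<comment> \<open>For a single square \<open>h\<close> is an explicit polynomial; for a product,
    \<open>step\<close> expresses it through polynomials already obtained.\<close>
  show "h a m \<in> PP (j + 2)" if "m \<in> PP j" for a m
    using that
  proof (induction a arbitrary: m rule: steenrod_induct)
    case (Sq n a)
    have m: "m \<in> PP (j + 2)" using Sq(2) by (auto intro: PP_mono)
    have "h (Sq n) (act a m) = (\<Sum>i<n. D j (Sq i) (act a m) * lvar_pow (Suc j) (int (n - Suc i)))"
      unfolding h_def D_Sq[of "Suc j"] sum_distrib_right sum.distrib[symmetric]
      by (intro sum.cong refl) (simp add: D_def act_Sq distrib_left distrib_right mult_ac add_ac)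
    also have "\<dots> \<in> PP (j + 2)"
      using m by (intro sum_PP mult_PP D_PP act_PP lvar_pow_PP) auto
    finally have 1: "h (Sq n) (act a m) \<in> PP (j + 2)" .
    have 2: "D j (Sq n) (D (Suc j) a m) + D (Suc j) (Sq n) (D j a m) \<in> PP (j + 2)"
      using m by (intro add_PP D_PP) auto
    have "h (Sq n * a) m = (D j (Sq n) (D (Suc j) a m) + D (Suc j) (Sq n) (D j a m))
        + (act (Sq n) (h a m) + h (Sq n) (act a m))"
      unfolding step by (simp add: add_ac)
    also have "\<dots> \<in> PP (j + 2)"
      by (intro add_PP[OF 2] add_PP[OF act_PP 1] Sq)
    finally show ?case .
  next
    case (add a b)
    then show ?case unfolding hadd by (intro add_PP)
  qed (simp_all add: h_def)
qed (simp_all add: swap_sub_def)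

text \<open>The transvection changes a polynomial by a multiple of the variable
  \<open>Suc j\<close>, so the quotient \<open>h\<close> is a polynomial (\<open>div\<close>).
  Writing the change as this quotient times the variable turns its image under
  \<open>D (Suc j)\<close> into a coboundary.\<close>

lemma transfer_trans:
  assumes j: "Suc j < k" and q: "q \<in> bar_chains (Lp k j) (k - j) d"
    and cyc: "\<And>\<Phi> :: bar_symbol \<Rightarrow> laurent. multilinear \<Phi> \<Longrightarrow> lin \<Phi> (bar_boundary act q) = 0"
  shows "subst (trans_sub j) (lin (V j) q) + lin (V j) q \<in> hits k"
proof (rule transfer_homotopy[OF _ _ _ _ _ _ j q cyc])
  define h where "h a m = (subst (trans_sub j) (D j a m) + D j a m) * iv (Suc j)" for a m
  have v: "linear_form (trans_sub j i)" for i by (simp add: trans_sub_def linear_form_add)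
  show "h (a + b) m = h a m + h b m" for a b m
    by (simp add: h_def D_add_left distrib_right add_ac)
  show "h a (m + m') = h a m + h a m'" for a m m'
    by (simp add: h_def D_add_right distrib_right add_ac)
  have div: "(subst (trans_sub j) n + n) * iv (Suc j) \<in> PP (j + 2)" if "n \<in> PP (Suc j)" for n
    using that
  proof (induction rule: PP_induct)
    case (lvar i f)
    have f: "subst (trans_sub j) (xv i * f) = trans_sub j i * subst (trans_sub j) f"
      using lvar by (intro subst_lvar_mult)
    have 1: "xv i * ((subst (trans_sub j) f + f) * iv (Suc j)) \<in> PP (j + 2)"
      by (rule mult_PP[OF lvar_pow_PP lvar(3)]) (use lvar(1) in auto)
    show ?case
    proof (cases "i = j")
      case True
      have "xv (Suc j) * iv (Suc j) = 1" by (simp flip: lvar_pow_add) (simp add: lvar_pow_def)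
      then have "xv (Suc j) * subst (trans_sub j) f * iv (Suc j) = subst (trans_sub j) f"
        by (metis mult.assoc mult.commute mult.right_neutral)
      then have eq: "(subst (trans_sub j) (xv i * f) + xv i * f) * iv (Suc j)
          = xv i * ((subst (trans_sub j) f + f) * iv (Suc j)) + subst (trans_sub j) f"
        unfolding f by (simp add: True trans_sub_def distrib_left distrib_right mult_ac add_ac)
      have "subst (trans_sub j) f \<in> PP (j + 2)"
        using lvar(2) by (rule subst_PP[rotated]) (auto simp: trans_sub_def intro!: add_PP lvar_pow_PP)
      with 1 show ?thesis unfolding eq by (rule add_PP)
    next
      case False
      then have "(subst (trans_sub j) (xv i * f) + xv i * f) * iv (Suc j)
          = xv i * ((subst (trans_sub j) f + f) * iv (Suc j))"
        unfolding f by (simp add: trans_sub_def distrib_left distrib_right mult_ac)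
      with 1 show ?thesis by (simp only:)
    qed
  next
    case (add f g)
    have "(subst (trans_sub j) (f + g) + (f + g)) * iv (Suc j)
        = (subst (trans_sub j) f + f) * iv (Suc j) + (subst (trans_sub j) g + g) * iv (Suc j)"
      by (simp add: distrib_right add_ac)
    with add show ?case by (simp add: add_PP)
  qed simp_all
  show "h a m \<in> PP (j + 2)" if "m \<in> PP j" for a m
    unfolding h_def using that by (intro div D_PP) (auto intro: PP_mono)
  show "subst (trans_sub j) (D (Suc j) c (D j b m)) + D (Suc j) c (D j b m)
      = act c (h b m) + h (c * b) m + h c (act b m)" if m: "m \<in> PP j" for c b m
  proof -
    define n n' where "n = D j b m" and "n' = subst (trans_sub j) n"
    have mk: "m \<in> PP k" using m j by (auto intro: PP_mono)
    then have n: "n \<in> PP k" unfolding n_def using j by (intro D_PP) auto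
    have "subst (trans_sub j) (D (Suc j) c n) = D (Suc j) c n'"
      unfolding n'_def using j n by (intro subst_D[of k] v) (auto simp: trans_sub_def)
    then have "subst (trans_sub j) (D (Suc j) c n) + D (Suc j) c n
        = act c ((n' + n) * iv (Suc j)) + (act c n' + act c n) * iv (Suc j)"
      by (simp add: D_def act_add_right distrib_right add_ac)
    moreover have "subst (trans_sub j) (act c n) = act c n'"
      unfolding n'_def using n by (intro subst_act v)
    ultimately show ?thesis
      by (simp add: h_def D_mult distrib_right add_ac flip: n_def n'_def)
  qed
qed (auto simp: trans_sub_def linear_form_add)

lemma lin_snd_V: "x \<in> bar_chains M 0 d \<Longrightarrow> lin snd x = lin (V k) (x :: laurent bar)"
  by (rule lin_cong) (auto simp: bar_chains_def bar_symbols_def)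

text \<open>All chains of the last stage have the value \<open>V 0\<close> of the representing
  cycle, and hit changes of the lift fill its coset. Invariance under a generator in the variables
  \<open>j\<close> and \<open>Suc j\<close> is tested at stage \<open>j\<close>, just before these
  variables are introduced.\<close>

theorem transfer_class:
  assumes "c \<in> Tor_F2 (Suc l) (d + int (Suc l))"
  shows "\<exists>f\<in>poly_part (Suc l) d. singer_transfer (Suc l) d c = (+) f ` hit_part (Suc l) d
    \<and> (\<forall>v\<in>gens (Suc l). subst v f + f \<in> hits (Suc l))"
proof -
  define k where "k = Suc l"
  from assms obtain z where c: "c = (+) z ` bar_boundaries act (poly_part 0) k (d + int k)"
    and z: "z \<in> bar_cycles act (poly_part 0) k (d + int k)"
    by (auto simp: Tor_F2_def Tor_def k_def)
  let ?X = "transfer_chain k d k c"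
  obtain x0 where x0: "x0 \<in> ?X" using transfer_chain_nonempty[OF c z order.refl] by blast
  have X: "x \<in> bar_chains (Lp k k) 0 d" if "x \<in> ?X" for x
    using that by (simp add: k_def connecting_def bar_cycles_def)
  have part: "lin snd x \<in> poly_part k d" if "x \<in> ?X" for x
    using X[OF that] unfolding lin_def
    by (intro sum_poly_part) (auto simp: bar_chains_def bar_symbols_def desuspend_def)
  have val: "lin snd x + lin (V 0) z \<in> hits k" if "x \<in> ?X" for x
    using transfer_chain_value[OF c z that] lin_snd_V[OF X[OF that], of k] by simp
  define f where "f = lin snd x0"
  have f: "f \<in> poly_part k d" "f + lin (V 0) z \<in> hits k" unfolding f_def using part val x0 by auto
  have sub1: "lin snd x \<in> (+) f ` hit_part k d" if "x \<in> ?X" for x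
  proof
    show "lin snd x = f + (f + lin snd x)" by simp
    have "(f + lin (V 0) z) + (lin snd x + lin (V 0) z) \<in> hits k"
      by (rule add_hits[OF f(2) val[OF that]])
    then have "f + lin snd x \<in> hits k" by (simp add: add_ac)
    then show "f + lin snd x \<in> hit_part k d"
      using f part[OF that] by (simp add: hit_part_eq add_poly_part)
  qed
  have sub2: "\<exists>x\<in>?X. lin snd x = f + h" if "h \<in> hit_part k d" for h
  proof -
    have "h \<in> group_closure {Sq_op n g | n g. 0 < n \<and> g \<in> poly_part k (d - int n)}"
      using that hits_homogeneous by (simp add: hit_part_eq)
    then have "\<forall>x\<in>?X. \<exists>x'\<in>?X. lin snd x' = lin snd x + h"
    proof (induction rule: group_closure_pm_induct)
      case (base h)
      then obtain n g where h: "h = Sq_op n g" "0 < n" "g \<in> poly_part k (d - int n)" by blast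
      show ?case
      proof
        fix x assume "x \<in> ?X"
        then have "x + basis ([], h) \<in> ?X"
          using transfer_chain_add_hit[of c z l d x n g] c h by (simp add: k_def)
        then show "\<exists>x'\<in>?X. lin snd x' = lin snd x + h" by (rule bexI[rotated]) simp
      qed
    next
      case (add h h')
      then show ?case by (metis (no_types) add.assoc)
    qed auto
    then show ?thesis using x0 by (simp add: f_def)
  qed
  have img: "singer_transfer k d c = (+) f ` hit_part k d"
    unfolding singer_transfer_def using sub1 sub2 by (force simp: image_iff)
  have inv: "subst v f + f \<in> hits k" if v: "v \<in> gens k" for v
  proof -
    from v obtain j where j: "Suc j < k" "v = swap_sub j \<or> v = trans_sub j" by (auto simp: gens_def)
    obtain q where q: "q \<in> transfer_chain k d j c" "q \<in> bar_cycles act (Lp k j) (k - j) d"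
      using transfer_chain_nonempty[OF c z, of j] j by auto
    have 1: "subst v (lin (V j) q) + lin (V j) q \<in> hits k"
      using j(2) transfer_swap[OF j(1)] transfer_trans[OF j(1)] q(2) cycle_multilinear[OF q(2)]
      by (auto simp: bar_cycles_def)
    have "lin (V j) q + lin (V 0) z \<in> hits k"
      using transfer_chain_value[OF c z q(1)] j by simp
    with f(2) have "(f + lin (V 0) z) + (lin (V j) q + lin (V 0) z) \<in> hits k"
      by (rule add_hits)
    then have 2: "f + lin (V j) q \<in> hits k" by (simp add: add_ac)
    then have "subst v (f + lin (V j) q) \<in> hits k"
      using v by (intro subst_hits[of k]) (auto simp: gens_linear_form gens_PP)
    from add_hits[OF add_hits[OF this 1] 2] show ?thesis by (simp add: add_ac)
  qed
  show ?thesis using f(1) img inv unfolding k_def by blast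
qed

section \<open>Kameko's homomorphism\<close>

lemma square_add_mult: "(c :: laurent) * ((f + g) * (f + g)) = c * (f * f) + c * (g * g)"
  by (subst pm_square_add) (rule distrib_left)

definition xprod :: "nat set \<Rightarrow> laurent"
  where "xprod S = (\<Prod>i\<in>S. xv i)"

lemma xprod_basis: "finite S \<Longrightarrow> xprod S = basis (\<Sum>i\<in>S. Poly_Mapping.single i 1)"
  by (induction S rule: finite_induct) (simp_all add: xprod_def lvar_pow_def mult_single)

lemma lookup_ones: "finite S \<Longrightarrow> Poly_Mapping.lookup (\<Sum>i\<in>S. Poly_Mapping.single i (1::int)) j = (if j \<in> S then 1 else 0)"
  by (simp add: lookup_sum lookup_single when_def)

lemma xprod_poly_part: "S \<subseteq> {..<k} \<Longrightarrow> xprod S \<in> poly_part k (int (card S))"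
proof -
  assume S: "S \<subseteq> {..<k}"
  then have "finite S" by (rule finite_subset) simp
  from this S show ?thesis
  proof (induction S rule: finite_induct)
    case (insert i S)
    then have "xv i * xprod S \<in> poly_part k (1 + int (card S))"
      by (intro mult_poly_part lvar_pow_poly_part) auto
    with insert show ?case by (simp add: xprod_def)
  qed (simp add: xprod_def)
qed

lemma xprod_PP: "S \<subseteq> {..<k} \<Longrightarrow> xprod S \<in> PP k"
  using xprod_poly_part by (rule poly_part_PP)

text \<open>\<open>few k\<close> is spanned by the monomials having an even exponent.\<close>

definition few :: "nat \<Rightarrow> laurent set"
  where "few k = group_closure {xprod S * (g * g) | S g. S \<subset> {..<k} \<and> g \<in> PP k}"

lemma few_add: "f \<in> few k \<Longrightarrow> g \<in> few k \<Longrightarrow> f + g \<in> few k"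
  unfolding few_def by (rule group_closure_add)

lemma few_zero [simp]: "0 \<in> few k" by (simp add: few_def)

lemma few_sum: "(\<And>i. i \<in> I \<Longrightarrow> f i \<in> few k) \<Longrightarrow> sum f I \<in> few k"
  unfolding few_def by (rule group_closure_sum)

lemma few_xprod: "S \<subset> {..<k} \<Longrightarrow> g \<in> PP k \<Longrightarrow> xprod S * (g * g) \<in> few k"
  unfolding few_def by (intro group_closure.base insertI2) blast

lemma few_induct [consumes 1, case_names zero base add]:
  assumes "f \<in> few k" "P 0" "\<And>S g. S \<subset> {..<k} \<Longrightarrow> g \<in> PP k \<Longrightarrow> P (xprod S * (g * g))"
    "\<And>f g. P f \<Longrightarrow> P g \<Longrightarrow> P (f + g)"
  shows "P f"
  using assms(1) unfolding few_def by (induction rule: group_closure_pm_induct) (use assms in auto)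

lemma lvar_mult_xprod:
  assumes "i < k" "S \<subseteq> {..<k}"
  shows "xv i * xprod S = (if i \<in> S then xprod (S - {i}) * (xv i * xv i) else xprod (insert i S))"
proof -
  have "finite S" using assms(2) by (rule finite_subset) simp
  then show ?thesis by (auto simp: xprod_def prod.remove mult_ac)
qed

text \<open>Left inverse of \<open>g \<mapsto> xprod {..<k} * (g * g)\<close>, and zero on
  \<open>few k\<close>; by \<open>PP_decompose\<close> these two properties determine it on
  polynomials.\<close>

definition kameko :: "nat \<Rightarrow> laurent \<Rightarrow> laurent"
  where "kameko k = lin (\<lambda>e. if \<forall>i<k. odd (Poly_Mapping.lookup e i)
    then basis (Poly_Mapping.map (\<lambda>a. a div 2) e) else 0)"

lemma kameko_add: "kameko k (f + g) = kameko k f + kameko k g"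
  by (simp add: kameko_def)

lemma kameko_zero [simp]: "kameko k 0 = 0"
  by (simp add: kameko_def)

lemma kameko_xprod:
  assumes "S \<subseteq> {..<k}" "g \<in> PP k"
  shows "kameko k (xprod S * (g * g)) = (if S = {..<k} then g else 0)"
  using assms(2) unfolding PP_def mem_Collect_eq
proof (induction rule: keys_induct)
  case (basis e)
  have fin: "finite S" using assms(1) by (rule finite_subset) simp
  define a where "a = (\<Sum>i\<in>S. Poly_Mapping.single i 1) + (e + e)"
  have l: "Poly_Mapping.lookup a i = (if i \<in> S then 1 else 0) + 2 * Poly_Mapping.lookup e i" for i
    by (simp only: a_def lookup_add lookup_ones[OF fin])
  have "(\<forall>i<k. odd (Poly_Mapping.lookup a i)) \<longleftrightarrow> S = {..<k}"
    using assms(1) by (auto simp: l)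
  moreover have "Poly_Mapping.map (\<lambda>a. a div 2) a = e"
    by (rule poly_mapping_eqI) (simp add: Poly_Mapping.map.rep_eq when_def l)
  moreover have "xprod S * (basis e * basis e) = basis a"
    unfolding a_def xprod_basis[OF fin] by (simp only: mult_single mult_1_left)
  ultimately show ?case by (simp add: kameko_def)
qed (simp_all add: square_add_mult kameko_add)

lemma kameko_few: "f \<in> few k \<Longrightarrow> kameko k f = 0"
proof (induction rule: few_induct)
  case (base S g)
  then show ?case using kameko_xprod[of S k g] by auto
qed (simp_all add: kameko_add)

lemma PP_decompose: "f \<in> PP k \<Longrightarrow> \<exists>g\<in>PP k. f + xprod {..<k} * (g * g) \<in> few k"
proof -
  have mono: "\<exists>S h. S \<subseteq> {..<k} \<and> h \<in> PP k \<and> basis e = xprod S * (h * h)" if "poly_exp k e" for e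
    using that
  proof (induction rule: poly_exp_induct)
    case zero
    show ?case by (intro exI[of _ "{}"] exI[of _ 1]) (simp add: xprod_def)
  next
    case (step i e)
    then obtain S h where *: "S \<subseteq> {..<k}" "h \<in> PP k" "basis e = xprod S * (h * h)" by blast
    have eq: "basis (Poly_Mapping.single i 1 + e) = xv i * xprod S * (h * h)"
      by (simp add: lvar_mult_basis[symmetric] *(3) mult.assoc)
    show ?case
    proof (cases "i \<in> S")
      case True
      then have "basis (Poly_Mapping.single i 1 + e) = xprod (S - {i}) * ((xv i * h) * (xv i * h))"
        unfolding eq lvar_mult_xprod[OF step(1) *(1)] by (simp add: mult_ac)
      moreover have "xv i * h \<in> PP k" using * step(1) by (intro mult_PP lvar_pow_PP) auto
      moreover have "S - {i} \<subseteq> {..<k}" using * by auto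
      ultimately show ?thesis by blast
    next
      case False
      then show ?thesis unfolding eq lvar_mult_xprod[OF step(1) *(1)]
        using * step(1) by (intro exI[of _ "insert i S"] exI[of _ h]) auto
    qed
  qed
  assume "f \<in> PP k"
  then show ?thesis unfolding PP_def[of k] mem_Collect_eq
  proof (induction rule: keys_induct)
    case zero
    show ?case by (intro bexI[of _ 0]) (auto simp: PP_def)
  next
    case (basis e)
    from mono[OF this] obtain S h where *: "S \<subseteq> {..<k}" "h \<in> PP k" "basis e = xprod S * (h * h)" by blast
    show ?case
    proof (cases "S = {..<k}")
      case True
      with * show ?thesis by (intro bexI[of _ h]) (auto simp: PP_def)
    next
      case False
      with * have "basis e \<in> few k" by (auto intro: few_xprod)
      then show ?thesis by (intro bexI[of _ 0]) (auto simp: PP_def)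
    qed
  next
    case (add f g)
    then obtain a b where "a \<in> PP k" "f + xprod {..<k} * (a * a) \<in> few k" "b \<in> PP k" "g + xprod {..<k} * (b * b) \<in> few k"
      by (auto simp: PP_def)
    moreover from this have "(f + g) + xprod {..<k} * ((a + b) * (a + b)) \<in> few k"
      using few_add[of "f + xprod {..<k} * (a * a)" k "g + xprod {..<k} * (b * b)"]
      by (simp add: square_add_mult add_ac)
    ultimately show ?case using add_PP[of a k b] by (auto simp: PP_def)
  qed
qed

lemma kameko_decompose:
  assumes "f \<in> PP k"
  shows "kameko k f \<in> PP k" "f + xprod {..<k} * (kameko k f * kameko k f) \<in> few k"
proof -
  obtain g where g: "g \<in> PP k" "f + xprod {..<k} * (g * g) \<in> few k" using PP_decompose[OF assms] by blast
  have "kameko k f + g = 0"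
    using kameko_few[OF g(2)] g(1) by (simp add: kameko_add kameko_xprod)
  then have "kameko k f = g" by (rule iffD2[OF pm_eq_iff])
  with g show "kameko k f \<in> PP k" "f + xprod {..<k} * (kameko k f * kameko k f) \<in> few k" by simp_all
qed

subsection \<open>Compatibility with the Steenrod operations\<close>

text \<open>In terms of total squares: Sq(l f) = (l + l^2 t^s) Sq(f). The case of interest is a
  power of a variable with exponent \<open>2 ^ j = s\<close>, on which only the lowest and the
  highest square are nonzero.\<close>

definition power_form :: "laurent \<Rightarrow> nat \<Rightarrow> bool"
  where "power_form l s \<longleftrightarrow> (\<forall>n f. Sq_op n (l * f) = l * Sq_op n f + l * l * (if n < s then 0 else Sq_op (n - s) f))"

lemma power_form_square: "power_form l s \<Longrightarrow> power_form (l * l) (2 * s)"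
  unfolding power_form_def by (auto simp: mult.assoc distrib_left mult_2)

lemma power_form_lvar: "power_form (xv i) 1"
  using linear_form_lvar[of i] by (simp add: power_form_def linear_form_def)

lemma power_form_lvar_pow: "power_form (xv i ^ 2 ^ j) (2 ^ j)"
proof (induction j)
  case (Suc j)
  from power_form_square[OF this] show ?case by (simp add: mult_2 power_add)
qed (simp add: power_form_lvar[unfolded One_nat_def])

lemma Sq_op_square:
  "g \<in> PP k \<Longrightarrow> Sq_op n (g * g) = (if even n then Sq_op (n div 2) g * Sq_op (n div 2) g else 0)"
proof (induction arbitrary: n rule: PP_induct)
  case one
  show ?case by (auto simp: Sq_op_one elim: evenE)
next
  case (lvar i f)
  have pf: "power_form (xv i * xv i) 2" using power_form_square[OF power_form_lvar] by simp
  have "Sq_op n ((xv i * f) * (xv i * f)) = Sq_op n ((xv i * xv i) * (f * f))" by (simp add: mult_ac)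
  also have "\<dots> = (xv i * xv i) * Sq_op n (f * f)
      + (xv i * xv i) * (xv i * xv i) * (if n < 2 then 0 else Sq_op (n - 2) (f * f))"
    using pf unfolding power_form_def by blast
  finally have *: "Sq_op n ((xv i * f) * (xv i * f)) = (xv i * xv i) * Sq_op n (f * f)
      + (xv i * xv i) * (xv i * xv i) * (if n < 2 then 0 else Sq_op (n - 2) (f * f))" .
  show ?case
  proof (cases "even n")
    case True
    then obtain m where n: "n = 2 * m" by (elim evenE)
    show ?thesis
    proof (cases m)
      case 0
      then show ?thesis using * by (simp add: n lvar mult_ac)
    next
      case (Suc m')
      have x2: "lvar_pow i 2 = xv i * xv i" by (simp flip: lvar_pow_add)
      have "(xv i * Sq_op m f + xv i * xv i * Sq_op m' f) * (xv i * Sq_op m f + xv i * xv i * Sq_op m' f)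
        = (xv i * xv i) * (Sq_op m f * Sq_op m f) + (xv i * xv i) * (xv i * xv i) * (Sq_op m' f * Sq_op m' f)"
        unfolding pm_square_add by (simp add: mult_ac)
      then show ?thesis using * by (simp add: n Suc lvar Sq_op_lvar_mult x2)
    qed
  next
    case False
    then have "even (n - 2) \<Longrightarrow> n < 2" by presburger
    then show ?thesis using * False by (auto simp: lvar)
  qed
next
  case (add f g)
  then show ?case by (simp add: pm_square_add)
qed simp

text \<open>Each variable is either kept or squared, and \<open>J\<close> is the set of those
  squared.\<close>

lemma Sq_op_xprod:
  "finite S \<Longrightarrow> Sq_op j (xprod S) \<in> group_closure {xprod (S - J) * (xprod J * xprod J) | J. J \<subseteq> S \<and> card J = j}"
proof (induction S arbitrary: j rule: finite_induct)
  case empty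
  show ?case by (auto simp: xprod_def Sq_op_one intro!: group_closure.base)
next
  case (insert i S)
  let ?G = "\<lambda>S j. {xprod (S - J) * (xprod J * xprod J) | J. J \<subseteq> S \<and> card J = j}"
  have xi: "xprod (insert i T) = xv i * xprod T" if "T \<subseteq> S" for T
    using insert(1,2) that finite_subset[of T S] by (subst xprod_def, subst prod.insert) (auto simp: xprod_def)
  have 1: "xv i * p \<in> group_closure (?G (insert i S) j)" if "p \<in> group_closure (?G S j)" for p j
    using that
  proof (induction rule: group_closure_pm_induct)
    case (base p)
    then obtain J where J: "p = xprod (S - J) * (xprod J * xprod J)" "J \<subseteq> S" "card J = j" by blast
    have "insert i S - J = insert i (S - J)" using J(2) insert(2) by auto
    then have "xv i * p = xprod (insert i S - J) * (xprod J * xprod J)"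
      using xi[of "S - J"] by (simp add: J(1) mult.assoc)
    then show ?case using J by (intro group_closure.base insertI2 CollectI exI[of _ J]) auto
  qed (auto simp: distrib_left intro: group_closure_add)
  have 2: "xv i * xv i * p \<in> group_closure (?G (insert i S) (Suc j))" if "p \<in> group_closure (?G S j)" for p j
    using that
  proof (induction rule: group_closure_pm_induct)
    case (base p)
    then obtain J where J: "p = xprod (S - J) * (xprod J * xprod J)" "J \<subseteq> S" "card J = j" by blast
    have "insert i S - insert i J = S - J" using insert(2) by auto
    then have "xv i * xv i * p = xprod (insert i S - insert i J) * (xprod (insert i J) * xprod (insert i J))"
      using xi[OF J(2)] by (simp add: J(1) mult_ac)
    moreover have "card (insert i J) = Suc j" using J insert(1,2) finite_subset[of J S] by (subst card_insert_disjoint) auto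
    ultimately show ?case using J(2) by (intro group_closure.base insertI2 CollectI exI[of _ "insert i J"]) auto
  qed (auto simp: distrib_left intro: group_closure_add)
  have x2: "lvar_pow i 2 = xv i * xv i" by (simp flip: lvar_pow_add)
  show ?case unfolding xi[OF order.refl] Sq_op_lvar_mult x2
    using 1[OF insert(3), of j] 2[OF insert(3), of "j - 1"]
    by (cases j) (auto intro!: group_closure_add)
qed

lemma Sq_op_xprod_few:
  assumes "S \<subseteq> {..<k}" "0 < j" "g \<in> PP k"
  shows "Sq_op j (xprod S) * (g * g) \<in> few k"
proof -
  have fin: "finite S" using assms(1) by (rule finite_subset) simp
  from Sq_op_xprod[OF fin, of j] show ?thesis
  proof (induction rule: group_closure_pm_induct)
    case (base p)
    then obtain J where J: "p = xprod (S - J) * (xprod J * xprod J)" "J \<subseteq> S" "card J = j" by blast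
    then have "J \<noteq> {}" using assms(2) by auto
    then have "S - J \<subset> {..<k}" using J assms(1) by auto
    moreover have "xprod J * g \<in> PP k" using J assms by (intro mult_PP xprod_PP) auto
    ultimately have "xprod (S - J) * ((xprod J * g) * (xprod J * g)) \<in> few k" by (rule few_xprod)
    then show ?case by (simp add: J(1) mult_ac)
  qed (auto simp: distrib_right intro: few_add)
qed

text \<open>In the Cartan formula a positive operation on \<open>xprod S\<close> makes an odd
  exponent even and lands in \<open>few k\<close>. Hence under \<open>kameko\<close> the operation
  Sq^(2m) corresponds to Sq^m and odd squares to 0.\<close>

lemma Sq_op_xprod_square:
  assumes "S \<subseteq> {..<k}" "g \<in> PP k"
  shows "Sq_op n (xprod S * (g * g)) + (if even n then xprod S * (Sq_op (n div 2) g * Sq_op (n div 2) g) else 0) \<in> few k"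
proof -
  have "Sq_op n (xprod S * (g * g)) = (\<Sum>j\<in>insert 0 {1..n}. Sq_op j (xprod S) * Sq_op (n - j) (g * g))"
    unfolding Sq_op_Cartan by (intro sum.cong) auto
  also have "\<dots> = xprod S * Sq_op n (g * g) + (\<Sum>j\<in>{1..n}. Sq_op j (xprod S) * Sq_op (n - j) (g * g))"
    by (subst sum.insert) auto
  finally have "Sq_op n (xprod S * (g * g)) + (if even n then xprod S * (Sq_op (n div 2) g * Sq_op (n div 2) g) else 0)
      = (\<Sum>j\<in>{1..n}. Sq_op j (xprod S) * Sq_op (n - j) (g * g))"
    by (simp add: Sq_op_square[OF assms(2)] add_ac)
  also have "\<dots> \<in> few k"
    using assms by (intro few_sum) (auto simp: Sq_op_square[OF assms(2)] intro!: Sq_op_xprod_few Sq_op_PP)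
  finally show ?thesis .
qed

lemma few_Sq_op: "f \<in> few k \<Longrightarrow> Sq_op n f \<in> few k"
proof (induction rule: few_induct)
  case (base S g)
  have "(if even n then xprod S * (Sq_op (n div 2) g * Sq_op (n div 2) g) else 0) \<in> few k"
    using base by (auto intro: few_xprod Sq_op_PP)
  from few_add[OF Sq_op_xprod_square[of S k g n] this] base show ?case by (simp add: add.assoc)
qed (auto intro: few_add)

lemma kameko_hits: "f \<in> hits k \<Longrightarrow> kameko k f \<in> hits k"
proof (induction rule: hits_induct)
  case (Sq n f)
  define g where "g = kameko k f"
  have g: "g \<in> PP k" "f + xprod {..<k} * (g * g) \<in> few k" unfolding g_def using kameko_decompose[OF Sq(2)] by simp_all
  define r where "r = (if even n then Sq_op (n div 2) g else 0)"
  have r: "r \<in> PP k" "r \<in> hits k" using g(1) Sq(1) by (auto simp: r_def intro!: Sq_op_PP Sq_op_hits elim!: evenE)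
  have "Sq_op n (xprod {..<k} * (g * g)) + xprod {..<k} * (r * r) \<in> few k"
    using Sq_op_xprod_square[OF order.refl g(1), of n] by (simp add: r_def split: if_splits)
  from few_add[OF few_Sq_op[OF g(2), of n] this] have "Sq_op n f + xprod {..<k} * (r * r) \<in> few k"
    by (simp add: add_ac)
  from kameko_few[OF this] have "kameko k (Sq_op n f) + r = 0"
    using r(1) by (simp add: kameko_add kameko_xprod)
  then have "kameko k (Sq_op n f) = r" by (rule iffD2[OF pm_eq_iff])
  then show ?case using r(2) by simp
qed (simp_all add: kameko_add add_hits)

text \<open>Doubling the operations lifts a hit polynomial along Kameko's homomorphism, up to
  \<open>few k\<close>. Where the degree part of \<open>few k\<close> is hit, this makes the
  homomorphism injective on classes.\<close>

lemma square_hits: "g \<in> hits k \<Longrightarrow> \<exists>h\<in>hits k. xprod {..<k} * (g * g) + h \<in> few k"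
proof (induction rule: hits_induct)
  case zero
  show ?case by (intro bexI[of _ 0]) simp_all
next
  case (Sq n v)
  have "Sq_op (2 * n) (xprod {..<k} * (v * v)) \<in> hits k"
    using Sq by (intro Sq_op_hits mult_PP xprod_PP) auto
  moreover have "xprod {..<k} * (Sq_op n v * Sq_op n v) + Sq_op (2 * n) (xprod {..<k} * (v * v)) \<in> few k"
    using Sq_op_xprod_square[OF order.refl Sq(2), of "2 * n"] by (simp add: add.commute)
  ultimately show ?case by blast
next
  case (add f g)
  then obtain a b where "a \<in> hits k" "xprod {..<k} * (f * f) + a \<in> few k" "b \<in> hits k" "xprod {..<k} * (g * g) + b \<in> few k"
    by blast
  then have "a + b \<in> hits k" "(xprod {..<k} * (f * f) + a) + (xprod {..<k} * (g * g) + b) \<in> few k"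
    by (simp_all only: add_hits few_add)
  then show ?case by (intro bexI[of _ "a + b"]) (simp_all add: square_add_mult add_ac)
qed

subsection \<open>Equivariance\<close>

lemma subst_xprod: "S \<subseteq> {..<k} \<Longrightarrow> subst v (xprod S) = (\<Prod>i\<in>S. v i)"
proof -
  assume S: "S \<subseteq> {..<k}"
  then have "finite S" by (rule finite_subset) simp
  from this S show ?thesis
  proof (induction S rule: finite_induct)
    case (insert i S)
    then have "xprod S \<in> PP k" by (intro xprod_PP) auto
    then show ?case using insert subst_lvar_mult[of i k "xprod S" v] by (simp add: xprod_def)
  qed (simp add: xprod_def)
qed

text \<open>A swap permutes the factors. A transvection adds a term in which the variable
  \<open>j\<close> has lost its odd exponent, so the full product is invariant modulo
  \<open>few k\<close> and shorter products stay inside.\<close>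

lemma subst_xprod_few:
  assumes v: "v \<in> gens k" and S: "S \<subseteq> {..<k}" and h: "h \<in> PP k"
  shows "subst v (xprod S) * (h * h) + (if S = {..<k} then xprod S * (h * h) else 0) \<in> few k"
proof -
  have fin: "finite S" using S by (rule finite_subset) simp
  from v consider j where "Suc j < k" "v = swap_sub j" | j where "Suc j < k" "v = trans_sub j"
    by (auto simp: gens_def)
  then show ?thesis
  proof cases
    case (1 j)
    define p where "p = (\<lambda>i. if i = j then Suc j else if i = Suc j then j else i)"
    have p: "p (p i) = i" "p i < k \<longleftrightarrow> i < k" for i using 1 by (auto simp: p_def)
    have inj: "inj_on p A" for A by (rule inj_on_inverseI[of _ p]) (simp add: p)
    have "(\<Prod>i\<in>S. v i) = xprod (p ` S)"
      unfolding xprod_def by (subst prod.reindex[OF inj]) (simp add: 1 swap_sub_def p_def)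
    then have "subst v (xprod S) = xprod (p ` S)" by (simp only: subst_xprod[OF S])
    moreover have sub: "p ` S \<subseteq> {..<k}" using S p by auto
    moreover have "p ` S = {..<k} \<longleftrightarrow> S = {..<k}"
    proof
      assume "p ` S = {..<k}"
      then have "card S = card {..<k}" using card_image[OF inj, of S] by simp
      then show "S = {..<k}" using S by (intro card_subset_eq) auto
    next
      assume "S = {..<k}"
      then have "card (p ` S) = card {..<k}" using card_image[OF inj, of S] by simp
      then show "p ` S = {..<k}" using sub by (intro card_subset_eq) auto
    qed
    ultimately show ?thesis using h by (auto intro: few_xprod)
  next
    case (2 j)
    show ?thesis
    proof (cases "j \<in> S")
      case False
      then have "(\<Prod>i\<in>S. v i) = xprod S"
        unfolding xprod_def by (intro prod.cong) (auto simp: 2 trans_sub_def)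
      then have "subst v (xprod S) = xprod S" by (simp only: subst_xprod[OF S])
      then show ?thesis using S h by (auto intro: few_xprod)
    next
      case True
      define T where "T = S - {j}"
      have T: "T \<subseteq> {..<k}" "j \<notin> T" "finite T" "S = insert j T" using S True fin by (auto simp: T_def)
      have "(\<Prod>i\<in>T. v i) = xprod T"
        unfolding xprod_def using T(2) by (intro prod.cong) (auto simp: 2 trans_sub_def)
      then have "subst v (xprod S) = (xv j + xv (Suc j)) * xprod T"
        unfolding subst_xprod[OF S] using T by (simp add: 2 trans_sub_def)
      then have eq: "subst v (xprod S) * (h * h) = xprod S * (h * h) + xv (Suc j) * xprod T * (h * h)"
        using T by (simp add: distrib_right) (simp add: xprod_def)
      have A: "xv (Suc j) * xprod T * (h * h) \<in> few k"
      proof (cases "Suc j \<in> T")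
        case True
        have "xprod (T - {Suc j}) * ((xv (Suc j) * h) * (xv (Suc j) * h)) \<in> few k"
          using T h 2 True by (intro few_xprod mult_PP lvar_pow_PP) auto
        then show ?thesis unfolding lvar_mult_xprod[OF 2(1) T(1)] using True by (simp add: mult_ac)
      next
        case False
        have "insert (Suc j) T \<subseteq> {..<k}" "j \<notin> insert (Suc j) T" "j \<in> {..<k}" using T 2 by auto
        then have "insert (Suc j) T \<subset> {..<k}" by blast
        then show ?thesis unfolding lvar_mult_xprod[OF 2(1) T(1)] using False h by (simp add: few_xprod)
      qed
      have B: "xprod S * (h * h) + (if S = {..<k} then xprod S * (h * h) else 0) \<in> few k"
        using S h by (auto intro: few_xprod)
      from few_add[OF B A] show ?thesis unfolding eq by (simp add: add_ac)
    qed
  qed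
qed

lemma kameko_subst:
  assumes v: "v \<in> gens k" and f: "f \<in> PP k"
  shows "kameko k (subst v f) = subst v (kameko k f)"
proof -
  define g where "g = kameko k f"
  have g: "g \<in> PP k" "f + xprod {..<k} * (g * g) \<in> few k" unfolding g_def using kameko_decompose[OF f] by simp_all
  have vPP: "subst v h \<in> PP k" if "h \<in> PP k" for h
    using subst_PP[of k v k h] that gens_PP[OF v] by blast
  have sq: "subst v (xprod S * (h * h)) = subst v (xprod S) * (subst v h * subst v h)"
    if "S \<subseteq> {..<k}" "h \<in> PP k" for S h
    using that by (simp add: subst_mult[of _ k] xprod_PP mult_PP)
  have few: "subst v p \<in> few k" if "p \<in> few k" for p
    using that
  proof (induction rule: few_induct)
    case (base S h)
    then have "S \<subseteq> {..<k}" "S \<noteq> {..<k}" by auto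
    then show ?case using subst_xprod_few[OF v _ vPP[OF base(2)], of S] sq[of S h] base(2) by simp
  qed (auto intro: few_add)
  have "subst v (xprod {..<k}) * (subst v g * subst v g) + xprod {..<k} * (subst v g * subst v g) \<in> few k"
    using subst_xprod_few[OF v order.refl vPP[OF g(1)]] by simp
  from few_add[OF few[OF g(2)] this] have "subst v f + xprod {..<k} * (subst v g * subst v g) \<in> few k"
    by (simp add: sq[OF order.refl g(1)] add_ac)
  from kameko_few[OF this] have "kameko k (subst v f) + subst v g = 0"
    using vPP[OF g(1)] by (simp add: kameko_add kameko_xprod)
  then show ?thesis unfolding g_def by (rule iffD2[OF pm_eq_iff])
qed

subsection \<open>Monomials with few odd exponents\<close>

text \<open>The sum telescopes: with X = x^(2^j), Sq^n(X v) = X Sq^n(v) + X^2 Sq^(n-2^j)(v), and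
  neighbouring terms cancel. A variable moves inside the operation at the price of lowering it by
  \<open>2^j - 1\<close>.\<close>

lemma lvar_mult_Sq_op:
  "xv i * Sq_op m v = (\<Sum>j<Suc m. if 2 ^ j \<le> m + 1 then Sq_op (m + 1 - 2 ^ j) (xv i ^ 2 ^ j * v) else 0)"
proof -
  define t where "t j = (if 2 ^ j \<le> m + 1 then xv i ^ 2 ^ j * Sq_op (m + 1 - 2 ^ j) v else 0)" for j
  have "(if 2 ^ j \<le> m + 1 then Sq_op (m + 1 - 2 ^ j) (xv i ^ 2 ^ j * v) else 0) = t j + t (Suc j)" for j
  proof -
    have pw: "xv i ^ 2 ^ j * xv i ^ 2 ^ j = xv i ^ 2 ^ Suc j" by (simp add: mult_2 power_add)
    have "Sq_op (m + 1 - 2 ^ j) (xv i ^ 2 ^ j * v) = xv i ^ 2 ^ j * Sq_op (m + 1 - 2 ^ j) v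
      + xv i ^ 2 ^ Suc j * (if m + 1 - 2 ^ j < 2 ^ j then 0 else Sq_op (m + 1 - 2 ^ j - 2 ^ j) v)"
      using power_form_lvar_pow[of i j] unfolding power_form_def pw by blast
    then show ?thesis by (auto simp: t_def mult_2)
  qed
  then have "(\<Sum>j<Suc m. if 2 ^ j \<le> m + 1 then Sq_op (m + 1 - 2 ^ j) (xv i ^ 2 ^ j * v) else 0)
      = (\<Sum>j<Suc m. t j + t (Suc j))" by (simp only:)
  also have "\<dots> = t 0 + t (Suc m)"
  proof (induction m)
    case (Suc m)
    show ?case unfolding sum.lessThan_Suc[of _ "Suc m"] Suc.IH by (simp add: add_ac)
  qed simp
  also have "t (Suc m) = 0" using less_exp[of "Suc m"] by (simp add: t_def)
  finally show ?thesis by (simp add: t_def)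
qed

fun mersenne_sum :: "nat \<Rightarrow> nat \<Rightarrow> bool"
  where "mersenne_sum 0 m \<longleftrightarrow> m = 0"
  | "mersenne_sum (Suc r) m \<longleftrightarrow> (\<exists>j. 2 ^ j \<le> m + 1 \<and> mersenne_sum r (m + 1 - 2 ^ j))"

text \<open>Moving the variables of \<open>S\<close> inside one at a time lowers the operation by
  numbers \<open>2^j - 1\<close>. It could come down to \<open>Sq_op 0\<close> only if
  \<open>m\<close> were a sum of \<open>card S\<close> such numbers.\<close>

lemma xprod_Sq_op_hits:
  "finite S \<Longrightarrow> S \<subseteq> {..<k} \<Longrightarrow> v \<in> PP k \<Longrightarrow> \<not> mersenne_sum (card S) m \<Longrightarrow> xprod S * Sq_op m v \<in> hits k"
proof (induction S arbitrary: m v rule: finite_induct)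
  case empty
  then show ?case by (simp add: xprod_def Sq_op_hits)
next
  case (insert i S)
  have "xprod S * (if 2 ^ j \<le> m + 1 then Sq_op (m + 1 - 2 ^ j) (xv i ^ 2 ^ j * v) else 0) \<in> hits k" for j
  proof (cases "2 ^ j \<le> m + 1")
    case True
    then have "\<not> mersenne_sum (card S) (m + 1 - 2 ^ j)" using insert by auto
    moreover have "xv i ^ 2 ^ j * v \<in> PP k" using insert by (intro mult_PP power_PP lvar_pow_PP) auto
    ultimately have "xprod S * Sq_op (m + 1 - 2 ^ j) (xv i ^ 2 ^ j * v) \<in> hits k" using insert by simp
    then show ?thesis using True by simp
  qed simp
  then have "(\<Sum>j<Suc m. xprod S * (if 2 ^ j \<le> m + 1 then Sq_op (m + 1 - 2 ^ j) (xv i ^ 2 ^ j * v) else 0)) \<in> hits k"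
    by (rule sum_hits)
  then have "xprod S * (xv i * Sq_op m v) \<in> hits k" by (simp only: lvar_mult_Sq_op sum_distrib_left)
  then show ?case using insert by (simp add: xprod_def mult_ac)
qed

text \<open>The vanishing of operations above the degree is proved along with it, because
  multiplication by a variable produces such a term in the top degree.\<close>

lemma Sq_op_top: "f \<in> poly_part k (int n) \<Longrightarrow> Sq_op n f = f * f"
proof -
  have "Sq_op (nat (total_degree e)) (basis e) = basis e * basis e \<and> 0 \<le> total_degree e
    \<and> (\<forall>n>nat (total_degree e). Sq_op n (basis e) = 0)" if "poly_exp k e" for e
    using that
  proof (induction rule: poly_exp_induct)
    case zero
    show ?case by (auto simp: Sq_op_one)
  next
    case (step i e)
    have x2: "lvar_pow i 2 = xv i * xv i" by (simp flip: lvar_pow_add)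
    have d: "nat (total_degree (Poly_Mapping.single i 1 + e)) = Suc (nat (total_degree e))"
      using step(3) by (simp add: total_degree_add nat_add_distrib)
    have "Sq_op n (basis (Poly_Mapping.single i 1 + e)) = 0" if "Suc (nat (total_degree e)) < n" for n
      using step(3) that unfolding lvar_mult_basis[symmetric] Sq_op_lvar_mult by simp
    moreover have "Sq_op (Suc (nat (total_degree e))) (basis (Poly_Mapping.single i 1 + e))
        = basis (Poly_Mapping.single i 1 + e) * basis (Poly_Mapping.single i 1 + e)"
      using step(3) unfolding lvar_mult_basis[symmetric] Sq_op_lvar_mult x2 by (simp add: mult_ac)
    ultimately show ?case using step(3) by (simp only: d) (simp add: total_degree_add)
  qed
  note * = this
  show "Sq_op n f = f * f" if "f \<in> poly_part k (int n)"
    using that unfolding poly_part_iff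
  proof (induction rule: keys_induct)
    case (basis e)
    then show ?case using *[of e] by simp
  qed (simp_all add: pm_square_add)
qed

lemma poly_part_neg: "d < 0 \<Longrightarrow> f \<in> poly_part k d \<Longrightarrow> f = 0"
proof -
  assume d: "d < 0" and f: "f \<in> poly_part k d"
  have "0 \<le> total_degree e" if "poly_exp k e" for e
    using that unfolding total_degree_def poly_exp_def by (simp add: sum_nonneg)
  moreover have "poly_exp k e \<and> total_degree e = d" if "e \<in> Poly_Mapping.keys f" for e
    using f that by (auto simp: poly_part_iff)
  ultimately have "Poly_Mapping.keys f = {}" using d by fastforce
  then show "f = 0" by simp
qed

lemma deg_proj_few_hits:
  assumes "f \<in> few k" and no: "\<And>r m. r < k \<Longrightarrow> int r + 2 * int m = d \<Longrightarrow> \<not> mersenne_sum r m"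
  shows "deg_proj d f \<in> hits k"
  using assms(1)
proof (induction rule: few_induct)
  case (base S g)
  have fin: "finite S" using base(1) by (auto intro: finite_subset[of _ "{..<k}"])
  from base(2) show ?case
  proof (induction rule: PP_homogeneous_induct)
    case (hom e g)
    have part: "xprod S * (g * g) \<in> poly_part k (int (card S) + (e + e))"
      using hom base(1) by (intro mult_poly_part xprod_poly_part) auto
    show ?case
    proof (cases "d = int (card S) + (e + e) \<and> 0 \<le> e")
      case True
      then obtain m where m: "e = int m" using nonneg_int_cases by blast
      have "card S < k" using base(1) psubset_card_mono[of "{..<k}" S] by simp
      then have "\<not> mersenne_sum (card S) m" using no[of "card S" m] True m by simp
      then have "xprod S * Sq_op m g \<in> hits k"
        using base(1) hom fin by (intro xprod_Sq_op_hits) (auto intro: poly_part_PP)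
      then show ?thesis using deg_proj_hom[OF part, of d] Sq_op_top[of g k m] hom m by simp
    next
      case False
      then show ?thesis using deg_proj_hom[OF part, of d] poly_part_neg[of e g k] hom by auto
    qed
  qed (simp_all add: square_add_mult deg_proj_add add_hits)
qed (simp_all add: deg_proj_add add_hits)

lemma deg_proj_hits: "f \<in> hits k \<Longrightarrow> deg_proj d f \<in> hits k"
proof (induction rule: hits_induct)
  case (Sq n g)
  from Sq(2) show ?case
  proof (induction rule: PP_homogeneous_induct)
    case (hom e g)
    then have "deg_proj d (Sq_op n g) = (if d = e + int n then Sq_op n g else 0)"
      by (intro deg_proj_hom Sq_op_poly_part)
    then show ?case using hom Sq(1) by (auto intro: Sq_op_hits poly_part_PP)
  qed (simp_all add: deg_proj_add add_hits)
qed (simp_all add: deg_proj_add add_hits)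

text \<open>\<open>kameko k f\<close> inherits the invariance, so it is hit by \<open>IH\<close>.
  Lifting this back by \<open>square_hits\<close> leaves a remainder in \<open>few k\<close>, whose
  part of the given degree is hit by the assumption on \<open>mersenne_sum\<close>.\<close>

theorem kameko_invariants:
  assumes f: "f \<in> poly_part k (2 * d + int k)" and inv: "\<And>v. v \<in> gens k \<Longrightarrow> subst v f + f \<in> hits k"
    and no: "\<And>r m. r < k \<Longrightarrow> int r + 2 * int m = 2 * d + int k \<Longrightarrow> \<not> mersenne_sum r m"
    and IH: "\<And>g. g \<in> poly_part k d \<Longrightarrow> (\<And>v. v \<in> gens k \<Longrightarrow> subst v g + g \<in> hits k) \<Longrightarrow> g \<in> hits k"
  shows "f \<in> hits k"
proof -
  have fPP: "f \<in> PP k" using f by (rule poly_part_PP)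
  define g where "g = kameko k f"
  have g: "g \<in> PP k" "f + xprod {..<k} * (g * g) \<in> few k"
    unfolding g_def using kameko_decompose[OF fPP] by simp_all
  have gd: "g \<in> poly_part k d"
    using f unfolding g_def poly_part_iff[of f]
  proof (induction rule: keys_induct)
    case (basis e)
    define h where "h = Poly_Mapping.map (\<lambda>a. a div 2) e"
    have lh: "Poly_Mapping.lookup h i = Poly_Mapping.lookup e i div 2" for i
      by (simp add: h_def Poly_Mapping.map.rep_eq when_def)
    show ?case
    proof (cases "\<forall>i<k. odd (Poly_Mapping.lookup e i)")
      case True
      have "e = (\<Sum>i<k. Poly_Mapping.single i 1) + (h + h)"
      proof (rule poly_mapping_eqI)
        fix i
        have "odd (Poly_Mapping.lookup e i)" if "i < k" using True that by blast
        moreover have "Poly_Mapping.lookup e i = 0" if "\<not> i < k"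
          using basis that by (auto simp: poly_exp_def in_keys_iff subset_iff)
        ultimately show "Poly_Mapping.lookup e i = Poly_Mapping.lookup ((\<Sum>i<k. Poly_Mapping.single i 1) + (h + h)) i"
          unfolding lookup_add lookup_ones[OF finite_lessThan] lh lessThan_iff by (cases "i < k") (simp, presburger, simp)
      qed
      then have "total_degree e = total_degree (\<Sum>i<k. Poly_Mapping.single i 1) + (total_degree h + total_degree h)"
        by (metis total_degree_add)
      moreover have "total_degree (\<Sum>i\<in>I. Poly_Mapping.single i 1) = int (card I)" if "finite I" for I
        using that by (induction I rule: finite_induct) (simp_all add: total_degree_add)
      ultimately have "total_degree h = d" using basis by simp
      moreover have "poly_exp k h" using basis by (auto simp: poly_exp_def in_keys_iff lh subset_iff)
      ultimately show ?thesis using True by (simp add: kameko_def flip: h_def)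
    next
      case False
      then show ?thesis by (auto simp: kameko_def)
    qed
  qed (simp_all add: kameko_add add_poly_part)
  have "g \<in> hits k"
  proof (rule IH[OF gd])
    fix v assume v: "v \<in> gens k"
    show "subst v g + g \<in> hits k"
      using kameko_hits[OF inv[OF v]] by (simp add: kameko_add kameko_subst[OF v fPP] flip: g_def)
  qed
  from square_hits[OF this] obtain h where h: "h \<in> hits k" "xprod {..<k} * (g * g) + h \<in> few k" by blast
  have "f + h \<in> few k" using few_add[OF g(2) h(2)] by (simp add: add_ac)
  then have "deg_proj (2 * d + int k) (f + h) \<in> hits k" using no by (rule deg_proj_few_hits)
  then have "f + deg_proj (2 * d + int k) h \<in> hits k" using deg_proj_hom[OF f] by (simp add: deg_proj_add)
  from add_hits[OF this deg_proj_hits[OF h(1), of "2 * d + int k"]] show ?thesis by (simp add: add.assoc)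
qed

lemma power_2_mod_4: "(2::nat) ^ j = 1 \<or> (2::nat) ^ j = 2 \<or> 4 dvd (2::nat) ^ j"
proof (cases "2 \<le> j")
  case True
  then show ?thesis using le_imp_power_dvd[of 2 j "2::nat"] by simp
next
  case False
  then have "j = 0 \<or> j = 1" by auto
  then show ?thesis by auto
qed

text \<open>The three numbers are 0, 1 or 2 modulo 4 and their sum is 3 modulo 4. Either all are 1,
  or two of them are 1 and 2 and the third is \<open>28 * N - 4\<close>.\<close>

lemma three_powers_mod_4: 
  assumes "x = (1::nat) \<or> x = 2 \<or> 4 dvd x" "y = (1::nat) \<or> y = 2 \<or> 4 dvd y" "z = (1::nat) \<or> z = 2 \<or> 4 dvd z"
    "x + y + z + 1 = 28 * N" "28 * N \<noteq> x + 4" "28 * N \<noteq> y + 4" "28 * N \<noteq> z + 4"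
  shows False
proof -
  have *: "(x + y + z + 1) mod 4 = 0" unfolding assms(4) by presburger
  have "x mod 4 = 0 \<or> x = 1 \<or> x = 2" using assms(1) by auto
  moreover have "y mod 4 = 0 \<or> y = 1 \<or> y = 2" using assms(2) by auto
  moreover have "z mod 4 = 0 \<or> z = 1 \<or> z = 2" using assms(3) by auto
  moreover have "(x + y + z + 1) mod 4 = (x mod 4 + y mod 4 + z mod 4 + 1) mod 4" by (intro mod_add_cong) simp_all
  ultimately have "x + y + z = 3 \<or> x + y = 3 \<or> x + z = 3 \<or> y + z = 3"
    using * by (elim disjE) simp_all
  moreover have "28 * N \<noteq> 4" by presburger
  ultimately show False using assms(4-7) by linarith
qed

lemma mersenne_sum_SucD: "mersenne_sum (Suc r) m \<Longrightarrow> \<exists>j n. m + 1 = 2 ^ j + n \<and> mersenne_sum r n"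
  by (metis mersenne_sum.simps(2) le_add_diff_inverse)

text \<open>Parity leaves \<open>r = 1\<close> and \<open>r = 3\<close>. They would require
  \<open>28 * N - 2\<close> to be a power of 2, or \<open>28 * N - 1\<close> to be a sum of three;
  with \<open>3 \<le> s\<close> the number \<open>N = 2 ^ (s - 3)\<close> is an integer, so both are
  excluded modulo 4 up to small cases.\<close>

lemma not_mersenne_sum_5:
  assumes "3 \<le> s" "r < 5" "int r + 2 * int m = 7 * 2 ^ s - 5"
  shows "\<not> mersenne_sum r m"
proof -
  define t where "t = s - 3"
  have s: "s = t + 3" using assms(1) by (simp add: t_def)
  define N where "N = (2::nat) ^ t"
  have "int r + 2 * int m + 5 = int (56 * N)" using assms(3) by (simp add: s N_def power_add)
  then have eq: "r + 2 * m + 5 = 56 * N" by linarith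
  have not_pow: "28 * N \<noteq> 2 ^ j + 4" for j
  proof
    assume *: "28 * N = 2 ^ j + 4"
    then have j: "2 ^ j = 28 * N - 4" "2 ^ j + 4 = 28 * N" by simp_all
    have "2 \<le> j"
    proof (rule ccontr)
      assume "\<not> 2 \<le> j"
      then have "j = 0 \<or> j = 1" by auto
      then show False using j(2) by (elim disjE) (simp_all, presburger+)
    qed
    then obtain i where "j = i + 2" using le_Suc_ex[of 2 j] by (auto simp: add.commute)
    then have "7 * N = 2 ^ i + 1" using j(2) by (simp add: power_add)
    then show False using power_2_mod_4[of i] power_2_mod_4[of t, folded N_def] by presburger
  qed
  have "odd r" using eq by presburger
  then have "r = 1 \<or> r = 3" using assms(2) by presburger
  then show ?thesis
  proof
    assume r: "r = 1"
    show ?thesis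
    proof
      assume "mersenne_sum r m"
      then obtain j where "m + 1 = 2 ^ j" using mersenne_sum_SucD[of 0 m] by (auto simp: r)
      then show False using power_2_mod_4[of j] eq r by presburger
    qed
  next
    assume r: "r = 3"
    show ?thesis
    proof
      assume "mersenne_sum r m"
      then obtain a n where a: "m + 1 = 2 ^ a + n" "mersenne_sum (Suc (Suc 0)) n"
        using mersenne_sum_SucD[of "Suc (Suc 0)" m] by (auto simp: r numeral_3_eq_3)
      then obtain b n' where b: "n + 1 = 2 ^ b + n'" "mersenne_sum (Suc 0) n'" using mersenne_sum_SucD by blast
      then obtain c where c: "n' + 1 = 2 ^ c" using mersenne_sum_SucD[of 0 n'] by auto
      have "2 ^ a + 2 ^ b + 2 ^ c + 1 = 28 * N" using eq r a(1) b(1) c by linarith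
      from three_powers_mod_4[OF power_2_mod_4 power_2_mod_4 power_2_mod_4 this not_pow not_pow not_pow] show False .
    qed
  qed
qed

section \<open>Extension of scalars to the field with 32 elements\<close>

text \<open>\<open>Ext a\<^sub>0 \<dots> a\<^sub>4\<close> stands for \<open>a\<^sub>0 + a\<^sub>1 \<zeta> + \<dots> + a\<^sub>4 \<zeta>\<^sup>4\<close> with \<open>\<zeta>\<^sup>5 = \<zeta>\<^sup>2 + 1\<close>.\<close>

datatype 'a ext = Ext 'a 'a 'a 'a 'a

instantiation ext :: (comm_ring_1) comm_ring_1
begin

definition zero_ext :: "'a ext" where "0 = Ext 0 0 0 0 0"
definition one_ext :: "'a ext" where "1 = Ext 1 0 0 0 0"

fun plus_ext :: "'a ext \<Rightarrow> 'a ext \<Rightarrow> 'a ext"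
  where "Ext a0 a1 a2 a3 a4 + Ext b0 b1 b2 b3 b4 = Ext (a0 + b0) (a1 + b1) (a2 + b2) (a3 + b3) (a4 + b4)"

fun uminus_ext :: "'a ext \<Rightarrow> 'a ext"
  where "- Ext a0 a1 a2 a3 a4 = Ext (- a0) (- a1) (- a2) (- a3) (- a4)"

definition minus_ext :: "'a ext \<Rightarrow> 'a ext \<Rightarrow> 'a ext" where "p - q = p + - (q :: 'a ext)"

fun times_ext :: "'a ext \<Rightarrow> 'a ext \<Rightarrow> 'a ext"
  where "Ext a0 a1 a2 a3 a4 * Ext b0 b1 b2 b3 b4 =
    Ext (a0 * b0 + a1 * b4 + a2 * b3 + a3 * b2 + a4 * b1 + a4 * b4)
      (a0 * b1 + a1 * b0 + a2 * b4 + a3 * b3 + a4 * b2)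
      (a0 * b2 + a1 * b1 + a2 * b0 + a1 * b4 + a2 * b3 + a3 * b2 + a4 * b1 + a3 * b4 + a4 * b3 + a4 * b4)
      (a0 * b3 + a1 * b2 + a2 * b1 + a3 * b0 + a2 * b4 + a3 * b3 + a4 * b2 + a4 * b4)
      (a0 * b4 + a1 * b3 + a2 * b2 + a3 * b1 + a4 * b0 + a3 * b4 + a4 * b3)"

instance
proof
  fix p q r :: "'a ext"
  show "p + q + r = p + (q + r)" by (cases p; cases q; cases r) (simp add: add.assoc)
  show "p + q = q + p" by (cases p; cases q) (simp add: add.commute)
  show "0 + p = p" by (cases p) (simp add: zero_ext_def)
  show "- p + p = 0" by (cases p) (simp add: zero_ext_def)
  show "p - q = p + - q" by (simp add: minus_ext_def)
  show "p * q = q * p" by (cases p; cases q) (simp add: algebra_simps)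
  show "1 * p = p" by (cases p) (simp add: one_ext_def)
  show "(p + q) * r = p * r + q * r"
    by (cases p; cases q; cases r) (simp add: algebra_simps)
  show "p * q * r = p * (q * r)"
    by (cases p; cases q; cases r) (simp add: algebra_simps)
  show "(0 :: 'a ext) \<noteq> 1" by (simp add: zero_ext_def one_ext_def)
qed

end

lemma map_ext_add:
  assumes "\<And>x y. f (x + y) = f x + f y"
  shows "map_ext f (p + q) = map_ext f p + map_ext f q"
  by (cases p; cases q) (simp add: assms)

lemma map_ext_zero: "f 0 = 0 \<Longrightarrow> map_ext f 0 = 0"
  by (simp add: zero_ext_def)

lemma ext_double [simp]: "(p :: ('a \<Rightarrow>\<^sub>0 bit) ext) + p = 0" for p :: "(('a :: comm_monoid_add) \<Rightarrow>\<^sub>0 bit) ext"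
  by (cases p) (simp add: zero_ext_def)

lemma bit_ext_double [simp]: "(p :: bit ext) + p = 0"
  by (cases p) (simp add: zero_ext_def)

lemma ext_add_cancel [simp]: "(p :: laurent ext) + (p + q) = q"
  by (simp flip: add.assoc)

lemma plus_bit_code [code]: "(0::bit) + b = b" "(1::bit) + 0 = 1" "(1::bit) + 1 = 0"
  by simp_all

lemma times_bit_code [code]: "(0::bit) * b = 0" "(1::bit) * b = b"
  by simp_all

definition sc :: "bit ext \<Rightarrow> laurent ext"
  where "sc = map_ext (Poly_Mapping.single 0)"

definition emb :: "laurent \<Rightarrow> laurent ext"
  where "emb f = Ext f 0 0 0 0"

lemma sc_add: "sc (a + b) = sc a + sc b"
  unfolding sc_def by (rule map_ext_add) (rule single_add)

lemma sc_zero [simp]: "sc 0 = 0"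
  by (simp add: sc_def zero_ext_def)

lemma sc_one [simp]: "sc 1 = 1"
  by (simp add: sc_def one_ext_def)

lemma sc_mult: "sc (a * b) = sc a * sc b"
  by (cases a; cases b) (simp add: sc_def single_add mult_single)

lemma sc_power: "sc (a ^ n) = sc a ^ n"
  by (induction n) (simp_all add: sc_mult)

lemma emb_add: "emb (f + g) = emb f + emb g"
  by (simp add: emb_def)

lemma emb_zero [simp]: "emb 0 = 0" by (simp add: emb_def zero_ext_def)
lemma emb_one [simp]: "emb 1 = 1" by (simp add: emb_def one_ext_def)

lemma emb_mult_Ext: "emb f * Ext a b c d e = Ext (f * a) (f * b) (f * c) (f * d) (f * e)"
  by (simp add: emb_def)

lemma emb_mult: "emb (f * g) = emb f * emb g"
  by (simp add: emb_def)

lemma additive_single: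
  assumes "\<And>x y :: laurent. t (x + y) = t x + (t y :: 'b :: ab_group_add)" 
  shows "t (Poly_Mapping.single 0 c * f) = (if c = 1 then t f else 0)"
  using assms[of 0 0] by (cases c) simp_all

lemma map_ext_sc_mult:
  assumes "\<And>x y :: laurent. t (x + y) = t x + (t y :: laurent)"
  shows "map_ext t (sc c * p) = sc c * map_ext t p"
proof -
  have t: "t (Poly_Mapping.single 0 c * f) = Poly_Mapping.single 0 c * t f" for c f
    using additive_single[OF assms, of c f] by (cases c) simp_all
  show ?thesis by (cases c; cases p) (simp add: sc_def assms t)
qed

text \<open>Coordinatewise, hence linear over F_32: an operation leaves scalars alone, whereas
  squaring a polynomial squares them. This mismatch causes the index shift in
  \<open>SqE_y_mult\<close>.\<close>

definition SqE :: "nat \<Rightarrow> laurent ext \<Rightarrow> laurent ext"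
  where "SqE n = map_ext (Sq_op n)"

definition TE :: "(nat \<Rightarrow> laurent) \<Rightarrow> laurent ext \<Rightarrow> laurent ext"
  where "TE v = map_ext (subst v)"

definition PPE :: "laurent ext set"
  where "PPE = {p. set_ext p \<subseteq> PP 5}"

definition EH :: "laurent ext set"
  where "EH = {p. set_ext p \<subseteq> hits 5}"

lemma PPE_Ext: "Ext a b c d e \<in> PPE \<longleftrightarrow> a \<in> PP 5 \<and> b \<in> PP 5 \<and> c \<in> PP 5 \<and> d \<in> PP 5 \<and> e \<in> PP 5"
  by (auto simp: PPE_def)

lemma EH_Ext: "Ext a b c d e \<in> EH \<longleftrightarrow> a \<in> hits 5 \<and> b \<in> hits 5 \<and> c \<in> hits 5 \<and> d \<in> hits 5 \<and> e \<in> hits 5"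
  by (auto simp: EH_def)

lemma PPE_zero [simp]: "0 \<in> PPE" by (simp add: zero_ext_def PPE_Ext)
lemma PPE_one [simp]: "1 \<in> PPE" by (simp add: one_ext_def PPE_Ext)

lemma PPE_add: "p \<in> PPE \<Longrightarrow> q \<in> PPE \<Longrightarrow> p + q \<in> PPE"
  by (cases p; cases q) (simp add: PPE_Ext add_PP)

lemma PPE_mult: "p \<in> PPE \<Longrightarrow> q \<in> PPE \<Longrightarrow> p * q \<in> PPE"
  by (cases p; cases q) (simp add: PPE_Ext add_PP mult_PP)

lemma PPE_sum: "(\<And>i. i \<in> I \<Longrightarrow> f i \<in> PPE) \<Longrightarrow> sum f I \<in> PPE"
  by (induction I rule: infinite_finite_induct) (auto intro: PPE_add)

lemma PPE_power: "p \<in> PPE \<Longrightarrow> p ^ n \<in> PPE"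
  by (induction n) (auto intro: PPE_mult)

lemma PPE_emb: "f \<in> PP 5 \<Longrightarrow> emb f \<in> PPE"
  by (simp add: emb_def PPE_Ext)

lemma PP_single_zero: "Poly_Mapping.single 0 c \<in> PP k"
  by (auto simp: PP_def)

lemma PPE_sc: "sc c \<in> PPE"
  by (cases c) (simp add: sc_def PPE_Ext PP_single_zero)

lemma EH_zero [simp]: "0 \<in> EH" by (simp add: zero_ext_def EH_Ext)

lemma EH_add: "p \<in> EH \<Longrightarrow> q \<in> EH \<Longrightarrow> p + q \<in> EH"
  by (cases p; cases q) (simp add: EH_Ext add_hits)

lemma EH_sum: "(\<And>i. i \<in> I \<Longrightarrow> f i \<in> EH) \<Longrightarrow> sum f I \<in> EH"
  by (induction I rule: infinite_finite_induct) (auto intro: EH_add)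

lemma EH_sc: "p \<in> EH \<Longrightarrow> sc c * p \<in> EH"
proof -
  have "Poly_Mapping.single 0 b * f \<in> hits 5" if "f \<in> hits 5" for b and f :: laurent
    using that by (cases b) simp_all
  then show "p \<in> EH \<Longrightarrow> sc c * p \<in> EH"
    by (cases c; cases p) (simp add: sc_def EH_Ext add_hits)
qed

lemma EH_emb: "emb f \<in> EH \<longleftrightarrow> f \<in> hits 5"
  by (simp add: emb_def EH_Ext)

lemma SqE_add: "SqE n (p + q) = SqE n p + SqE n q"
  unfolding SqE_def by (rule map_ext_add) simp

lemma SqE_zero [simp]: "SqE n 0 = 0"
  by (simp add: SqE_def map_ext_zero)

lemma SqE_sum: "SqE n (sum f I) = (\<Sum>i\<in>I. SqE n (f i))"
  by (induction I rule: infinite_finite_induct) (simp_all add: SqE_add)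

lemma SqE_sc: "SqE n (sc c * p) = sc c * SqE n p"
  unfolding SqE_def by (rule map_ext_sc_mult) simp

lemma SqE_one: "SqE n 1 = (if n = 0 then 1 else 0)"
  by (simp add: SqE_def one_ext_def zero_ext_def Sq_op_one)

lemma SqE_EH: "0 < n \<Longrightarrow> p \<in> PPE \<Longrightarrow> SqE n p \<in> EH"
  by (cases p) (simp add: SqE_def PPE_Ext EH_Ext Sq_op_hits)

lemma SqE_lvar_mult:
  "SqE n (emb (xv b) * p) = emb (xv b) * SqE n p + emb (xv b) ^ 2 * (if n = 0 then 0 else SqE (n - 1) p)"
proof -
  have x2: "lvar_pow b 2 = xv b * xv b" by (simp flip: lvar_pow_add)
  show ?thesis
    by (cases p) (auto simp: SqE_def emb_mult_Ext Sq_op_lvar_mult x2 power2_eq_square mult.assoc emb_def)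
qed

lemma TE_add: "TE v (p + q) = TE v p + TE v q"
  unfolding TE_def by (rule map_ext_add) simp

lemma TE_zero [simp]: "TE v 0 = 0"
  by (simp add: TE_def map_ext_zero)

lemma TE_one [simp]: "TE v 1 = 1"
  by (simp add: TE_def one_ext_def)

lemma TE_sum: "TE v (sum f I) = (\<Sum>i\<in>I. TE v (f i))"
  by (induction I rule: infinite_finite_induct) (simp_all add: TE_add)

lemma TE_sc: "TE v (sc c * p) = sc c * TE v p"
  unfolding TE_def by (rule map_ext_sc_mult) simp

lemma TE_emb: "TE v (emb f) = emb (subst v f)"
  by (simp add: TE_def emb_def)

lemma TE_emb_mult: "f \<in> PP 5 \<Longrightarrow> p \<in> PPE \<Longrightarrow> TE v (emb f * p) = emb (subst v f) * TE v p"
  by (cases p) (simp add: TE_def emb_mult_Ext PPE_Ext subst_mult[of f 5])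

lemma TE_EH: "v \<in> gens 5 \<Longrightarrow> p \<in> EH \<Longrightarrow> TE v p \<in> EH"
proof -
  assume v: "v \<in> gens 5"
  have "subst v f \<in> hits 5" if "f \<in> hits 5" for f
    by (rule subst_hits[of 5]) (use v that gens_linear_form gens_PP in auto)
  then show "p \<in> EH \<Longrightarrow> TE v p \<in> EH"
    by (cases p) (simp add: TE_def EH_Ext)
qed

subsection \<open>Coordinates adapted to the Singer cycle\<close>

text \<open>The Frobenius map in coordinates, from \<open>\<zeta>^6 = \<zeta>^3 + \<zeta>\<close>
  and \<open>\<zeta>^8 = \<zeta>^3 + \<zeta>^2 + 1\<close>.\<close>

fun sqb :: "bit ext \<Rightarrow> bit ext"
  where "sqb (Ext a b c d e) = Ext (a + e) d (b + e) (d + e) c"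

lemma sqb: "sqb x = x ^ 2"
proof -
  have b: "b * b = b" for b :: bit by (cases b) simp_all
  show ?thesis
  proof (cases x)
    case (Ext a0 a1 a2 a3 a4)
    have c: "a * b + (b * a + c) = c" "a * b + b * a = 0" for a b c :: bit
      by (simp_all add: mult.commute[of b a] flip: add.assoc)
    show ?thesis by (simp add: Ext power2_eq_square b c add_ac)
  qed
qed

lemma bit_ext_power32: "(x :: bit ext) ^ 32 = x"
proof -
  have "sqb (sqb (sqb (sqb (sqb x)))) = x"
  proof (cases x)
    case (Ext a b c d e)
    have c: "u + (u + w) = w" for u w :: bit by (simp flip: add.assoc)
    show ?thesis by (simp add: Ext add_ac c)
  qed
  then show ?thesis by (simp add: sqb flip: power_mult)
qed

definition frobs :: "nat \<Rightarrow> bit ext list \<Rightarrow> bit ext list"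
  where "frobs j w = map (\<lambda>x. x ^ 2 ^ j) w"

lemma frobs_0 [simp]: "frobs 0 w = w" by (simp add: frobs_def)

lemma frobs_frobs: "frobs j (frobs l w) = frobs (j + l) w"
  by (simp add: frobs_def power_add mult.commute flip: power_mult)

lemma frobs_5: "frobs 5 w = w"
  by (simp add: frobs_def bit_ext_power32)

lemma length_frobs [simp]: "length (frobs j w) = length w"
  by (simp add: frobs_def)

lemma bit_ext_power2_add: "(x + y :: bit ext) ^ 2 ^ i = x ^ 2 ^ i + y ^ 2 ^ i"
proof (induction i)
  case (Suc i)
  have 2: "(u + v) ^ 2 = u ^ 2 + v ^ 2" for u v :: "bit ext"
  proof -
    have "(u + v) ^ 2 = u ^ 2 + v ^ 2 + (u * v + u * v)"
      by (simp only: power2_eq_square distrib_left distrib_right mult.commute[of v u] add_ac)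
    then show ?thesis by simp
  qed
  have "z ^ 2 ^ Suc i = (z ^ 2 ^ i) ^ 2" for z :: "bit ext" by (simp add: mult.commute flip: power_mult)
  then show ?case by (simp only: Suc 2)
qed simp

text \<open>The linear form with coefficient vector \<open>w\<close>, twisted by the
  \<open>i\<close>-th power of Frobenius. The vector stays a parameter because substitutions,
  Frobenius and scaling all act through it.\<close>

definition y :: "nat \<Rightarrow> bit ext list \<Rightarrow> laurent ext"
  where "y i w = (\<Sum>b<5. sc ((w ! b) ^ 2 ^ i) * emb (xv b))"

lemma y_frobs: "length w = 5 \<Longrightarrow> y i (frobs j w) = y (j + i) w"
  unfolding y_def frobs_def by (intro sum.cong) (simp_all add: power_add flip: power_mult)

lemma y_mod5: "length w = 5 \<Longrightarrow> y (i + 5) w = y i w"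
  using y_frobs[of w i 5] by (simp add: frobs_5 add.commute)

lemma PPE_lvar: "b < 5 \<Longrightarrow> emb (xv b) \<in> PPE"
  by (simp add: PPE_emb lvar_pow_PP)

lemma y_PPE: "y i w \<in> PPE"
  unfolding y_def by (intro PPE_sum PPE_mult PPE_sc PPE_lvar) simp

lemma laurent_ext_square_add: "(p + q) ^ 2 = p ^ 2 + (q ^ 2 :: laurent ext)"
proof -
  have "(p + q) ^ 2 = p ^ 2 + q ^ 2 + (p * q + p * q)"
    by (simp only: power2_eq_square distrib_left distrib_right mult.commute[of q p] add_ac)
  then show ?thesis by simp
qed

lemma laurent_ext_square_sum: "(sum f I) ^ 2 = (\<Sum>i\<in>I. f i ^ 2 :: laurent ext)"
  by (induction I rule: infinite_finite_induct) (simp_all add: laurent_ext_square_add)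

text \<open>The first square of the form replaces each variable by its square but keeps the
  coefficients \<open>(w ! b) ^ 2 ^ i\<close>; this is the square of the form with index
  \<open>i - 1\<close>, that is \<open>i + 4\<close> modulo 5.\<close>

lemma SqE_y_mult:
  assumes "length w = 5"
  shows "SqE n (y i w * p) = y i w * SqE n p + y (i + 4) w ^ 2 * (if n = 0 then 0 else SqE (n - 1) p)"
proof -
  have "y (i + 4) w ^ 2 = (\<Sum>b<5. sc ((w ! b) ^ 2 ^ i) * emb (xv b) ^ 2)"
    unfolding y_def laurent_ext_square_sum power_mult_distrib sc_power[symmetric]
  proof (intro sum.cong refl)
    fix b
    have "((w ! b) ^ 2 ^ (i + 4)) ^ 2 = ((w ! b) ^ 32) ^ 2 ^ i"
      by (simp add: power_add mult.commute flip: power_mult)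
    then show "sc (((w ! b) ^ 2 ^ (i + 4)) ^ 2) * emb (xv b) ^ 2 = sc ((w ! b) ^ 2 ^ i) * emb (xv b) ^ 2"
      by (simp add: bit_ext_power32)
  qed
  then show ?thesis
    by (simp add: y_def sum_distrib_right mult.assoc SqE_sum SqE_sc SqE_lvar_mult distrib_left sum.distrib)
qed

datatype gen = Sw nat | Tr nat

fun subg :: "gen \<Rightarrow> nat \<Rightarrow> laurent"
  where "subg (Sw j) = swap_sub j" | "subg (Tr j) = trans_sub j"

text \<open>The transposed action: replacing variable \<open>j\<close> by its sum with variable
  \<open>Suc j\<close> adds the coefficient at \<open>j\<close> to the one at
  \<open>Suc j\<close>.\<close>

fun wact :: "gen \<Rightarrow> bit ext list \<Rightarrow> bit ext list"
  where
    "wact (Sw j) w = w[j := w ! Suc j, Suc j := w ! j]"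
  | "wact (Tr j) w = w[Suc j := w ! Suc j + w ! j]"

definition gen_ok :: "gen \<Rightarrow> bool"
  where "gen_ok g = (case g of Sw j \<Rightarrow> j < 4 | Tr j \<Rightarrow> j < 4)"

lemma subg_gens: "gen_ok g \<Longrightarrow> subg g \<in> gens 5"
  by (cases g) (auto simp: gen_ok_def gens_def)

lemma length_wact [simp]: "length (wact g w) = length w"
  by (cases g) simp_all

lemma TE_y_mult:
  assumes g: "gen_ok g" and w: "length w = 5" and p: "p \<in> PPE"
  shows "TE (subg g) (y i w * p) = y i (wact g w) * TE (subg g) p"
proof -
  have "TE (subg g) (y i w * p) = (\<Sum>b<5. sc ((w ! b) ^ 2 ^ i) * emb (subg g b)) * TE (subg g) p"
    using p by (simp add: y_def sum_distrib_right mult.assoc TE_sum TE_sc TE_emb_mult lvar_pow_PP)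
  also have "(\<Sum>b<5. sc ((w ! b) ^ 2 ^ i) * emb (subg g b)) = y i (wact g w)"
  proof -
    obtain a0 a1 a2 a3 a4 where w: "w = [a0, a1, a2, a3, a4]"
      using w by (auto simp: numeral_eq_Suc length_Suc_conv)
    have 5: "{..<5::nat} = {0, Suc 0, Suc (Suc 0), Suc (Suc (Suc 0)), Suc (Suc (Suc (Suc 0)))}" by auto
    have 4: "j < 4 \<longleftrightarrow> j = 0 \<or> j = Suc 0 \<or> j = Suc (Suc 0) \<or> j = Suc (Suc (Suc 0))" for j :: nat by auto
    consider j where "g = Sw j" "j < 4" | j where "g = Tr j" "j < 4"
      using g by (cases g) (auto simp: gen_ok_def)
    then show ?thesis
    proof cases
      case 1
      from 1(2) show ?thesis unfolding w y_def 5 1(1) 4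
        by (elim disjE) (simp_all add: swap_sub_def add_ac)
    next
      case 2
      from 2(2) show ?thesis unfolding w y_def 5 2(1) 4
        by (elim disjE)
           (simp_all add: trans_sub_def bit_ext_power2_add sc_add distrib_left distrib_right emb_add add_ac)
    qed
  qed
  finally show ?thesis .
qed

section \<open>Monomials in the adapted coordinates, their weights and orbit sums\<close>

fun Yl :: "nat \<Rightarrow> nat list \<Rightarrow> bit ext list \<Rightarrow> laurent ext"
  where
    "Yl i [] w = 1"
  | "Yl i (a # as) w = y i w ^ a * Yl (Suc i) as w"

abbreviation Y :: "nat list \<Rightarrow> bit ext list \<Rightarrow> laurent ext"
  where "Y \<equiv> Yl 0"

lemma Yl_PPE: "Yl i as w \<in> PPE"
  by (induction i as w rule: Yl.induct) (auto intro: PPE_mult PPE_power y_PPE)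

fun TEs :: "gen list \<Rightarrow> laurent ext \<Rightarrow> laurent ext"
  where "TEs [] p = p" | "TEs (g # gs) p = TEs gs (TE (subg g) p)"

fun wacts :: "gen list \<Rightarrow> bit ext list \<Rightarrow> bit ext list"
  where "wacts [] w = w" | "wacts (g # gs) w = wacts gs (wact g w)"

abbreviation words_ok :: "gen list \<Rightarrow> bool"
  where "words_ok gs \<equiv> list_all gen_ok gs"

lemma TE_Yl:
  assumes "gen_ok g" "length w = 5"
  shows "TE (subg g) (Yl i as w) = Yl i as (wact g w)"
proof (induction as arbitrary: i)
  case (Cons a as)
  have "TE (subg g) (y i w ^ a * Yl (Suc i) as w) = y i (wact g w) ^ a * Yl (Suc i) as (wact g w)"
  proof (induction a)
    case (Suc a)
    then show ?case
      using TE_y_mult[OF assms, of "y i w ^ a * Yl (Suc i) as w" i]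
      by (simp add: PPE_mult PPE_power y_PPE Yl_PPE mult.assoc)
  qed (simp add: Cons)
  then show ?case by simp
qed simp

lemma TEs_Yl: "words_ok gs \<Longrightarrow> length w = 5 \<Longrightarrow> TEs gs (Yl i as w) = Yl i as (wacts gs w)"
  by (induction gs arbitrary: w) (simp_all add: TE_Yl)

lemma TEs_add: "TEs gs (p + q) = TEs gs p + TEs gs q"
  by (induction gs arbitrary: p q) (simp_all add: TE_add)

lemma TEs_zero [simp]: "TEs gs 0 = 0"
  by (induction gs) simp_all

lemma TEs_sum: "TEs gs (sum f I) = (\<Sum>i\<in>I. TEs gs (f i))"
  by (induction I rule: infinite_finite_induct) (simp_all add: TEs_add)

lemma TEs_sc: "TEs gs (sc c * p) = sc c * TEs gs p"
  by (induction gs arbitrary: p) (simp_all add: TE_sc)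

lemma TEs_EH: "words_ok gs \<Longrightarrow> p \<in> EH \<Longrightarrow> TEs gs p \<in> EH"
  by (induction gs arbitrary: p) (simp_all add: TE_EH subg_gens)

lemma wact_map:
  assumes "\<And>a b. F (a + b) = F a + F b" "gen_ok g" "length w = 5"
  shows "wact g (map F w) = map F (wact g w)"
  using assms by (cases g) (auto simp: gen_ok_def map_update)

lemma wacts_map:
  assumes "\<And>a b. F (a + b) = F a + F b" "words_ok gs" "length w = 5"
  shows "wacts gs (map F w) = map F (wacts gs w)"
  using assms(2,3) by (induction gs arbitrary: w) (simp_all add: wact_map assms(1))

lemma wacts_frobs: "words_ok gs \<Longrightarrow> length w = 5 \<Longrightarrow> wacts gs (frobs j w) = frobs j (wacts gs w)"
  unfolding frobs_def by (rule wacts_map) (rule bit_ext_power2_add)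

text \<open>The exponent of the character by which scaling \<open>w\<close> acts on the monomial;
  averaging will keep the multiples of 31.\<close>

fun wtl :: "nat \<Rightarrow> nat list \<Rightarrow> nat"
  where "wtl i [] = 0" | "wtl i (a # as) = a * 2 ^ i + wtl (Suc i) as"

lemma y_scale: "length w = 5 \<Longrightarrow> y i (map ((*) c) w) = sc (c ^ 2 ^ i) * y i w"
  by (simp add: y_def sum_distrib_left power_mult_distrib sc_mult mult.assoc)

lemma Yl_scale: "length w = 5 \<Longrightarrow> Yl i as (map ((*) c) w) = sc (c ^ wtl i as) * Yl i as w"
proof (induction as arbitrary: i)
  case (Cons a as)
  have sc: "sc (c ^ 2 ^ i) ^ a = sc (c ^ (a * 2 ^ i))"
    by (simp add: sc_power mult.commute flip: power_mult)
  have "Yl i (a # as) (map ((*) c) w)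
      = (sc (c ^ 2 ^ i) * y i w) ^ a * (sc (c ^ wtl (Suc i) as) * Yl (Suc i) as w)"
    using Cons by (simp only: Yl.simps y_scale)
  also have "\<dots> = sc (c ^ wtl i (a # as)) * Yl i (a # as) w"
    by (simp only: Yl.simps wtl.simps power_mult_distrib power_add sc_mult sc mult_ac)
  finally show ?case .
qed simp

definition Orb :: "nat list \<Rightarrow> bit ext list \<Rightarrow> laurent ext"
  where "Orb m w = (\<Sum>j<5. Y m (frobs j w))"

lemma Orb_PPE: "Orb m w \<in> PPE"
  unfolding Orb_def by (intro PPE_sum Yl_PPE)

lemma TEs_Orb: "words_ok gs \<Longrightarrow> length w = 5 \<Longrightarrow> TEs gs (Orb m w) = Orb m (wacts gs w)"
  by (simp add: Orb_def TEs_sum TEs_Yl wacts_frobs)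

lemma Orb_frobs: "Orb m (frobs (Suc 0) w) = Orb m w"
proof -
  have "Orb m (frobs (Suc 0) w) = (\<Sum>j<5. Y m (frobs (Suc j) w))"
    by (simp add: Orb_def frobs_frobs)
  also have "\<dots> = Orb m w"
    using frobs_5[of w] by (simp add: Orb_def eval_nat_numeral add_ac)
  finally show ?thesis .
qed

lemma length_5E:
  assumes "length m = 5"
  obtains a0 a1 a2 a3 a4 where "m = [a0, a1, a2, a3, a4]"
  using assms by (auto simp: numeral_eq_Suc length_Suc_conv)

lemma Y_rotate1:
  assumes "length m = 5" "length w = 5"
  shows "Y (rotate1 m) (frobs (Suc 0) w) = Y m w"
proof -
  obtain a0 a1 a2 a3 a4 where m: "m = [a0, a1, a2, a3, a4]" using assms(1) by (rule length_5E)
  have "y (Suc (Suc (Suc (Suc (Suc 0))))) w = y 0 w"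
    using y_mod5[OF assms(2), of 0] by (simp add: eval_nat_numeral)
  then show ?thesis using assms(2) by (simp add: m y_frobs mult_ac)
qed

text \<open>Rotating the exponents amounts to a Frobenius twist of \<open>w\<close>, and
  \<open>Orb\<close> already sums over these twists.\<close>

lemma Orb_rotate1:
  assumes "length m = 5" "length w = 5"
  shows "Orb (rotate1 m) w = Orb m w"
proof -
  have "Orb (rotate1 m) (frobs (Suc 0) w) = (\<Sum>j<5. Y (rotate1 m) (frobs (Suc 0) (frobs j w)))"
    by (simp add: Orb_def frobs_frobs)
  also have "\<dots> = Orb m w"
    unfolding Orb_def using assms by (intro sum.cong refl Y_rotate1) simp_all
  finally show ?thesis by (simp add: Orb_frobs)
qed

subsection \<open>Steenrod operations in the adapted coordinates\<close>

lemma of_nat_laurent_ext: "(of_nat k :: laurent ext) = (if odd k then 1 else 0)"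
  by (induction k) auto

text \<open>The total square of \<open>y i w\<close> is \<open>y i w + y (i + 4) w ^ 2\<close>, and
  the formula expands its \<open>a\<close>-th power; the induction is Pascal's rule.\<close>

lemma SqE_y_power_mult:
  assumes "length w = 5"
  shows "SqE n (y i w ^ a * p) = (\<Sum>j\<le>n. of_nat (a choose j) * (y i w ^ (a - j) * (y (i + 4) w ^ (2 * j) * SqE (n - j) p)))"
    (is "_ = ?S a n")
proof (induction a arbitrary: n)
  case 0
  have "?S 0 n = (\<Sum>j\<in>{0}. of_nat (0 choose j) * (y i w ^ (0 - j) * (y (i + 4) w ^ (2 * j) * SqE (n - j) p)))"
    by (rule sum.mono_neutral_right) (auto simp: binomial_eq_0)
  then show ?case by simp
next
  case (Suc a)
  define t where "t j = y i w ^ (Suc a - j) * (y (i + 4) w ^ (2 * j) * SqE (n - j) p)" for j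
  have A: "y i w * ?S a n = (\<Sum>j\<le>n. of_nat (a choose j) * t j)"
    unfolding sum_distrib_left
  proof (intro sum.cong refl)
    fix j
    show "y i w * (of_nat (a choose j) * (y i w ^ (a - j) * (y (i + 4) w ^ (2 * j) * SqE (n - j) p)))
      = of_nat (a choose j) * t j"
      by (cases "j \<le> a") (simp_all add: t_def Suc_diff_le binomial_eq_0 mult_ac)
  qed
  have B: "y (i + 4) w ^ 2 * (if n = 0 then 0 else ?S a (n - 1)) = (\<Sum>j<n. of_nat (a choose j) * t (Suc j))"
  proof (cases n)
    case (Suc n')
    then show ?thesis
      by (simp add: sum_distrib_left t_def lessThan_Suc_atMost power2_eq_square mult_ac)
  qed simp
  have "SqE n (y i w ^ Suc a * p) = y i w * ?S a n + y (i + 4) w ^ 2 * (if n = 0 then 0 else ?S a (n - 1))"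
    using SqE_y_mult[OF assms, of n i "y i w ^ a * p"] by (simp add: Suc mult.assoc)
  also have "\<dots> = (\<Sum>j\<le>n. of_nat (a choose j) * t j) + (\<Sum>j<n. of_nat (a choose j) * t (Suc j))"
    by (simp only: A B)
  also have "\<dots> = (\<Sum>j\<le>n. of_nat (Suc a choose j) * t j)"
    by (cases n) (simp_all add: sum.atMost_Suc_shift lessThan_Suc_atMost distrib_right sum.distrib add_ac
        del: sum.atMost_Suc)
  finally show ?case by (simp add: t_def)
qed

text \<open>Lucas's criterion modulo 2: \<open>a choose j\<close> is odd when no binary digit of
  \<open>j\<close> exceeds that of \<open>a\<close>.\<close>

fun bodd :: "nat \<Rightarrow> nat \<Rightarrow> bool"
  where "bodd a j = (if j = 0 then True else if a = 0 then False else
    (even a \<longrightarrow> even j) \<and> bodd (a div 2) (j div 2))"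

declare bodd.simps [simp del]

lemma bodd_simps [simp]:
  "bodd a 0" "0 < j \<Longrightarrow> \<not> bodd 0 j"
  "bodd (2 * a) (2 * j) = bodd a j" "\<not> bodd (2 * a) (Suc (2 * j))"
  "bodd (Suc (2 * a)) (2 * j) = bodd a j" "bodd (Suc (2 * a)) (Suc (2 * j)) = bodd a j"
proof -
  show "bodd a 0" for a by (subst bodd.simps) simp
  show 0: "0 < j \<Longrightarrow> \<not> bodd 0 j" for j by (subst bodd.simps) simp
  show "bodd (2 * a) (2 * j) = bodd a j"
    by (cases "j = 0"; cases "a = 0") (simp_all add: bodd.simps[of "2 * a"] 0 bodd.simps[of _ 0])
  show "\<not> bodd (2 * a) (Suc (2 * j))" by (subst bodd.simps) simp
  show "bodd (Suc (2 * a)) (2 * j) = bodd a j"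
    by (cases "j = 0") (simp_all add: bodd.simps[of "Suc (2 * a)"] bodd.simps[of _ 0])
  show "bodd (Suc (2 * a)) (Suc (2 * j)) = bodd a j"
    by (simp add: bodd.simps[of "Suc (2 * a)"])
qed

lemma bodd_Suc_Suc: "bodd (Suc a) (Suc j) \<longleftrightarrow> bodd a j \<noteq> bodd a (Suc j)"
proof (induction a arbitrary: j rule: less_induct)
  case (less a)
  consider b c where "a = 2 * b" "j = 2 * c" | b c where "a = 2 * b" "j = Suc (2 * c)"
    | b c where "a = Suc (2 * b)" "j = 2 * c" | b c where "a = Suc (2 * b)" "j = Suc (2 * c)"
    by (metis evenE oddE Suc_eq_plus1)
  then show ?case
  proof cases
    case 2
    then show ?thesis using bodd_simps(3)[of b "Suc c"] bodd_simps(5)[of b "Suc c"] by simp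
  next
    case 3
    then show ?thesis using bodd_simps(4)[of "Suc b" c] by simp
  next
    case 4
    then show ?thesis
      using bodd_simps(3)[of "Suc b" "Suc c"] bodd_simps(5)[of b "Suc c"] less[of b c] by simp
  qed simp
qed

lemma odd_binomial: "odd (a choose j) = bodd a j"
proof (induction a arbitrary: j)
  case 0
  show ?case by (cases j) simp_all
next
  case (Suc a)
  show ?case by (cases j) (simp_all add: bodd_Suc_Suc flip: Suc)
qed

definition bump :: "nat \<Rightarrow> nat \<Rightarrow> nat list \<Rightarrow> nat list"
  where "bump i c m = m[i := m ! i + c]"

text \<open>The monomials of Sq^n applied to a monomial, listed with multiplicity: \<open>j\<close>
  factors of index \<open>i\<close> become squares of index \<open>i - 1\<close> modulo 5.\<close>

fun sqL :: "nat \<Rightarrow> nat \<Rightarrow> nat list \<Rightarrow> nat list list"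
  where
    "sqL i n [] = (if n = 0 then [[0, 0, 0, 0, 0]] else [])"
  | "sqL i n (a # as) = concat (map (\<lambda>j. if bodd a j
      then map (\<lambda>m. bump i (a - j) (bump ((i + 4) mod 5) (2 * j) m)) (sqL (Suc i) (n - j) as) else [])
      [0..<Suc n])"

lemma sqL_length: "m \<in> set (sqL i n as) \<Longrightarrow> length m = 5"
  by (induction as arbitrary: i n m) (fastforce simp: bump_def split: if_splits)+

lemma Y_bump:
  assumes "length m = 5" "i < 5"
  shows "Y (bump i c m) w = y i w ^ c * Y m w"
proof -
  obtain a0 a1 a2 a3 a4 where m: "m = [a0, a1, a2, a3, a4]" using assms(1) by (rule length_5E)
  from assms(2) consider "i = 0" | "i = Suc 0" | "i = Suc (Suc 0)" | "i = Suc (Suc (Suc 0))" | "i = Suc (Suc (Suc (Suc 0)))"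
    by linarith
  then show ?thesis by cases (simp_all add: m bump_def power_add mult_ac)
qed

definition Ysum :: "nat list list \<Rightarrow> bit ext list \<Rightarrow> laurent ext"
  where "Ysum ms w = (\<Sum>m\<leftarrow>ms. Y m w)"

lemma Ysum_concat: "Ysum (concat (map f js)) w = (\<Sum>j\<leftarrow>js. Ysum (f j) w)"
  by (induction js) (simp_all add: Ysum_def)

lemma SqE_Yl:
  assumes "length w = 5" "i + length as = 5"
  shows "SqE n (Yl i as w) = Ysum (sqL i n as) w"
  using assms(2)
proof (induction as arbitrary: i n)
  case Nil
  then show ?case by (simp add: SqE_one Ysum_def)
next
  case (Cons a as)
  have i: "i < 5" using Cons(2) by simp
  have ymod: "y (i + 4) w = y ((i + 4) mod 5) w"
  proof (cases "i = 0")
    case False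
    then obtain i' where "i = Suc i'" using not0_implies_Suc by blast
    then show ?thesis using i y_mod5[OF assms(1), of i'] by (simp add: add.commute)
  qed simp
  have t: "of_nat (a choose j) * (y i w ^ (a - j) * (y (i + 4) w ^ (2 * j) * SqE (n - j) (Yl (Suc i) as w)))
    = Ysum (if bodd a j then map (\<lambda>m. bump i (a - j) (bump ((i + 4) mod 5) (2 * j) m)) (sqL (Suc i) (n - j) as) else []) w" for j
  proof -
    have "Y (bump i c (bump ((i + 4) mod 5) c' m)) w = y i w ^ c * (y (i + 4) w ^ c' * Y m w)"
      if "m \<in> set (sqL (Suc i) (n - j) as)" for m c c'
      using sqL_length[OF that] i by (simp add: Y_bump ymod) (simp add: bump_def Y_bump[unfolded bump_def])
    then have "map ((\<lambda>m. Y m w) \<circ> (\<lambda>m. bump i (a - j) (bump ((i + 4) mod 5) (2 * j) m))) (sqL (Suc i) (n - j) as)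
      = map (\<lambda>m. y i w ^ (a - j) * (y (i + 4) w ^ (2 * j) * Y m w)) (sqL (Suc i) (n - j) as)"
      by simp
    then have "Ysum (map (\<lambda>m. bump i (a - j) (bump ((i + 4) mod 5) (2 * j) m)) (sqL (Suc i) (n - j) as)) w
      = y i w ^ (a - j) * (y (i + 4) w ^ (2 * j) * Ysum (sqL (Suc i) (n - j) as) w)"
      unfolding Ysum_def map_map by (simp only: sum_list_const_mult)
    moreover have "SqE (n - j) (Yl (Suc i) as w) = Ysum (sqL (Suc i) (n - j) as) w"
      using Cons by simp
    ultimately show ?thesis
      by (simp add: of_nat_laurent_ext odd_binomial[symmetric]) (simp add: Ysum_def)
  qed
  have "SqE n (Yl i (a # as) w) = (\<Sum>j\<le>n. Ysum (if bodd a j then map (\<lambda>m. bump i (a - j) (bump ((i + 4) mod 5) (2 * j) m)) (sqL (Suc i) (n - j) as) else []) w)"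
    unfolding Yl.simps SqE_y_power_mult[OF assms(1)] t ..
  also have "\<dots> = Ysum (sqL i n (a # as)) w"
    unfolding sqL.simps Ysum_concat interv_sum_list_conv_sum_set_nat set_upt
    by (simp only: atLeast0LessThan lessThan_Suc_atMost)
  finally show ?case .
qed

definition Osum :: "nat list list \<Rightarrow> bit ext list \<Rightarrow> laurent ext"
  where "Osum ms w = (\<Sum>m\<leftarrow>ms. Orb m w)"

lemma Osum_simps [simp]: "Osum [] w = 0" "Osum (m # ms) w = Orb m w + Osum ms w"
  "Osum (ms @ ms') w = Osum ms w + Osum ms' w"
  by (simp_all add: Osum_def)

lemma Osum_Ysum: "Osum ms w = (\<Sum>j<5. Ysum ms (frobs j w))"
  by (induction ms) (simp_all add: Ysum_def Orb_def sum.distrib)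

lemma SqE_Orb: "length w = 5 \<Longrightarrow> length m = 5 \<Longrightarrow> SqE n (Orb m w) = Osum (sqL 0 n m) w"
  by (simp add: Orb_def SqE_sum SqE_Yl Osum_Ysum)

text \<open>Parity and half are read off the binary numeral, which spares \<open>code_simp\<close> the general
  division algorithm.\<close>

definition nat_parity :: "nat \<Rightarrow> bool" where "nat_parity n = odd n"

definition nat_half :: "nat \<Rightarrow> nat" where "nat_half n = n div 2"

lemma nat_parity_code [code]:
  "nat_parity 0 = False" "nat_parity (nat_of_num Num.One) = True"
  "nat_parity (nat_of_num (Num.Bit0 n)) = False" "nat_parity (nat_of_num (Num.Bit1 n)) = True"
  by (simp_all add: nat_parity_def nat_of_num_numeral)

lemma nat_half_code [code]:
  "nat_half 0 = 0" "nat_half (nat_of_num Num.One) = 0"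
  "nat_half (nat_of_num (Num.Bit0 n)) = nat_of_num n" "nat_half (nat_of_num (Num.Bit1 n)) = nat_of_num n"
  by (simp_all add: nat_half_def nat_of_num_numeral)

lemma nat_parity_half_unfold [code_unfold]:
  "odd n = nat_parity n" "even n = (\<not> nat_parity n)" "n div 2 = nat_half n" for n :: nat
  by (simp_all add: nat_parity_def nat_half_def)

subsection \<open>Averaging over a group of order 155\<close>

lemma sc_sum: "sc (sum f I) = (\<Sum>i\<in>I. sc (f i))"
  by (induction I rule: infinite_finite_induct) (simp_all add: sc_add)

definition zeta :: "bit ext" where "zeta = Ext 0 1 0 0 0"

definition w0 :: "bit ext list"
  where "w0 = [Ext 1 0 0 0 0, Ext 0 1 0 0 0, Ext 0 0 1 0 0, Ext 0 0 0 1 0, Ext 0 0 0 0 1]"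

text \<open>In the basis \<open>w0\<close> the two words act as multiplication by \<open>\<zeta>\<close> and as squaring.\<close>

definition singer_word :: "gen list"
  where "singer_word = [Sw 0, Sw 1, Tr 1, Sw 2, Sw 3]"

definition frobenius_word :: "gen list"
  where "frobenius_word = [Sw 1, Sw 2, Tr 2, Tr 0, Tr 1, Tr 0, Sw 2, Sw 3, Sw 2]"

lemma words_ok_words [simp]: "words_ok singer_word" "words_ok frobenius_word"
  by (simp_all add: singer_word_def frobenius_word_def gen_ok_def)

lemma length_w0 [simp]: "length w0 = 5" by (simp add: w0_def)

lemma singer_word_w0: "wacts singer_word w0 = map ((*) zeta) w0"
  by (simp add: singer_word_def w0_def zeta_def numeral_eq_Suc Let_def)

lemma frobenius_word_w0: "wacts frobenius_word w0 = frobs (Suc 0) w0"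
  by (simp add: frobenius_word_def w0_def frobs_def flip: sqb)

fun horner :: "nat \<Rightarrow> bit ext \<Rightarrow> bit ext"
  where "horner 0 x = 0" | "horner (Suc n) x = 1 + x * horner n x"

lemma horner: "(\<Sum>j<n. x ^ j) = horner n x"
proof (induction n)
  case (Suc n)
  have "(\<Sum>j<Suc n. x ^ j) = 1 + (\<Sum>j<n. x ^ Suc j)" by (subst sum.lessThan_Suc_shift) simp
  then show ?case by (simp add: Suc flip: sum_distrib_left)
qed simp

text \<open>Orthogonality of characters for the group of order 31; the sum for the trivial character
  is 31 = 1 in characteristic 2.\<close>

lemma horner_zeta: "list_all (\<lambda>r. horner 31 (zeta ^ r) = (if r = 0 then 1 else 0)) [0..<31]"
  by code_simp

lemma zeta_31: "zeta ^ 31 = 1"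
  by code_simp

lemma sum_zeta_powers: "(\<Sum>j<31. (zeta ^ j) ^ k) = (if 31 dvd k then 1 else 0)"
proof -
  have "zeta ^ k = (zeta ^ 31) ^ (k div 31) * zeta ^ (k mod 31)"
    by (simp flip: power_mult power_add)
  then have "zeta ^ k = zeta ^ (k mod 31)" by (simp add: zeta_31)
  moreover have "(zeta ^ j) ^ k = (zeta ^ k) ^ j" for j by (simp add: mult.commute flip: power_mult)
  ultimately have "(\<Sum>j<31. (zeta ^ j) ^ k) = horner 31 (zeta ^ (k mod 31))" by (simp add: horner)
  moreover have "k mod 31 \<in> set [0..<31]" by simp
  ultimately show ?thesis
    using horner_zeta unfolding list_all_iff by (simp add: dvd_eq_mod_eq_0)
qed

definition avg :: "laurent ext \<Rightarrow> laurent ext"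
  where "avg p = (\<Sum>k<5. \<Sum>j<31. (TEs frobenius_word ^^ k) ((TEs singer_word ^^ j) p))"

lemma funpow_TEs_add: "(TEs gs ^^ j) (p + q) = (TEs gs ^^ j) p + (TEs gs ^^ j) q"
  by (induction j) (simp_all add: TEs_add)

lemma funpow_TEs_sc: "(TEs gs ^^ j) (sc c * p) = sc c * (TEs gs ^^ j) p"
  by (induction j) (simp_all add: TEs_sc)

lemma funpow_TEs_zero [simp]: "(TEs gs ^^ j) 0 = 0"
  by (induction j) simp_all

lemma avg_add: "avg (p + q) = avg p + avg q"
  by (simp add: avg_def funpow_TEs_add sum.distrib)

lemma avg_zero: "avg 0 = 0"
  by (simp add: avg_def)

lemma avg_sc: "avg (sc c * p) = sc c * avg p"
  by (simp add: avg_def funpow_TEs_sc sum_distrib_left)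

text \<open>The Singer cycle multiplies the monomial by a power of \<open>zeta\<close>, so its
  average is zero unless 31 divides the weight; the Frobenius word then adds up the
  conjugates.\<close>

lemma avg_Y: "avg (Y m w0) = (if 31 dvd wtl 0 m then Orb m w0 else 0)"
proof -
  have 1: "(TEs singer_word ^^ j) (Y m w0) = Y m (map ((*) (zeta ^ j)) w0)" for j
  proof (induction j)
    case (Suc j)
    have "wacts singer_word (map ((*) (zeta ^ j)) w0) = map ((*) (zeta ^ j)) (wacts singer_word w0)"
      by (rule wacts_map) (simp_all add: distrib_left)
    then show ?case by (simp add: Suc TEs_Yl singer_word_w0 comp_def mult.left_commute mult.assoc)
  qed (simp add: map_idI)
  have 2: "(TEs frobenius_word ^^ k) (Y m w0) = Y m (frobs k w0)" for k
  proof (induction k)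
    case (Suc k)
    then show ?case by (simp add: TEs_Yl wacts_frobs frobenius_word_w0 frobs_frobs)
  qed simp
  have "avg (Y m w0) = (\<Sum>k<5. sc (\<Sum>j<31. (zeta ^ j) ^ wtl 0 m) * Y m (frobs k w0))"
    unfolding avg_def 1 sc_sum sum_distrib_right by (simp add: Yl_scale funpow_TEs_sc 2)
  then show ?thesis by (simp add: sum_zeta_powers Orb_def)
qed

lemma TEs_invariant:
  assumes "\<And>g. gen_ok g \<Longrightarrow> TE (subg g) p + p \<in> EH" "words_ok gs"
  shows "TEs gs p + p \<in> EH"
  using assms(2)
proof (induction gs)
  case (Cons g gs)
  have "TEs gs (TE (subg g) p + p) \<in> EH"
    using Cons assms(1) by (intro TEs_EH) auto
  from EH_add[OF this, of "TEs gs p + p"] Cons show ?case by (simp add: TEs_add add_ac)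
qed simp

lemma funpow_TEs_invariant:
  assumes "\<And>g. gen_ok g \<Longrightarrow> TE (subg g) p + p \<in> EH" "words_ok gs" "q + p \<in> EH"
  shows "(TEs gs ^^ j) q + p \<in> EH"
proof (induction j)
  case (Suc j)
  have "TEs gs ((TEs gs ^^ j) q + p) \<in> EH" using Suc assms(2) by (intro TEs_EH)
  from EH_add[OF this TEs_invariant[OF assms(1,2)]] show ?case by (simp add: TEs_add add_ac)
qed (simp add: assms(3))

text \<open>Each of the 155 summands is congruent to \<open>p\<close>, and 155 is odd, so nothing
  has to be divided by the group order.\<close>

lemma avg_invariant:
  assumes "\<And>g. gen_ok g \<Longrightarrow> TE (subg g) p + p \<in> EH"
  shows "avg p + p \<in> EH"
proof -
  have "(\<Sum>k<5. \<Sum>j<31. (TEs frobenius_word ^^ k) ((TEs singer_word ^^ j) p) + p) \<in> EH"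
    by (intro EH_sum funpow_TEs_invariant[OF assms]) simp_all
  also have "(\<Sum>k<5. \<Sum>j<31. (TEs frobenius_word ^^ k) ((TEs singer_word ^^ j) p) + p)
      = avg p + of_nat (5 * 31) * p"
    by (simp add: avg_def sum.distrib)
  also have "of_nat (5 * 31) * p = p" by (simp only: of_nat_laurent_ext) simp
  finally show ?thesis .
qed

inductive_set span_Y :: "nat \<Rightarrow> laurent ext set" for d
  where
    zero: "0 \<in> span_Y d"
  | Y: "length m = 5 \<Longrightarrow> sum_list m = d \<Longrightarrow> Y m w0 \<in> span_Y d"
  | add: "p \<in> span_Y d \<Longrightarrow> q \<in> span_Y d \<Longrightarrow> p + q \<in> span_Y d"
  | sc: "p \<in> span_Y d \<Longrightarrow> sc c * p \<in> span_Y d"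

lemma sum_list_bump: "length (m :: nat list) = 5 \<Longrightarrow> i < 5 \<Longrightarrow> sum_list (m[i := m ! i + c]) = sum_list m + c"
  using elem_le_sum_list[of i m] by (simp add: sum_list_update)

lemma span_Y_y: "p \<in> span_Y d \<Longrightarrow> i < 5 \<Longrightarrow> y i w0 * p \<in> span_Y (Suc d)"
proof (induction rule: span_Y.induct)
  case (Y m)
  then have "Y (bump i 1 m) w0 \<in> span_Y (Suc d)"
    unfolding bump_def using sum_list_bump[of m i 1] by (intro span_Y.Y) simp_all
  with Y show ?case by (simp add: Y_bump)
next
  case (sc p c)
  then have "sc c * (y i w0 * p) \<in> span_Y (Suc d)" by (intro span_Y.sc)
  then show ?case by (simp add: mult.left_commute)
qed (auto simp: distrib_left intro: span_Y.intros)

text \<open>The basis dual to \<open>w0\<close> for the trace form of F_32 over F_2. It inverts the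
  change of coordinates (\<open>lvar_eq_y\<close>).\<close>

definition dual_w0 :: "bit ext list"
  where "dual_w0 = [Ext 1 1 1 0 1, Ext 1 0 0 1 1, Ext 1 0 0 1 0, Ext 0 1 1 0 1, Ext 1 1 0 1 0]"

lemma dual_w0: "list_all (\<lambda>b. list_all (\<lambda>c.
    (let x = dual_w0 ! b * w0 ! c in x + sqb x + sqb (sqb x) + sqb (sqb (sqb x)) + sqb (sqb (sqb (sqb x))))
    = (if b = c then 1 else 0)) [0..<5]) [0..<5]"
  by code_simp

lemma lvar_eq_y:
  assumes "b < 5"
  shows "emb (xv b) = (\<Sum>i<5. sc ((dual_w0 ! b) ^ 2 ^ i) * y i w0)"
proof -
  have tr: "(\<Sum>i<5. (dual_w0 ! b) ^ 2 ^ i * (w0 ! c) ^ 2 ^ i) = (if b = c then 1 else 0)" if "c < 5" for c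
  proof -
    define x where "x = dual_w0 ! b * w0 ! c"
    have "(\<Sum>i<5. (dual_w0 ! b) ^ 2 ^ i * (w0 ! c) ^ 2 ^ i) = (\<Sum>i<5. x ^ 2 ^ i)"
      by (simp add: x_def power_mult_distrib)
    also have "\<dots> = x + sqb x + sqb (sqb x) + sqb (sqb (sqb x)) + sqb (sqb (sqb (sqb x)))"
      by (simp add: sqb eval_nat_numeral(2,3) flip: power_mult)
    also have "\<dots> = (if b = c then 1 else 0)"
      using dual_w0 assms that by (simp add: list_all_iff x_def Let_def)
    finally show ?thesis .
  qed
  have "(\<Sum>i<5. sc ((dual_w0 ! b) ^ 2 ^ i) * y i w0)
      = (\<Sum>c<5. sc (\<Sum>i<5. (dual_w0 ! b) ^ 2 ^ i * (w0 ! c) ^ 2 ^ i) * emb (xv c))"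
    unfolding y_def sc_sum sum_distrib_left sum_distrib_right
    by (subst sum.swap) (simp add: sc_mult mult.assoc)
  also have "\<dots> = (\<Sum>c<5. if b = c then emb (xv c) else 0)"
    by (intro sum.cong refl) (simp add: tr)
  also have "\<dots> = emb (xv b)" using assms by simp
  finally show ?thesis ..
qed

lemma span_Y_lvar: "p \<in> span_Y d \<Longrightarrow> b < 5 \<Longrightarrow> emb (xv b) * p \<in> span_Y (Suc d)"
proof -
  assume p: "p \<in> span_Y d" and b: "b < 5"
  have sum: "sum f I \<in> span_Y (Suc d)" if "\<And>i. i \<in> I \<Longrightarrow> f i \<in> span_Y (Suc d)" for f and I :: "nat set"
    using that by (induction I rule: infinite_finite_induct) (auto intro: span_Y.intros)
  show "emb (xv b) * p \<in> span_Y (Suc d)"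
    unfolding lvar_eq_y[OF b] sum_distrib_right mult.assoc
    by (intro sum span_Y.sc span_Y_y[OF p]) simp
qed

lemma emb_span_Y: "f \<in> poly_part 5 (int d) \<Longrightarrow> emb f \<in> span_Y d"
proof -
  have *: "emb (basis e) \<in> span_Y (nat (total_degree e)) \<and> 0 \<le> total_degree e" if "poly_exp 5 e" for e
    using that
  proof (induction rule: poly_exp_induct)
    case zero
    have "Y [0, 0, 0, 0, 0] w0 \<in> span_Y 0" by (rule span_Y.Y) simp_all
    then show ?case by simp
  next
    case (step i e)
    then show ?case
      using span_Y_lvar[of "emb (basis e)" "nat (total_degree e)" i]
      by (simp add: total_degree_add nat_add_distrib emb_mult flip: lvar_mult_basis)
  qed
  show "emb f \<in> span_Y d" if "f \<in> poly_part 5 (int d)"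
    using that unfolding poly_part_iff
  proof (induction rule: keys_induct)
    case (basis e)
    then show ?case using *[of e] by simp
  qed (auto simp: emb_add intro: span_Y.intros)
qed

subsection \<open>A certificate for reduction modulo hit elements\<close>

definition lc :: "(nat \<Rightarrow> bit ext) \<Rightarrow> nat list list \<Rightarrow> bit ext list \<Rightarrow> laurent ext"
  where "lc \<gamma> bs w = (\<Sum>i<length bs. sc (\<gamma> i) * Orb (bs ! i) w)"

lemma lc_add: "lc (\<lambda>i. \<gamma> i + \<delta> i) bs w = lc \<gamma> bs w + lc \<delta> bs w"
  by (simp add: lc_def sc_add distrib_right sum.distrib)

lemma lc_sc: "lc (\<lambda>i. c * \<gamma> i) bs w = sc c * lc \<gamma> bs w"
  by (simp add: lc_def sc_mult sum_distrib_left mult.assoc)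

lemma lc_zero [simp]: "lc (\<lambda>i. 0) bs w = 0"
  by (simp add: lc_def)

definition bat :: "bool list \<Rightarrow> nat \<Rightarrow> bit ext"
  where "bat v i = (if i < length v \<and> v ! i then 1 else 0)"

text \<open>Addition modulo 2; a shorter vector is padded by zeros, in accordance with the default
  value of \<open>bat\<close>.\<close>

fun vx :: "bool list \<Rightarrow> bool list \<Rightarrow> bool list"
  where "vx [] v = v" | "vx (a # u) [] = a # u" | "vx (a # u) (b # v) = (a \<noteq> b) # vx u v"

lemma bat_vx: "bat (vx u v) i = bat u i + bat v i"
proof (induction u v arbitrary: i rule: vx.induct)
  case (3 a u b v)
  then show ?case by (cases i) (auto simp: bat_def)
qed (simp_all add: bat_def)

definition lcb :: "nat list list \<Rightarrow> bool list \<Rightarrow> laurent ext"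
  where "lcb bs v = lc (bat v) bs w0"

lemma lcb_vx: "lcb bs (vx u v) = lcb bs u + lcb bs v"
proof -
  have "bat (vx u v) = (\<lambda>i. bat u i + bat v i)" by (rule ext) (rule bat_vx)
  then show ?thesis by (simp add: lcb_def lc_add)
qed

lemma lcb_Nil [simp]: "lcb bs [] = 0"
proof -
  have "bat [] = (\<lambda>i. 0)" by (auto simp: bat_def)
  then show ?thesis by (simp add: lcb_def)
qed

section \<open>Orbit representatives, the table of normal forms, and the checking of a
  certificate\<close>

fun lless :: "nat list \<Rightarrow> nat list \<Rightarrow> bool"
  where
    "lless (a # as) (b # bs) = (a < b \<or> a = b \<and> lless as bs)"
  | "lless _ _ = False"

definition lmax :: "nat list \<Rightarrow> nat list \<Rightarrow> nat list"
  where "lmax a b = (if lless a b then b else a)"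

text \<open>The largest rotation in lexicographic order names the orbit sum; soundness uses that it
  is a rotation.\<close>

definition rep :: "nat list \<Rightarrow> nat list"
  where "rep m = (let a = rotate1 m; b = rotate1 a; c = rotate1 b; d = rotate1 c
    in lmax m (lmax a (lmax b (lmax c d))))"

lemma Orb_rep:
  assumes "length m = 5"
  shows "Orb (rep m) w0 = Orb m w0 \<and> length (rep m) = 5"
proof -
  define P where "P x \<longleftrightarrow> Orb x w0 = Orb m w0 \<and> length x = 5" for x
  have P: "P x \<Longrightarrow> P (rotate1 x)" "P x \<Longrightarrow> P z \<Longrightarrow> P (lmax x z)" for x z
    by (simp_all add: P_def Orb_rotate1 lmax_def)
  have "P m" using assms by (simp add: P_def)
  then have "P (rep m)" unfolding rep_def Let_def by (intro P)
  then show ?thesis by (simp add: P_def)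
qed

datatype tree = Lf | Nd tree "nat list" "bool list" tree

text \<open>Soundness of the table is a statement about all stored pairs, so the order of the tree
  influences only which lookups succeed.\<close>

fun ents :: "tree \<Rightarrow> (nat list \<times> bool list) set"
  where "ents Lf = {}" | "ents (Nd l k v r) = insert (k, v) (ents l \<union> ents r)"

fun look :: "tree \<Rightarrow> nat list \<Rightarrow> bool list option"
  where
    "look Lf m = None"
  | "look (Nd l k v r) m = (if m = k then Some v else if lless m k then look l m else look r m)"

fun ins :: "tree \<Rightarrow> nat list \<Rightarrow> bool list \<Rightarrow> tree"
  where
    "ins Lf m u = Nd Lf m u Lf"
  | "ins (Nd l k v r) m u = (if lless m k then Nd (ins l m u) k v r else Nd l k v (ins r m u))"

lemma look_ents: "look t m = Some v \<Longrightarrow> (m, v) \<in> ents t"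
  by (induction t) (auto split: if_splits)

lemma ents_ins: "ents (ins t m u) \<subseteq> insert (m, u) (ents t)"
  by (induction t) auto

fun nfs :: "tree \<Rightarrow> nat list list \<Rightarrow> bool list option"
  where
    "nfs t [] = Some []"
  | "nfs t (m # ms) = (case look t m of None \<Rightarrow> None | Some v \<Rightarrow> map_option (vx v) (nfs t ms))"

text \<open>
  A step \<open>(hs, m)\<close> consists of hit elements \<open>Sq\<^sup>n y\<^sup>p\<close> for \<open>(n, p)\<close> in \<open>hs\<close> whose averaged sum
  contains the orbit sum of \<open>m\<close>, all other orbit sums in it having been expressed before.
\<close>

type_synonym cert = "((nat \<times> nat list) list \<times> nat list) list"

text \<open>Addition of an orbit sum modulo 2: a second copy cancels the first.\<close>

fun toggle :: "nat list \<Rightarrow> nat list list \<Rightarrow> nat list list"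
  where "toggle m [] = [m]" | "toggle m (x # xs) = (if m = x then xs else x # toggle m xs)"

lemma Osum_toggle: "Osum (toggle m ms) w = Orb m w + Osum ms w"
  by (induction ms) (simp_all add: add_ac)

lemma Osum_toggles: "Osum (foldr toggle ms xs) w = Osum ms w + Osum xs w"
  by (induction ms) (simp_all add: Osum_toggle)

definition hit_reps :: "(nat \<times> nat list) list \<Rightarrow> nat list list"
  where "hit_reps hs = foldr toggle (concat (map (\<lambda>(n, p). map rep (sqL 0 n p)) hs)) []"

fun run :: "tree \<Rightarrow> cert \<Rightarrow> tree option"
  where
    "run t [] = Some t"
  | "run t ((hs, m) # cs) =
      (let L = hit_reps hs in
       if list_all (\<lambda>(n, p). 0 < n \<and> length p = 5) hs \<and> odd (length (filter (\<lambda>x. x = m) L))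
       then case nfs t (filter (\<lambda>x. x \<noteq> m) L) of None \<Rightarrow> None | Some v \<Rightarrow> run (ins t m v) cs
       else None)"

definition good :: "nat list list \<Rightarrow> tree \<Rightarrow> bool"
  where "good bs t \<longleftrightarrow> (\<forall>(m, v)\<in>ents t. Orb m w0 + lcb bs v \<in> EH)"

lemma nfs_good:
  assumes "good bs t" "nfs t ms = Some v"
  shows "Osum ms w0 + lcb bs v \<in> EH"
  using assms(2)
proof (induction ms arbitrary: v)
  case (Cons m ms)
  then obtain u u' where u: "look t m = Some u" "nfs t ms = Some u'" "v = vx u u'"
    by (auto split: option.splits)
  have "Orb m w0 + lcb bs u \<in> EH"
    using look_ents[OF u(1)] assms(1) by (auto simp: good_def)
  from EH_add[OF this Cons(1)[OF u(2)]] show ?case by (simp add: u(3) lcb_vx add_ac)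
qed simp

text \<open>Operations commute with the sum over conjugates, so expanding one monomial by
  \<open>sqL\<close> yields an operation on its whole orbit sum.\<close>

lemma hit_reps_EH:
  assumes "list_all (\<lambda>(n, p). 0 < n \<and> length p = 5) hs"
  shows "Osum (hit_reps hs) w0 \<in> EH"
  using assms
proof (induction hs)
  case (Cons h hs)
  obtain n p where h: "h = (n, p)" by (cases h)
  have len: "length m = 5" if "m \<in> set (sqL 0 n p)" for m using that by (rule sqL_length)
  then have "map ((\<lambda>m. Orb m w0) \<circ> rep) (sqL 0 n p) = map (\<lambda>m. Orb m w0) (sqL 0 n p)"
    by (simp add: Orb_rep)
  then have "Osum (map rep (sqL 0 n p)) w0 = Osum (sqL 0 n p) w0"
    unfolding Osum_def map_map by (rule arg_cong)
  also have "\<dots> = SqE n (Orb p w0)" using Cons h by (simp add: SqE_Orb)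
  also have "\<dots> \<in> EH" using Cons h by (intro SqE_EH Orb_PPE) simp
  finally show ?case using Cons h by (simp add: hit_reps_def Osum_toggles EH_add)
qed (simp add: hit_reps_def)

lemma Osum_filter: "Osum L w = Osum (filter P L) w + Osum (filter (\<lambda>x. \<not> P x) L) w"
  by (induction L) (simp_all add: add_ac)

lemma Osum_filter_eq: "Osum (filter (\<lambda>x. x = m) L) w = of_nat (length (filter (\<lambda>x. x = m) L)) * Orb m w"
  by (induction L) (simp_all add: distrib_right)

lemma run_good: "good bs t \<Longrightarrow> run t cs = Some t' \<Longrightarrow> good bs t'"
proof (induction t cs rule: run.induct)
  case (2 t hs m cs)
  define L where "L = hit_reps hs"
  from 2(3) have hs: "list_all (\<lambda>(n, p). 0 < n \<and> length p = 5) hs"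
    and odd: "odd (length (filter (\<lambda>x. x = m) L))"
    and "\<exists>v. nfs t (filter (\<lambda>x. x \<noteq> m) L) = Some v \<and> run (ins t m v) cs = Some t'"
    by (auto simp: L_def Let_def split: if_splits option.splits)
  then obtain v where v: "nfs t (filter (\<lambda>x. x \<noteq> m) L) = Some v" "run (ins t m v) cs = Some t'" by blast
  have "Osum L w0 \<in> EH" unfolding L_def by (rule hit_reps_EH[OF hs])
  moreover have "Osum L w0 = Orb m w0 + Osum (filter (\<lambda>x. x \<noteq> m) L) w0"
    using odd by (subst Osum_filter[of _ _ "\<lambda>x. x = m"]) (simp only: Osum_filter_eq of_nat_laurent_ext, simp)
  ultimately have "Orb m w0 + lcb bs v \<in> EH"
    using EH_add[OF _ nfs_good[OF 2(2) v(1)]] by (fastforce simp: add_ac)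
  then have "good bs (ins t m v)"
    using 2(2) ents_ins[of t m v] by (auto simp: good_def)
  with 2(1)[OF L_def] hs odd v show ?case by (simp add: L_def)
qed simp

fun basis_tree :: "nat \<Rightarrow> nat list list \<Rightarrow> tree \<Rightarrow> tree"
  where
    "basis_tree i [] t = t"
  | "basis_tree i (b # bs) t = basis_tree (Suc i) bs (ins t b (replicate i False @ [True]))"

lemma good_basis_tree: "good bs (basis_tree 0 bs Lf)"
proof -
  have *: "good bs (basis_tree i cs t)" if "good bs t" "drop i bs = cs" for i cs t
    using that
  proof (induction i cs t rule: basis_tree.induct)
    case (2 i b cs t)
    have i: "i < length bs" "bs ! i = b" "drop (Suc i) bs = cs"
      using 2(3) by (metis drop_all list.discI not_le, metis nth_via_drop, metis drop_Suc drop_tl list.sel(3))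
    have "bat (replicate i False @ [True]) = (\<lambda>j. if j = i then 1 else 0)"
      by (rule ext) (auto simp: bat_def nth_append)
    then have "lcb bs (replicate i False @ [True]) = (\<Sum>j<length bs. if j = i then Orb (bs ! j) w0 else 0)"
      unfolding lcb_def lc_def by (intro sum.cong) auto
    also have "\<dots> = Orb b w0" using i by simp
    finally have "good bs (ins t b (replicate i False @ [True]))"
      using 2(2) ents_ins[of t b "replicate i False @ [True]"] by (auto simp: good_def)
    then show ?case using 2(1) i by simp
  qed simp
  show ?thesis by (rule *) (simp_all add: good_def)
qed

text \<open>For exponents with sum \<open>d\<close> the weight is
  \<open>d + a1 + 3 * a2 + 7 * a3 + 15 * a4\<close>. Divisibility by 31 thus fixes \<open>a1\<close>
  modulo 31, hence \<open>a1\<close> itself if \<open>d < 31\<close>, and the degree fixes the first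
  exponent.\<close>

definition enum :: "nat \<Rightarrow> nat list list"
  where "enum d = concat (map (\<lambda>a4. concat (map (\<lambda>a3. concat (map (\<lambda>a2.
    let s = a2 + a3 + a4; a1 = (31 - (d + 3 * a2 + 7 * a3 + 15 * a4) mod 31) mod 31
    in if s + a1 \<le> d then [[d - (s + a1), a1, a2, a3, a4]] else [])
    [0..<Suc (d - (a3 + a4))])) [0..<Suc (d - a4)])) [0..<Suc d])"

lemma enum_complete:
  assumes "length m = 5" "sum_list m = d" "31 dvd wtl 0 m" "d < 31"
  shows "m \<in> set (enum d)"
proof -
  obtain a0 a1 a2 a3 a4 where m: "m = [a0, a1, a2, a3, a4]" using assms(1) by (rule length_5E)
  define X where "X = d + 3 * a2 + 7 * a3 + 15 * a4"
  have d: "d = a0 + a1 + a2 + a3 + a4" using assms(2) m by simp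
  have "wtl 0 m = a1 + X" using d by (simp add: m X_def)
  then have "31 dvd a1 + X" "a1 < 31" using assms(3,4) d by simp_all
  then have a1: "31 dvd a1 + X mod 31" "a1 < 31"
    by (simp_all add: dvd_eq_mod_eq_0 mod_add_right_eq)
  then obtain q where q: "a1 + X mod 31 = 31 * q" by (elim dvdE)
  have "X mod 31 < 31" by simp
  with q a1(2) have "q = 0 \<or> q = 1" by linarith
  with q a1(2) have "a1 = (31 - X mod 31) mod 31" by (elim disjE) auto
  then have a1: "(31 - (d + 3 * a2 + 7 * a3 + 15 * a4) mod 31) mod 31 = a1" by (simp only: X_def)
  have "m \<in> set (let s = a2 + a3 + a4; a1 = (31 - (d + 3 * a2 + 7 * a3 + 15 * a4) mod 31) mod 31
      in if s + a1 \<le> d then [[d - (s + a1), a1, a2, a3, a4]] else [])"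
    unfolding Let_def a1 using d by (simp add: m)
  moreover have "a4 \<in> set [0..<Suc d]" "a3 \<in> set [0..<Suc (d - a4)]" "a2 \<in> set [0..<Suc (d - (a3 + a4))]"
    using d by auto
  moreover have concat: "x \<in> set xs \<Longrightarrow> z \<in> set (h x) \<Longrightarrow> z \<in> set (concat (map h xs))"
    for x xs and h :: "nat \<Rightarrow> nat list list" and z by auto
  ultimately show ?thesis
    unfolding enum_def by (intro concat[of a4] concat[of a3] concat[of a2])
qed

definition cert_ok :: "nat \<Rightarrow> nat list list \<Rightarrow> cert \<Rightarrow> bool"
  where "cert_ok d bs cs = (d < 31 \<and> (case run (basis_tree 0 bs Lf) cs of None \<Rightarrow> False
    | Some t \<Rightarrow> list_all (\<lambda>m. look t (rep m) \<noteq> None) (enum d)))"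

lemma cert_ok_Orb:
  assumes "cert_ok d bs cs" "length m = 5" "sum_list m = d" "31 dvd wtl 0 m"
  shows "\<exists>v. Orb m w0 + lcb bs v \<in> EH"
proof -
  from assms(1) obtain t where t: "run (basis_tree 0 bs Lf) cs = Some t" "d < 31"
    "list_all (\<lambda>m. look t (rep m) \<noteq> None) (enum d)"
    by (auto simp: cert_ok_def split: option.splits)
  from t(3) enum_complete[OF assms(2-4) t(2)] obtain v where v: "look t (rep m) = Some v"
    by (auto simp: list_all_iff)
  have "good bs t" using run_good[OF good_basis_tree t(1)] .
  with look_ents[OF v] have "Orb (rep m) w0 + lcb bs v \<in> EH" by (auto simp: good_def)
  then show ?thesis using Orb_rep[OF assms(2)] by auto
qed

text \<open>Modulo hits \<open>f\<close> equals its average, a combination over F_32 of orbit sums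
  of weight divisible by 31, and the certificate rewrites each of these in terms of
  \<open>bs\<close>.\<close>

theorem invariant_reduction:
  assumes cert: "cert_ok d bs cs" and f: "f \<in> poly_part 5 (int d)"
    and inv: "\<And>v. v \<in> gens 5 \<Longrightarrow> subst v f + f \<in> hits 5"
  shows "\<exists>\<gamma>. emb f + lc \<gamma> bs w0 \<in> EH"
    and "words_ok gs \<Longrightarrow> TEs gs (emb f) + emb f \<in> EH"
proof -
  have TE: "TE (subg g) (emb f) + emb f \<in> EH" if "gen_ok g" for g
    using inv[OF subg_gens[OF that]] by (simp add: TE_emb EH_emb flip: emb_add)
  then show "words_ok gs \<Longrightarrow> TEs gs (emb f) + emb f \<in> EH" by (rule TEs_invariant)
  have "\<exists>\<gamma>. avg p + lc \<gamma> bs w0 \<in> EH" if "p \<in> span_Y d" for p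
    using that
  proof (induction rule: span_Y.induct)
    case zero
    then show ?case by (intro exI[of _ "\<lambda>i. 0"]) (simp add: avg_zero)
  next
    case (Y m)
    show ?case
    proof (cases "31 dvd wtl 0 m")
      case True
      then show ?thesis using cert_ok_Orb[OF cert Y True] by (auto simp: avg_Y lcb_def)
    next
      case False
      then show ?thesis by (intro exI[of _ "\<lambda>i. 0"]) (simp add: avg_Y)
    qed
  next
    case (add p q)
    then obtain \<gamma> \<delta> where "avg p + lc \<gamma> bs w0 \<in> EH" "avg q + lc \<delta> bs w0 \<in> EH" by blast
    from EH_add[OF this] show ?case
      by (intro exI[of _ "\<lambda>i. \<gamma> i + \<delta> i"]) (simp add: avg_add lc_add add_ac)
  next
    case (sc p c)
    then obtain \<gamma> where "avg p + lc \<gamma> bs w0 \<in> EH" by blast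
    from EH_sc[OF this, of c] show ?case
      by (intro exI[of _ "\<lambda>i. c * \<gamma> i"]) (simp add: avg_sc lc_sc distrib_left)
  qed
  from this[OF emb_span_Y[OF f]] obtain \<gamma> where "avg (emb f) + lc \<gamma> bs w0 \<in> EH" by blast
  from EH_add[OF this avg_invariant[OF TE]] show "\<exists>\<gamma>. emb f + lc \<gamma> bs w0 \<in> EH"
    by (intro exI[of _ \<gamma>]) (simp add: add_ac)
qed

subsection \<open>Spike functionals\<close>

definition et :: "nat list \<Rightarrow> nat \<Rightarrow>\<^sub>0 int"
  where "et t = (\<Sum>b<5. Poly_Mapping.single b (int (t ! b)))"

lemma lookup_et: "Poly_Mapping.lookup (et t) i = (if i < 5 then int (t ! i) else 0)"
  by (simp add: et_def lookup_sum lookup_single when_def)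

definition kap :: "nat list \<Rightarrow> laurent ext \<Rightarrow> bit ext"
  where "kap t = map_ext (\<lambda>f. Poly_Mapping.lookup f (et t))"

lemma kap_add: "kap t (p + q) = kap t p + kap t q"
  unfolding kap_def by (rule map_ext_add) (rule lookup_add)

lemma kap_zero [simp]: "kap t 0 = 0"
  by (simp add: kap_def zero_ext_def)

lemma kap_sum: "kap t (sum f I) = (\<Sum>i\<in>I. kap t (f i))"
  by (induction I rule: infinite_finite_induct) (simp_all add: kap_add)

lemma kap_sc: "kap t (sc c * p) = c * kap t p"
proof -
  have l: "Poly_Mapping.lookup (Poly_Mapping.single 0 b * f) e = b * Poly_Mapping.lookup f e" for b and f :: laurent and e
    by (cases b) simp_all
  show ?thesis by (cases c; cases p) (simp add: kap_def sc_def lookup_add l)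
qed

lemma kap_one: "length t = 5 \<Longrightarrow> kap t 1 = (if list_all (\<lambda>a. a = 0) t then 1 else 0)"
proof -
  assume t: "length t = 5"
  have "et t = 0 \<longleftrightarrow> list_all (\<lambda>a. a = 0) t"
    using t by (auto simp: poly_mapping_eq_iff fun_eq_iff lookup_et list_all_length)
  then show ?thesis by (simp add: kap_def one_ext_def zero_ext_def lookup_one when_def)
qed

lemma lookup_lvar_mult:
  assumes "f \<in> PP 5" "b < 5" "length t = 5"
  shows "Poly_Mapping.lookup (xv b * f) (et t)
    = (if 0 < t ! b then Poly_Mapping.lookup f (et (t[b := t ! b - 1])) else 0)"
  using assms(1) unfolding PP_def mem_Collect_eq
proof (induction rule: keys_induct)
  case (basis e)
  have "Poly_Mapping.single b 1 + e = et t \<longleftrightarrow> 0 < t ! b \<and> e = et (t[b := t ! b - 1])"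
  proof
    assume eq: "Poly_Mapping.single b 1 + e = et t"
    then have l: "Poly_Mapping.lookup (Poly_Mapping.single b 1 + e) i = Poly_Mapping.lookup (et t) i" for i by simp
    have "0 \<le> Poly_Mapping.lookup e b" using basis by (simp add: poly_exp_def)
    then have pos: "0 < t ! b"
      using l[of b] assms(2) by (simp add: lookup_add lookup_et)
    moreover have "e = et (t[b := t ! b - 1])"
    proof (rule poly_mapping_eqI)
      fix i show "Poly_Mapping.lookup e i = Poly_Mapping.lookup (et (t[b := t ! b - 1])) i"
        using l[of i] pos assms by (auto simp: lookup_add lookup_et lookup_single when_def nth_list_update of_nat_diff split: if_splits)
    qed
    ultimately show "0 < t ! b \<and> e = et (t[b := t ! b - 1])" ..
  next
    assume "0 < t ! b \<and> e = et (t[b := t ! b - 1])"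
    then show "Poly_Mapping.single b 1 + e = et t"
      using assms by (intro poly_mapping_eqI) (auto simp: lookup_add lookup_et lookup_single when_def nth_list_update of_nat_diff)
  qed
  then show ?case by (auto simp: lvar_mult_basis lookup_single when_def)
qed (simp_all add: distrib_left lookup_add)

lemma kap_lvar_mult:
  assumes "p \<in> PPE" "b < 5" "length t = 5"
  shows "kap t (emb (xv b) * p) = (if 0 < t ! b then kap (t[b := t ! b - 1]) p else 0)"
  using assms by (cases p) (simp add: kap_def emb_mult_Ext PPE_Ext lookup_lvar_mult zero_ext_def)

lemma kap_y_mult:
  assumes "p \<in> PPE" "length t = 5"
  shows "kap t (y i w * p) = (\<Sum>b<5. if 0 < t ! b then (w ! b) ^ 2 ^ i * kap (t[b := t ! b - 1]) p else 0)"
  unfolding y_def sum_distrib_right kap_sum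
  by (intro sum.cong refl) (simp add: mult.assoc kap_sc kap_lvar_mult[OF assms(1) _ assms(2)])

abbreviation half :: "nat list \<Rightarrow> nat list"
  where "half \<equiv> map (\<lambda>a. a div 2)"

lemma lookup_square:
  assumes "length t = 5"
  shows "Poly_Mapping.lookup (f * f :: laurent) (et t)
    = (if list_all even t then Poly_Mapping.lookup f (et (half t)) else 0)"
proof (induction f rule: basis_induct)
  case (add e f)
  have "e + e = et t \<longleftrightarrow> list_all even t \<and> e = et (half t)"
  proof
    assume eq: "e + e = et t"
    then have l: "2 * Poly_Mapping.lookup e i = Poly_Mapping.lookup (et t) i" for i
      by (metis lookup_add mult_2)
    have ev: "int (t ! i) = 2 * Poly_Mapping.lookup e i" if "i < 5" for i
      using l[of i] that by (simp add: lookup_et)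
    then have "even (t ! i)" if "i < 5" for i
      using that by (metis dvd_triv_left even_of_nat)
    moreover have "e = et (half t)"
    proof (rule poly_mapping_eqI)
      fix i show "Poly_Mapping.lookup e i = Poly_Mapping.lookup (et (half t)) i"
        using l[of i] ev[of i] assms by (auto simp: lookup_et zdiv_int)
    qed
    ultimately show "list_all even t \<and> e = et (half t)" using assms by (simp add: list_all_length)
  next
    assume a: "list_all even t \<and> e = et (half t)"
    show "e + e = et t"
    proof (rule poly_mapping_eqI)
      fix i
      have "int (t ! i div 2) + int (t ! i div 2) = int (t ! i)" if "i < 5"
      proof -
        have "even (t ! i)" using a that assms by (simp add: list_all_length)
        then show ?thesis by presburger
      qed
      then show "Poly_Mapping.lookup (e + e) i = Poly_Mapping.lookup (et t) i"
        unfolding lookup_add using a assms by (simp add: lookup_et)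
    qed
  qed
  then show ?case
    by (simp add: pm_square_add lookup_add add mult_single) (auto simp: lookup_single when_def)
qed simp

text \<open>Cross terms vanish in characteristic 2, and the scalars are squared together with the
  monomials.\<close>

lemma kap_square:
  assumes "length t = 5"
  shows "kap t (p ^ 2) = (if list_all even t then (kap (half t) p) ^ 2 else 0)"
proof (cases p)
  case (Ext a0 a1 a2 a3 a4)
  have c: "u + (u + w) = w" for u w :: laurent by simp
  have "p ^ 2 = Ext (a0 * a0 + a4 * a4) (a3 * a3) (a1 * a1 + a4 * a4) (a3 * a3 + a4 * a4) (a2 * a2)"
    unfolding Ext power2_eq_square by (simp add: mult.commute add_ac)
  then show ?thesis
    using assms by (simp add: Ext kap_def lookup_add lookup_square zero_ext_def flip: sqb)
qed

section \<open>Coefficients of adapted monomials by repeated halving of exponents\<close>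

fun oddprod :: "nat \<Rightarrow> nat list \<Rightarrow> bit ext list \<Rightarrow> laurent ext"
  where
    "oddprod i [] w = 1"
  | "oddprod i (a # as) w = (if odd a then y i w else 1) * oddprod (Suc i) as w"

lemma oddprod_PPE: "oddprod i as w \<in> PPE"
  by (induction i as w rule: oddprod.induct) (auto intro: PPE_mult y_PPE)

lemma Yl_halves: "Yl i as w = oddprod i as w * (Yl i (half as) w) ^ 2"
proof (induction as arbitrary: i)
  case (Cons a as)
  have "y i w ^ a = (if odd a then y i w else 1) * (y i w ^ (a div 2)) ^ 2"
  proof (cases "even a")
    case True
    then show ?thesis by (simp flip: power_mult)
  next
    case False
    then have "a = Suc (a div 2 * 2)" by presburger
    then have "y i w ^ a = y i w ^ Suc (a div 2 * 2)" by (rule arg_cong)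
    then show ?thesis using False by (simp add: power_mult)
  qed
  then show ?case by (simp only: Yl.simps oddprod.simps list.map Cons power_mult_distrib mult_ac)
qed simp

text \<open>A square contributes even exponents and each linear factor changes one parity, so there
  must be at least as many linear factors as odd exponents in \<open>t\<close>. This prunes the
  expansion.\<close>

lemma kap_oddprod_parity:
  assumes "q \<in> PPE" "length t = 5" "length (filter odd as) < length (filter odd t)"
  shows "kap t (oddprod i as w * q ^ 2) = 0"
  using assms(2,3)
proof (induction as arbitrary: i t)
  case Nil
  then have "\<not> list_all even t" by (auto simp: list_all_iff filter_empty_conv)
  then show ?case using Nil by (simp add: kap_square)
next
  case (Cons a as)
  show ?case
  proof (cases "odd a")
    case True
    have "kap (t[b := t ! b - 1]) (oddprod (Suc i) as w * q ^ 2) = 0" if b: "b < 5" "0 < t ! b" for b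
    proof (rule Cons(1))
      have f: "length (filter odd t) = (\<Sum>i<5. if odd (t ! i) then 1 else 0)" if "length t = 5" for t :: "nat list"
        using that by (simp add: length_filter_conv_card sum.If_cases Int_def)
      have "(\<Sum>i\<in>{..<5} - {b}. if odd (t[b := t ! b - 1] ! i) then 1 else 0 :: nat)
          = (\<Sum>i\<in>{..<5} - {b}. if odd (t ! i) then 1 else 0)"
        by (intro sum.cong) auto
      then have "length (filter odd t) \<le> length (filter odd (t[b := t ! b - 1])) + 1"
        using b Cons(2) by (simp add: f sum.remove[of "{..<5}" b])
      then show "length (filter odd as) < length (filter odd (t[b := t ! b - 1]))"
        using Cons(3) True by simp
    qed (simp add: Cons)
    note Z = this
    have "kap t (oddprod i (a # as) w * q ^ 2)
        = (\<Sum>b<5. if 0 < t ! b then (w ! b) ^ 2 ^ i * kap (t[b := t ! b - 1]) (oddprod (Suc i) as w * q ^ 2) else 0)"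
      using True Cons(2) assms(1)
      by (simp add: mult.assoc kap_y_mult PPE_mult oddprod_PPE PPE_power)
    also have "\<dots> = 0" by (intro sum.neutral) (auto simp: Z simp del: One_nat_def)
    finally show ?thesis .
  next
    case False
    then show ?thesis using Cons by simp
  qed
qed

lemma kap_oddprod_odd:
  assumes "q \<in> PPE" "length t = 5" "odd a"
  shows "kap t (oddprod i (a # as) w * q ^ 2) = (if length (filter odd t) \<le> length (filter odd (a # as))
    then \<Sum>b\<leftarrow>[0, 1, 2, 3, 4]. if 0 < t ! b
      then (w ! b) ^ 2 ^ i * kap (t[b := t ! b - 1]) (oddprod (Suc i) as w * q ^ 2) else 0 else 0)"
proof (cases "length (filter odd t) \<le> length (filter odd (a # as))")
  case True
  have 5: "(\<Sum>b<5. F b) = (\<Sum>b\<leftarrow>[0, 1, 2, 3, 4]. F b)" for F :: "nat \<Rightarrow> bit ext"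
    by (simp add: eval_nat_numeral add_ac)
  have "kap t (oddprod i (a # as) w * q ^ 2)
      = (\<Sum>b<5. if 0 < t ! b then (w ! b) ^ 2 ^ i * kap (t[b := t ! b - 1]) (oddprod (Suc i) as w * q ^ 2) else 0)"
    using assms by (simp add: mult.assoc kap_y_mult PPE_mult oddprod_PPE PPE_power)
  then show ?thesis unfolding 5 using True by (simp only: if_True)
next
  case False
  then have "kap t (oddprod i (a # as) w * q ^ 2) = 0"
    by (intro kap_oddprod_parity[OF assms(1,2)]) (simp only: not_le)
  then show ?thesis using False by (simp only: if_False)
qed

text \<open>
  Coefficients of \<open>y\<^sup>m\<close> are computed by a dynamic program on lists of pairs \<open>(t, v)\<close>, each standing for
  \<open>v\<close> times the coefficient of \<open>x\<^sup>t\<close> in the factors still to be expanded.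
\<close>

definition tot :: "(nat list \<Rightarrow> bit ext) \<Rightarrow> (nat list \<times> bit ext) list \<Rightarrow> bit ext"
  where "tot R X = (\<Sum>(t, v)\<leftarrow>X. v * R t)"

lemma tot_simps [simp]: "tot R [] = 0" "tot R ((t, v) # X) = v * R t + tot R X"
  by (simp_all add: tot_def)

abbreviation five :: "(nat list \<times> bit ext) list \<Rightarrow> bool"
  where "five \<equiv> list_all (\<lambda>(t, v). length t = 5)"

text \<open>Merging equal exponent vectors keeps the list from growing with the number of expansion
  paths.\<close>

fun collect :: "nat list \<Rightarrow> bit ext \<Rightarrow> (nat list \<times> bit ext) list \<Rightarrow> (nat list \<times> bit ext) list"
  where
    "collect t v [] = [(t, v)]"
  | "collect t v ((s, u) # X) = (if s = t then (s, u + v) # X else (s, u) # collect t v X)"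

lemma tot_collect: "tot R (collect t v X) = v * R t + tot R X"
  by (induction X) (auto simp: distrib_right add_ac)

lemma five_collect: "length t = 5 \<Longrightarrow> five X \<Longrightarrow> five (collect t v X)"
  by (induction X) auto

fun pick :: "bit ext list \<Rightarrow> nat list \<Rightarrow> bit ext \<Rightarrow> nat list \<Rightarrow> (nat list \<times> bit ext) list \<Rightarrow> (nat list \<times> bit ext) list"
  where
    "pick w t v [] X = X"
  | "pick w t v (b # bs) X = (if 0 < t ! b
      then collect (t[b := t ! b - 1]) (v * w ! b) (pick w t v bs X) else pick w t v bs X)"

lemma tot_pick: "tot R (pick w t v bs X)
  = v * (\<Sum>b\<leftarrow>bs. if 0 < t ! b then w ! b * R (t[b := t ! b - 1]) else 0) + tot R X"
  by (induction bs) (simp_all add: tot_collect distrib_left mult.assoc add_ac)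

lemma five_pick: "length t = 5 \<Longrightarrow> five X \<Longrightarrow> five (pick w t v bs X)"
  by (induction bs) (simp_all add: five_collect)

fun picks :: "bit ext list \<Rightarrow> nat \<Rightarrow> (nat list \<times> bit ext) list \<Rightarrow> (nat list \<times> bit ext) list"
  where
    "picks w k [] = []"
  | "picks w k ((t, v) # X) = (if length (filter odd t) \<le> k
      then pick w t v [0, 1, 2, 3, 4] (picks w k X) else picks w k X)"

lemma five_picks: "five X \<Longrightarrow> five (picks w k X)"
  by (induction w k X rule: picks.induct) (simp_all add: five_pick del: pick.simps)

fun level :: "bit ext list \<Rightarrow> nat list \<Rightarrow> (nat list \<times> bit ext) list \<Rightarrow> (nat list \<times> bit ext) list"
  where
    "level w [] X = filter (\<lambda>(t, v). list_all even t) X"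
  | "level w (a # as) X = level (map sqb w) as (if odd a then picks w (length (filter odd (a # as))) X else X)"

lemma five_level: "five X \<Longrightarrow> five (level w as X)"
  by (induction w as X rule: level.induct) (simp_all add: five_picks, auto simp: list_all_iff)

lemma zero_power2 [simp]: "(0 :: bit ext) ^ 2 ^ e = 0"
  by (rule zero_power) simp

lemma bit_ext_power2_sum_list: "(\<Sum>b\<leftarrow>bs. f b) ^ 2 ^ e = (\<Sum>b\<leftarrow>bs. f b ^ 2 ^ e :: bit ext)"
  by (induction bs) (simp_all add: bit_ext_power2_add)

text \<open>Halving turns coefficients into squares of coefficients. The squares are recorded in the
  exponent \<open>2 ^ Suc e\<close> and matched by twisting \<open>w\<close>, so the accumulated
  factors \<open>v\<close> never have to be altered.\<close>

lemma tot_level: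
  assumes "q \<in> PPE" "length w = 5" "five X"
  shows "tot (\<lambda>t. kap t (oddprod i as w * q ^ 2) ^ 2 ^ e) X
    = tot (\<lambda>s. kap (half s) q ^ 2 ^ Suc e) (level (map (\<lambda>x. x ^ 2 ^ (i + e)) w) as X)"
  using assms(3)
proof (induction as arbitrary: i X)
  case Nil
  have "(x ^ 2) ^ 2 ^ e = x ^ 2 ^ Suc e" for x :: "bit ext" by (simp flip: power_mult)
  with Nil show ?case by (induction X) (auto simp: kap_square)
next
  case (Cons a as)
  let ?W = "map (\<lambda>x. x ^ 2 ^ (i + e)) w"
  let ?R = "\<lambda>t. kap t (oddprod (Suc i) as w * q ^ 2) ^ 2 ^ e"
  have W: "map sqb ?W = map (\<lambda>x. x ^ 2 ^ (Suc i + e)) w"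
    by (simp add: sqb o_def mult.commute[of 2] flip: power_mult)
  show ?case
  proof (cases "odd a")
    case True
    define k where "k = length (filter odd (a # as))"
    have "(kap t (oddprod i (a # as) w * q ^ 2)) ^ 2 ^ e
        = (if length (filter odd t) \<le> k then \<Sum>b\<leftarrow>[0, 1, 2, 3, 4]. if 0 < t ! b then ?W ! b * ?R (t[b := t ! b - 1]) else 0 else 0)"
      if "length t = 5" for t
    proof -
      have "(if 0 < t ! b then (w ! b) ^ 2 ^ i * kap (t[b := t ! b - 1]) (oddprod (Suc i) as w * q ^ 2) else 0) ^ 2 ^ e
          = (if 0 < t ! b then ?W ! b * ?R (t[b := t ! b - 1]) else 0)" if "b < 5" for b
        using that assms(2) by (simp add: power_mult_distrib power_add power_mult)
      note H = this
      have "(\<Sum>b\<leftarrow>[0, 1, 2, 3, 4]. (if 0 < t ! b then (w ! b) ^ 2 ^ i * kap (t[b := t ! b - 1]) (oddprod (Suc i) as w * q ^ 2) else 0) ^ 2 ^ e)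
          = (\<Sum>b\<leftarrow>[0, 1, 2, 3, 4]. if 0 < t ! b then ?W ! b * ?R (t[b := t ! b - 1]) else 0)"
        by (intro arg_cong[of _ _ sum_list] map_cong refl, rule H, auto)
      then show ?thesis
        unfolding kap_oddprod_odd[OF assms(1) that True] k_def
        by (cases "length (filter odd t) \<le> length (filter odd (a # as))")
          (simp_all only: if_True if_False bit_ext_power2_sum_list zero_power2)
    qed
    note step = this
    have "tot (\<lambda>t. kap t (oddprod i (a # as) w * q ^ 2) ^ 2 ^ e) X = tot ?R (picks ?W k X)"
      using Cons.prems
    proof (induction X)
      case (Cons x X)
      obtain t v where x: "x = (t, v)" by (cases x)
      have len: "length t = 5" "five X" using Cons.prems by (simp_all add: x)
      note IH = Cons.IH[OF len(2)]
      show ?case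
      proof (cases "length (filter odd t) \<le> k")
        case True
        then show ?thesis by (simp only: x tot_simps picks.simps step[OF len(1)] if_True tot_pick IH)
      next
        case False
        then show ?thesis by (simp only: x tot_simps picks.simps step[OF len(1)] if_False mult_zero_right add_0_left IH)
      qed
    qed (simp only: tot_simps picks.simps)
    also have "\<dots> = tot (\<lambda>s. kap (half s) q ^ 2 ^ Suc e) (level (map sqb ?W) as (picks ?W k X))"
      unfolding W by (rule Cons.IH) (rule five_picks[OF Cons.prems])
    finally show ?thesis using True by (simp only: level.simps if_True not_False_eq_True k_def)
  next
    case False
    then show ?thesis using Cons.IH[OF Cons.prems, of "Suc i"] by (simp only: level.simps oddprod.simps if_False mult_1_left W not_True_eq_False)
  qed
qed

text \<open>The first argument bounds the recursion: one level for each binary digit of the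
  exponents and one for the final test, hence \<open>coef 6\<close> for exponents below 32.\<close>

fun coef :: "nat \<Rightarrow> bit ext list \<Rightarrow> nat list \<Rightarrow> (nat list \<times> bit ext) list \<Rightarrow> bit ext"
  where
    "coef 0 w m X = 0"
  | "coef (Suc n) w m X = (if list_all (\<lambda>a. a = 0) m
      then sum_list (map snd (filter (\<lambda>(t, v). list_all (\<lambda>a. a = 0) t) X))
      else coef n (map sqb w) (half m) (map (\<lambda>(t, v). (half t, v)) (level w m X)))"

lemma tot_coef_zero:
  assumes "list_all (\<lambda>a. a = 0) m" "five X"
  shows "tot (\<lambda>t. kap t (Y m w) ^ 2 ^ e) X = sum_list (map snd (filter (\<lambda>(t, v). list_all (\<lambda>a. a = 0) t) X))"
proof -
  have "Yl i as w = 1" if "list_all (\<lambda>a. a = 0) as" for i as using that by (induction as arbitrary: i) auto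
  with assms(1) have "Y m w = 1" by simp
  moreover have "kap t 1 = (if list_all (\<lambda>a. a = 0) t then 1 else 0)" if "length t = 5" for t
    using that by (rule kap_one)
  ultimately show ?thesis using assms(2) by (induction X) auto
qed

lemma tot_coef:
  assumes "length w = 5" "five X" "\<forall>a\<in>set m. a < 2 ^ n"
  shows "tot (\<lambda>t. kap t (Y m w) ^ 2 ^ e) X = coef (Suc n) (map (\<lambda>x. x ^ 2 ^ e) w) m X"
  using assms(2,3)
proof (induction n arbitrary: e m X)
  case (0 e m X)
  then have "list_all (\<lambda>a. a = 0) m" by (auto simp: list_all_iff)
  with 0 show ?case using tot_coef_zero[of m X w e] by simp
next
  case (Suc n)
  show ?case
  proof (cases "list_all (\<lambda>a. a = 0) m")
    case True
    with Suc.prems show ?thesis using tot_coef_zero[of m X w e] by simp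
  next
    case False
    let ?W = "map (\<lambda>x. x ^ 2 ^ e) w"
    define L where "L = level ?W m X"
    have W: "map sqb ?W = map (\<lambda>x. x ^ 2 ^ Suc e) w" by (simp add: sqb o_def mult.commute[of 2] flip: power_mult)
    have "five L" unfolding L_def by (rule five_level[OF Suc.prems(1)])
    then have L: "five (map (\<lambda>(t, v). (half t, v)) L)" by (auto simp: list_all_iff)
    have h: "\<forall>a\<in>set (half m). a < 2 ^ n" using Suc.prems(2) by auto
    have "tot (\<lambda>t. kap t (Y m w) ^ 2 ^ e) X = tot (\<lambda>s. kap (half s) (Y (half m) w) ^ 2 ^ Suc e) L"
      unfolding L_def by (subst Yl_halves) (use tot_level[OF Yl_PPE assms(1) Suc.prems(1), of 0] in simp)
    also have "\<dots> = tot (\<lambda>s. kap s (Y (half m) w) ^ 2 ^ Suc e) (map (\<lambda>(t, v). (half t, v)) L)"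
      by (induction L) auto
    also have "\<dots> = coef (Suc n) (map sqb ?W) (half m) (map (\<lambda>(t, v). (half t, v)) L)"
      unfolding W by (rule Suc.IH[OF L h])
    finally show ?thesis using False by (simp only: coef.simps(2)[of "Suc n"] if_False L_def)
  qed
qed

definition trb :: "bit ext \<Rightarrow> bit ext"
  where "trb x = x + sqb x + sqb (sqb x) + sqb (sqb (sqb x)) + sqb (sqb (sqb (sqb x)))"

lemma trb_cases: "trb x = 0 \<or> trb x = 1"
proof (cases x)
  case (Ext a b c d e)
  then show ?thesis
    by (cases a; cases b; cases c; cases d; cases e) (simp_all add: trb_def zero_ext_def one_ext_def)
qed

text \<open>The coefficients in the conjugates of a monomial are the conjugates of one coefficient,
  so the orbit sum has their trace, an element of F_2, as coefficient.\<close>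

lemma kap_Orb_trb:
  assumes "length t = 5" "\<forall>a\<in>set m. a < 32" "length w = 5"
  shows "kap t (Orb m w) = trb (coef 6 w m [(t, 1)])"
proof -
  define z where "z = coef 6 w m [(t, 1)]"
  have c: "kap t (Y m v) ^ 2 ^ j = coef 6 (map (\<lambda>x. x ^ 2 ^ j) v) m [(t, 1)]" if "length v = 5" for v j
    using tot_coef[of v "[(t, 1)]" m 5 j] that assms by (simp add: numeral_eq_Suc del: coef.simps)
  have "kap t (Y m (frobs j w)) = kap t (Y m w) ^ 2 ^ j" for j
    using c[of "frobs j w" 0] c[of w j] assms(3) by (simp add: frobs_def)
  then have "kap t (Orb m w) = (\<Sum>j<5. kap t (Y m w) ^ 2 ^ j)" by (simp add: Orb_def kap_sum)
  also have "kap t (Y m w) = z" using c[of w 0] assms(3) by (simp add: z_def)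
  also have "(\<Sum>j<5. z ^ 2 ^ j) = trb z" by (simp add: trb_def sqb eval_nat_numeral(2,3) flip: power_mult)
  finally show ?thesis by (simp add: z_def)
qed

lemma in_concat_map: "z \<in> set (concat (map f xs)) \<Longrightarrow> \<exists>x\<in>set xs. z \<in> set (f x)"
  by auto

text \<open>The binary digits of \<open>a\<close> and \<open>j\<close> are complementary, so by
  Lucas's criterion only \<open>j = 0\<close> gives an odd binomial coefficient.\<close>

lemma bodd_add_pow2: "a + j + 1 = 2 ^ c \<Longrightarrow> bodd a j \<Longrightarrow> j = 0"
proof (induction c arbitrary: a j)
  case (Suc c)
  have "odd (a + j)" using Suc(2) by (metis Suc_eq_plus1 even_Suc even_power dvd_refl zero_less_Suc)
  then consider b k where "a = 2 * b" "j = Suc (2 * k)" | b k where "a = Suc (2 * b)" "j = 2 * k"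
    by (metis evenE oddE Suc_eq_plus1 odd_even_add even_add)
  then show ?case
  proof cases
    case 2
    then show ?thesis using Suc(1)[of b k] Suc(2,3) by simp
  qed (use Suc(3) in simp)
qed simp

lemma bit_of_nat: "(of_nat k :: bit) = (if odd k then 1 else 0)"
  by (induction k) auto

text \<open>An exponent \<open>2 ^ c - 1\<close> arises from Sq^j of a power of a variable only with
  \<open>j = 0\<close>. By the Cartan formula no positive operation is left to distribute.\<close>

lemma spike_Sq_op_basis:
  assumes "poly_exp k e" "0 < n" "\<And>i. \<exists>c. Poly_Mapping.lookup u i + 1 = 2 ^ c"
  shows "Poly_Mapping.lookup (Sq_op n (basis e)) u = 0"
  using assms
proof (induction k arbitrary: e u n)
  case 0
  then have "e = 0" by (auto simp: poly_exp_def)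
  then show ?case using 0(2) by (simp add: Sq_op_one)
next
  case (Suc k)
  define a where "a = nat (Poly_Mapping.lookup e k)"
  have a: "int a = Poly_Mapping.lookup e k" using Suc(2) by (simp add: a_def poly_exp_def)
  define e' where "e' = e - Poly_Mapping.single k (int a)"
  have e: "e = Poly_Mapping.single k (int a) + e'" by (simp add: e'_def)
  have le': "Poly_Mapping.lookup e' i = (if i = k then 0 else Poly_Mapping.lookup e i)" for i
    using a by (simp add: e'_def lookup_minus lookup_single when_def)
  have "Poly_Mapping.keys e' \<subseteq> {..<k}"
  proof
    fix i assume "i \<in> Poly_Mapping.keys e'"
    then have "i \<noteq> k" "i \<in> Poly_Mapping.keys e" using le'[of i] by (auto simp: in_keys_iff split: if_splits)
    moreover have "i < Suc k" using \<open>i \<in> Poly_Mapping.keys e\<close> Suc(2) by (auto simp: poly_exp_def)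
    ultimately show "i \<in> {..<k}" by simp
  qed
  then have e': "poly_exp k e'" using Suc(2) le' by (simp add: poly_exp_def)
  obtain c where c: "Poly_Mapping.lookup u k + 1 = 2 ^ c" using Suc(4) by blast
  have "Poly_Mapping.lookup (Sq_op j (lvar_pow k (int a)) * Sq_op (n - j) (basis e')) u = 0" if j: "j \<le> n" for j
  proof (cases "bodd a j")
    case False
    then have "binom2 (int a) j = 0" by (simp add: binom2_of_nat bit_of_nat odd_binomial)
    then show ?thesis by (simp add: Sq_op_lvar_pow)
  next
    case True
    define h where "h = Sq_op (n - j) (basis e')"
    have h: "h \<in> PP k" unfolding h_def using e' by (intro Sq_op_PP) simp
    have "binom2 (int a) j = 1" using True by (simp add: binom2_of_nat bit_of_nat odd_binomial)
    then have S: "Sq_op j (lvar_pow k (int a)) = basis (Poly_Mapping.single k (int (a + j)))"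
      by (simp add: Sq_op_lvar_pow) (simp add: lvar_pow_def)
    have shift: "Poly_Mapping.lookup (basis s * h) u = Poly_Mapping.lookup h (u - s)" for s
    proof (induction h rule: basis_induct)
      case (add x h)
      have "s + x = u \<longleftrightarrow> x = u - s" by (auto simp: algebra_simps)
      then show ?case by (simp add: distrib_left mult_single lookup_add add lookup_single when_def)
    qed simp
    show ?thesis
    proof (cases "Poly_Mapping.lookup u k = int (a + j)")
      case True
      then have "int (a + j + 1) = int (2 ^ c)" using c by simp
      then have "a + j + 1 = 2 ^ c" by (simp only: of_nat_eq_iff)
      with \<open>bodd a j\<close> have j0: "j = 0" by (intro bodd_add_pow2)
      have "\<exists>c. Poly_Mapping.lookup (u - Poly_Mapping.single k (int a)) i + 1 = 2 ^ c" for i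
      proof (cases "i = k")
        case True
        then show ?thesis using \<open>Poly_Mapping.lookup u k = int (a + j)\<close> j0
          by (intro exI[of _ 0]) (simp add: lookup_minus)
      next
        case False
        then show ?thesis using Suc(4)[of i] by (simp add: lookup_minus lookup_single when_def)
      qed
      then have "Poly_Mapping.lookup h (u - Poly_Mapping.single k (int a)) = 0"
        unfolding h_def j0 using Suc(1)[OF e' Suc(3)] by simp
      then show ?thesis unfolding S h_def[symmetric] shift by (simp add: j0)
    next
      case False
      have "u - Poly_Mapping.single k (int (a + j)) \<notin> Poly_Mapping.keys h"
      proof
        assume "u - Poly_Mapping.single k (int (a + j)) \<in> Poly_Mapping.keys h"
        then have "poly_exp k (u - Poly_Mapping.single k (int (a + j)))" using h by (simp add: PP_def)
        then have "k \<notin> Poly_Mapping.keys (u - Poly_Mapping.single k (int (a + j)))" by (auto simp: poly_exp_def)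
        with False show False by (simp add: in_keys_iff lookup_minus)
      qed
      then show ?thesis by (simp add: S h_def[symmetric] shift in_keys_iff)
    qed
  qed
  note zero = this
  have "basis e = lvar_pow k (int a) * basis e'" by (simp add: lvar_pow_def mult_single flip: e)
  then show ?case by (simp only: Sq_op_Cartan lookup_sum) (simp add: zero)
qed

lemma spike_hits:
  assumes "f \<in> hits k" "\<And>i. \<exists>c. Poly_Mapping.lookup u i + 1 = 2 ^ c"
  shows "Poly_Mapping.lookup f u = 0"
  using assms(1)
proof (induction rule: hits_induct)
  case (Sq n g)
  from Sq(2) show ?case unfolding PP_def mem_Collect_eq
  proof (induction rule: keys_induct)
    case (basis e)
    then show ?case using Sq(1) assms(2) by (intro spike_Sq_op_basis)
  qed (simp_all add: lookup_add)
qed (simp_all add: lookup_add)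

text \<open>The entries are the numbers \<open>2 ^ c - 1\<close> up to 15; the next one, 31, exceeds
  both degrees 9 and 23.\<close>

definition spike :: "nat list \<Rightarrow> bool"
  where "spike t \<longleftrightarrow> length t = 5 \<and> list_all (\<lambda>a. a \<in> {0, 1, 3, 7, 15}) t"

lemma kap_EH:
  assumes "spike t" "p \<in> EH"
  shows "kap t p = 0"
proof -
  have "\<exists>c. Poly_Mapping.lookup (et t) i + 1 = 2 ^ c" for i
  proof (cases "i < 5")
    case True
    then have "t ! i \<in> {0, 1, 3, 7, 15}" using assms(1) by (simp add: spike_def list_all_length)
    then have "t ! i + 1 = 2 ^ 0 \<or> t ! i + 1 = 2 ^ 1 \<or> t ! i + 1 = 2 ^ 2 \<or> t ! i + 1 = 2 ^ 3 \<or> t ! i + 1 = 2 ^ 4"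
      by auto
    then obtain c where "t ! i + 1 = 2 ^ c" by blast
    then have "int (t ! i + 1) = int (2 ^ c)" by (rule arg_cong)
    then show ?thesis using True by (intro exI[of _ c]) (simp add: lookup_et)
  next
    case False
    then show ?thesis by (intro exI[of _ 0]) (simp add: lookup_et)
  qed
  then have "Poly_Mapping.lookup f (et t) = 0" if "f \<in> hits 5" for f
    by (rule spike_hits[OF that])
  then show ?thesis using assms(2) by (cases p) (simp add: kap_def EH_Ext zero_ext_def)
qed

section \<open>Linear equations for the remaining coefficients\<close>

abbreviation powers :: "nat list \<Rightarrow> bit ext list"
  where "powers es \<equiv> map (\<lambda>e. zeta ^ e) es"

definition orb_val :: "nat list \<Rightarrow> nat list \<Rightarrow> nat list \<Rightarrow> bool"
  where "orb_val es t m = (trb (coef 6 (powers es) m [(t, 1)]) = 1)"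

lemma kap_Orb:
  assumes "length t = 5" "list_all (\<lambda>a. a < 32) m" "length es = 5"
  shows "kap t (Orb m (powers es)) = (if orb_val es t m then 1 else 0)"
  using kap_Orb_trb[OF assms(1), of m "powers es"] assms(2,3) trb_cases[of "coef 6 (powers es) m [(t, 1)]"]
  by (auto simp: orb_val_def list_all_iff simp del: coef.simps)

definition dotv :: "nat \<Rightarrow> (nat \<Rightarrow> bit ext) \<Rightarrow> bool list \<Rightarrow> bit ext"
  where "dotv n \<gamma> v = (\<Sum>i<n. \<gamma> i * bat v i)"

lemma dotv_vx: "dotv n \<gamma> (vx u v) = dotv n \<gamma> u + dotv n \<gamma> v"
  by (simp add: dotv_def bat_vx distrib_left sum.distrib)

definition swap_exps :: "nat list \<Rightarrow> nat list \<Rightarrow> nat list"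
  where "swap_exps js es = foldl (\<lambda>es j. es[j := es ! Suc j, Suc j := es ! j]) es js"

lemma length_swap_exps [simp]: "length (swap_exps js es) = length es"
  by (induction js arbitrary: es) (simp_all add: swap_exps_def)

lemma wacts_swaps:
  "list_all (\<lambda>j. j < 4) js \<Longrightarrow> length es = 5 \<Longrightarrow> wacts (map Sw js) (powers es) = powers (swap_exps js es)"
proof (induction js arbitrary: es)
  case (Cons j js)
  have "wact (Sw j) (powers es) = powers (es[j := es ! Suc j, Suc j := es ! j])"
    using Cons by (simp add: map_update)
  then show ?case using Cons by (simp add: swap_exps_def)
qed (simp add: swap_exps_def)

text \<open>
  An entry \<open>(t, wss)\<close> contributes, for each word of adjacent transpositions in \<open>wss\<close>, the equation
  comparing the coefficients of the spike \<open>x\<^sup>t\<close>.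
\<close>

type_synonym spec = "(nat list \<times> nat list list) list"

definition rows1 :: "nat list list \<Rightarrow> nat list list \<Rightarrow> nat list \<Rightarrow> bool list list"
  where "rows1 bs wss t = (let r = map (orb_val [0, 1, 2, 3, 4] t) bs
    in map (\<lambda>js. map2 (\<lambda>x y. x \<noteq> y) (map (orb_val (swap_exps js [0, 1, 2, 3, 4]) t) bs) r) wss)"

definition rows :: "nat list list \<Rightarrow> spec \<Rightarrow> bool list list"
  where "rows bs sp = concat (map (\<lambda>(t, wss). rows1 bs wss t) sp)"

text \<open>
  The code equations of \<open>rows\<close> avoid abstractions, since \<open>code_simp\<close> would unfold \<open>coef\<close> below them.
\<close>

fun orb_vals :: "nat list \<Rightarrow> nat list \<Rightarrow> nat list list \<Rightarrow> bool list"
  where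
    "orb_vals es t [] = []"
  | "orb_vals es t (b # bs) = orb_val es t b # orb_vals es t bs"

lemma orb_vals: "orb_vals es t bs = map (orb_val es t) bs"
  by (induction bs) simp_all

fun rows_aux :: "nat list list \<Rightarrow> bool list \<Rightarrow> nat list \<Rightarrow> nat list list \<Rightarrow> bool list list"
  where
    "rows_aux bs r t [] = []"
  | "rows_aux bs r t (js # wss) =
      map2 (\<lambda>x y. x \<noteq> y) (orb_vals (swap_exps js [0, 1, 2, 3, 4]) t bs) r # rows_aux bs r t wss"

lemma rows_aux: "rows_aux bs (map (orb_val [0, 1, 2, 3, 4] t) bs) t wss = rows1 bs wss t"
  by (induction wss) (simp_all only: rows_aux.simps orb_vals rows1_def Let_def list.map)

lemma rows_code [code]:
  "rows bs [] = []"
  "rows bs ((t, wss) # sp) = rows_aux bs (orb_vals [0, 1, 2, 3, 4] t bs) t wss @ rows bs sp"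
  by (simp_all only: rows_def orb_vals rows_aux list.map concat.simps case_prod_conv)

definition spec_ok :: "nat list list \<Rightarrow> spec \<Rightarrow> bool"
  where "spec_ok bs sp = (list_all (list_all (\<lambda>a. a < 32)) bs \<and>
    list_all (\<lambda>(t, wss). spike t \<and> list_all (list_all (\<lambda>j. j < 4)) wss) sp)"

text \<open>Elimination given as a certificate: the rows listed in \<open>sel ! i\<close> add up to
  the \<open>i\<close>-th unit vector. An index out of range stands for the zero row.\<close>

definition units_ok :: "nat \<Rightarrow> bool list list \<Rightarrow> nat list list \<Rightarrow> bool"
  where "units_ok n R sel = list_all (\<lambda>i. foldr (\<lambda>k. vx (if k < length R then R ! k else [])) (sel ! i) []
    = map (\<lambda>j. j = i) [0..<n]) [0..<n]"

lemma w0_powers: "w0 = powers [0, 1, 2, 3, 4]"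
  by (simp add: w0_def zeta_def one_ext_def numeral_eq_Suc)

text \<open>A permutation of the variables fixes \<open>f\<close> modulo hits and replaces
  \<open>w0\<close> by \<open>powers es\<close>. The two combinations therefore differ by a hit
  element, on which the spike coefficient vanishes; as coefficients of orbit sums lie in F_2, this
  is a Boolean row applied to the unknowns in F_32.\<close>

lemma rows_vanish:
  assumes ok: "spec_ok bs sp" and \<gamma>: "emb f + lc \<gamma> bs w0 \<in> EH"
    and inv: "\<And>gs. words_ok gs \<Longrightarrow> TEs gs (emb f) + emb f \<in> EH"
    and r: "r \<in> set (rows bs sp)"
  shows "dotv (length bs) \<gamma> r = 0"
proof -
  from r obtain t wss js where 1: "(t, wss) \<in> set sp" "js \<in> set wss"
    and r: "r = map2 (\<lambda>x y. x \<noteq> y) (map (orb_val (swap_exps js [0, 1, 2, 3, 4]) t) bs)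
      (map (orb_val [0, 1, 2, 3, 4] t) bs)"
  proof -
    from in_concat_map[OF r[unfolded rows_def]] obtain z where z: "z \<in> set sp"
      "r \<in> set (case z of (t, wss) \<Rightarrow> rows1 bs wss t)"
      by (elim bexE)
    obtain t wss where "z = (t, wss)" by (cases z)
    with z have "(t, wss) \<in> set sp" "r \<in> set (rows1 bs wss t)" by simp_all
    from this(2) show ?thesis unfolding rows1_def Let_def set_map
      by (elim imageE) (rule that[OF \<open>(t, wss) \<in> set sp\<close>])
  qed
  from ok 1 have t: "spike t" and js: "list_all (\<lambda>j. j < 4) js" and bs: "list_all (list_all (\<lambda>a. a < 32)) bs"
    by (auto simp: spec_ok_def list_all_iff)
  define gs where "gs = map Sw js"
  define es where "es = swap_exps js [0, 1, 2, 3, 4]"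
  have gs: "words_ok gs" using js by (simp add: gs_def list_all_iff gen_ok_def)
  have w: "wacts gs w0 = powers es" "length es = 5"
    unfolding gs_def es_def w0_powers using js by (simp_all add: wacts_swaps del: list.map)
  have "TEs gs (emb f + lc \<gamma> bs w0) \<in> EH" using gs \<gamma> by (rule TEs_EH)
  moreover have "TEs gs (lc \<gamma> bs w0) = lc \<gamma> bs (powers es)"
    by (simp add: lc_def TEs_sum TEs_sc TEs_Orb[OF gs length_w0] w)
  ultimately have A: "TEs gs (emb f) + lc \<gamma> bs (powers es) \<in> EH" by (simp add: TEs_add)
  have "(TEs gs (emb f) + lc \<gamma> bs (powers es)) + ((emb f + lc \<gamma> bs w0) + (TEs gs (emb f) + emb f)) \<in> EH"
    by (rule EH_add[OF A EH_add[OF \<gamma> inv[OF gs]]])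
  then have "lc \<gamma> bs (powers es) + lc \<gamma> bs w0 \<in> EH" by (simp add: add_ac)
  from kap_EH[OF t this]
  have "(\<Sum>i<length bs. \<gamma> i * (kap t (Orb (bs ! i) (powers es)) + kap t (Orb (bs ! i) w0))) = 0"
    by (simp add: lc_def kap_add kap_sum kap_sc distrib_left sum.distrib)
  also have "(\<Sum>i<length bs. \<gamma> i * (kap t (Orb (bs ! i) (powers es)) + kap t (Orb (bs ! i) w0))) = dotv (length bs) \<gamma> r"
    unfolding dotv_def
  proof (intro sum.cong refl)
    fix i assume "i \<in> {..<length bs}"
    then have i: "i < length bs" by simp
    have b: "list_all (\<lambda>a. a < 32) (bs ! i)" using bs i by (simp add: list_all_length)
    have t5: "length t = 5" using t by (simp add: spike_def)
    have "kap t (Orb (bs ! i) (powers es)) + kap t (Orb (bs ! i) w0) = bat r i"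
      unfolding w0_powers kap_Orb[OF t5 b w(2)]
      by (subst kap_Orb[OF t5 b]) (use i in \<open>simp_all add: bat_def r es_def\<close>)
    then show "\<gamma> i * (kap t (Orb (bs ! i) (powers es)) + kap t (Orb (bs ! i) w0)) = \<gamma> i * bat r i" by simp
  qed
  finally show ?thesis .
qed

text \<open>The rows generate all unit vectors, so every \<open>\<gamma> i\<close> is zero and
  \<open>emb f\<close> itself is hit.\<close>

theorem invariants_vanish:
  assumes cert: "cert_ok d bs cs" and sp: "spec_ok bs sp" and sel: "units_ok (length bs) (rows bs sp) sel"
    and f: "f \<in> poly_part 5 (int d)" and inv: "\<And>v. v \<in> gens 5 \<Longrightarrow> subst v f + f \<in> hits 5"
  shows "f \<in> hits 5"
proof -
  obtain \<gamma> where \<gamma>: "emb f + lc \<gamma> bs w0 \<in> EH"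
    using invariant_reduction(1)[OF cert f inv] by blast
  define n where "n = length bs"
  have row: "dotv n \<gamma> r = 0" if "r \<in> set (rows bs sp)" for r
    unfolding n_def using rows_vanish[OF sp \<gamma> invariant_reduction(2)[OF cert f inv] that] .
  have nil: "dotv n \<gamma> [] = 0" by (simp add: dotv_def bat_def)
  have "dotv n \<gamma> (foldr (\<lambda>k. vx (if k < length (rows bs sp) then rows bs sp ! k else [])) ks []) = 0" for ks
    by (induction ks) (simp_all add: nil dotv_vx row)
  then have unit: "dotv n \<gamma> (map (\<lambda>j. j = i) [0..<n]) = 0" if "i < n" for i
    using sel that unfolding units_ok_def list_all_iff n_def[symmetric] by (metis atLeast0LessThan lessThan_iff set_upt)
  have "\<gamma> i = 0" if i: "i < n" for i
  proof -
    have "dotv n \<gamma> (map (\<lambda>j. j = i) [0..<n]) = (\<Sum>j<n. if j = i then \<gamma> j else 0)"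
      unfolding dotv_def by (intro sum.cong) (auto simp: bat_def)
    then show ?thesis using unit[OF i] i by simp
  qed
  then have "lc \<gamma> bs w0 = 0" by (simp add: lc_def n_def)
  then show ?thesis using \<gamma> by (simp add: EH_emb)
qed

section \<open>Certificates in degrees 9 and 23\<close>

text \<open>Both vectors have degree 9 and weight 31.\<close>

definition basis_9 :: "nat list list"
  where "basis_9 = [[7, 0, 0, 1, 1], [5, 1, 0, 3, 0]]"

text \<open>Degree of the argument plus degree of the operation is 9, and all arguments have weight
  31; operations preserve weights modulo 31.\<close>

definition cert_9 :: cert
  where "cert_9 = [
    ([(4, [1, 1, 1, 1, 1])], [3, 2, 2, 2, 0]), ([(2, [3, 0, 3, 0, 1])], [4, 1, 0, 1, 3]),
    ([(2, [3, 2, 0, 1, 1])], [5, 1, 2, 0, 1])]"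

lemma cert_ok_9: "cert_ok 9 basis_9 cert_9"
  by code_simp

text \<open>One spike compared under the exchange of the first two variables and of the third and
  fourth: two equations for two unknowns.\<close>

definition spec_9 :: spec
  where "spec_9 = [([7, 1, 1, 0, 0], [[0], [2]])]"

lemma units_9: "units_ok (length basis_9) (rows basis_9 spec_9) [[1], [0, 1]]"
  by code_simp

lemma spec_ok_9: "spec_ok basis_9 spec_9"
  by code_simp

definition basis_23 :: "nat list list"
  where "basis_23 = [[15, 3, 0, 1, 4], [15, 1, 3, 0, 4], [15, 1, 1, 3, 3], [14, 2, 5, 1, 1], [13, 2, 3, 2, 3], [13, 0, 6, 1, 3], [11, 5, 0, 5, 2], [11, 3, 1, 7, 1]]"

text \<open>Where a step lists several hit elements, common terms cancel modulo 2 before the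
  remaining ones are looked up.\<close>

definition cert_23 :: cert
  where "cert_23 = [
    ([(8, [8, 1, 1, 4, 1])], [17, 0, 1, 1, 4]), ([(8, [8, 1, 3, 1, 2])], [18, 0, 1, 3, 1]),
    ([(8, [8, 3, 0, 2, 2])], [18, 0, 3, 0, 2]), ([(8, [9, 0, 1, 0, 5])], [21, 1, 0, 1, 0]),
    ([(8, [9, 1, 5, 0, 0])], [16, 1, 1, 5, 0]), ([(8, [9, 3, 2, 1, 0])], [16, 1, 3, 2, 1]),
    ([(8, [10, 0, 1, 2, 2])], [18, 2, 0, 1, 2]), ([(8, [10, 2, 0, 0, 3])], [19, 2, 2, 0, 0]),
    ([(8, [11, 0, 3, 1, 0])], [16, 3, 0, 3, 1]), ([(8, [11, 2, 0, 2, 0])], [16, 3, 2, 0, 2]),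
    ([(8, [13, 1, 0, 0, 1])], [17, 5, 1, 0, 0]), ([(4, [8, 5, 1, 5, 0])], [9, 1, 0, 8, 5]),
    ([(4, [9, 4, 1, 1, 4])], [9, 4, 1, 9, 0]), ([(4, [13, 5, 0, 1, 0])], [9, 5, 0, 1, 8]),
    ([(1, [15, 1, 1, 1, 4])], [14, 1, 1, 1, 6]),
    ([(1, [8, 2, 2, 7, 3]), (4, [9, 0, 5, 2, 3])], [9, 8, 1, 2, 3]),
    ([(1, [9, 1, 4, 0, 8]), (2, [11, 0, 0, 2, 8]), (8, [5, 4, 0, 2, 4])], [13, 0, 0, 10, 0]),
    ([(1, [11, 1, 0, 10, 0])], [10, 2, 10, 1, 0]), ([(1, [13, 0, 0, 8, 1])], [12, 0, 0, 8, 3]),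
    ([(2, [8, 3, 8, 2, 0])], [12, 1, 8, 2, 0]), ([(2, [10, 0, 9, 2, 0])], [9, 2, 4, 8, 0]),
    ([(2, [13, 0, 0, 6, 2])], [13, 0, 4, 4, 2]), ([(4, [8, 0, 1, 6, 4])], [14, 0, 8, 0, 1]),
    ([(4, [8, 2, 0, 4, 5])], [8, 2, 8, 0, 5]), ([(4, [8, 3, 4, 4, 0])], [11, 0, 4, 0, 8]),
    ([(4, [9, 2, 4, 0, 4])], [10, 0, 0, 4, 9]), ([(4, [10, 0, 5, 4, 0])], [10, 8, 1, 4, 0]),
    ([(4, [12, 0, 0, 0, 7])], [15, 8, 0, 0, 0]), ([(4, [12, 1, 0, 6, 0])], [8, 8, 1, 0, 6]),
    ([(4, [12, 1, 4, 0, 2])], [12, 9, 0, 0, 2]), ([(2, [9, 0, 5, 6, 1])], [8, 2, 4, 6, 3]),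
    ([(2, [9, 0, 9, 0, 3])], [9, 2, 8, 2, 2]), ([(2, [9, 1, 0, 4, 7])], [11, 0, 0, 6, 6]),
    ([(2, [9, 1, 2, 1, 8])], [10, 10, 0, 2, 1]), ([(2, [13, 7, 1, 0, 0])], [14, 6, 1, 0, 2]),
    ([(4, [8, 7, 2, 0, 2])], [12, 5, 2, 4, 0]), ([(4, [10, 1, 0, 2, 6])], [10, 1, 4, 4, 4]),
    ([(4, [10, 2, 4, 2, 1])], [12, 0, 4, 2, 5]), ([(4, [10, 4, 3, 0, 2])], [8, 4, 3, 4, 4]),
    ([(4, [11, 6, 2, 0, 0])], [13, 4, 2, 0, 4]), ([(4, [11, 1, 0, 4, 3])], [11, 1, 8, 0, 3]),
    ([(4, [13, 3, 3, 0, 0])], [9, 3, 3, 0, 8]), ([(1, [6, 3, 6, 3, 4])], [8, 2, 6, 3, 4]),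
    ([(1, [6, 5, 3, 4, 4])], [7, 2, 4, 4, 6]), ([(1, [7, 0, 5, 4, 6])], [8, 6, 0, 5, 4]),
    ([(1, [7, 2, 2, 5, 6])], [8, 6, 2, 2, 5]), ([(1, [7, 7, 2, 4, 2])], [9, 6, 2, 4, 2]),
    ([(1, [10, 1, 2, 5, 4])], [12, 0, 2, 5, 4]), ([(1, [11, 5, 2, 0, 4])], [10, 5, 2, 0, 6]),
    ([(1, [12, 1, 6, 3, 0])], [14, 0, 6, 3, 0]), ([(1, [12, 3, 3, 4, 0])], [14, 2, 3, 4, 0]),
    ([(1, [12, 5, 0, 5, 0])], [14, 4, 0, 5, 0]), ([(1, [12, 5, 2, 2, 1])], [14, 4, 2, 2, 1]),
    ([(1, [13, 2, 3, 0, 4])], [12, 2, 3, 0, 6]), ([(1, [13, 4, 0, 1, 4])], [12, 4, 0, 1, 6]),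
    ([(2, [6, 5, 1, 5, 4])], [8, 4, 5, 1, 5]), ([(2, [7, 2, 0, 6, 6])], [10, 4, 7, 2, 0]),
    ([(2, [10, 2, 6, 3, 0])], [10, 6, 4, 3, 0]), ([(2, [10, 4, 5, 1, 1])], [10, 6, 6, 0, 1]),
    ([(2, [12, 1, 6, 1, 1])], [12, 5, 4, 1, 1]), ([(2, [11, 3, 3, 0, 4])], [11, 7, 1, 0, 4]),
    ([(2, [14, 2, 1, 3, 1])], [12, 2, 1, 3, 5]), ([(4, [8, 1, 7, 3, 0])], [8, 7, 6, 2, 0]),
    ([(4, [8, 3, 6, 1, 1])], [11, 2, 1, 1, 8]), ([(4, [9, 0, 3, 5, 2])], [11, 1, 2, 9, 0]),
    ([(4, [10, 0, 7, 1, 1])], [10, 8, 3, 1, 1]), ([(4, [6, 1, 3, 5, 4])], [11, 1, 4, 6, 1]),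
    ([(4, [6, 6, 5, 1, 1])], [9, 2, 6, 5, 1]), ([(2, [9, 2, 6, 1, 3])], [9, 6, 4, 1, 3]),
    ([(2, [10, 3, 1, 1, 6])], [10, 3, 1, 5, 4]), ([(2, [11, 1, 2, 5, 2])], [9, 1, 2, 5, 6]),
    ([(2, [11, 1, 4, 2, 3])], [9, 1, 4, 2, 7]), ([(4, [7, 1, 5, 4, 2])], [13, 0, 2, 7, 1]),
    ([(1, [9, 1, 2, 3, 7])], [11, 0, 2, 3, 7]), ([(1, [11, 1, 2, 7, 1])], [10, 1, 2, 7, 3]),
    ([(2, [9, 2, 2, 7, 1])], [9, 6, 0, 7, 1]), ([(2, [9, 6, 0, 3, 3])], [13, 4, 0, 3, 3]),
    ([(1, [13, 2, 1, 3, 3])], [13, 2, 1, 5, 2]), ([(4, [6, 1, 5, 2, 5])], [10, 1, 6, 1, 5]),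
    ([(1, [11, 1, 6, 1, 3])], [11, 1, 6, 3, 2]), ([(1, [11, 3, 1, 5, 2])], [11, 3, 3, 4, 2]),
    ([(2, [10, 1, 2, 3, 5])], [10, 5, 0, 3, 5]), ([(1, [10, 3, 1, 3, 5])], [10, 3, 3, 2, 5]),
    ([(1, [11, 3, 3, 2, 3])], [11, 5, 2, 2, 3]),
    ([(1, [6, 5, 5, 1, 5]), (1, [7, 5, 5, 3, 2]), (1, [7, 7, 4, 1, 3]), (2, [6, 5, 3, 2, 5]), (2, [7, 7, 2, 2, 3])], [7, 7, 2, 6, 1]),
    ([(1, [7, 5, 5, 3, 2]), (1, [7, 5, 7, 0, 3]), (1, [7, 7, 4, 1, 3]), (2, [6, 5, 3, 2, 5]), (2, [7, 0, 3, 5, 6])], [6, 5, 5, 3, 4]),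
    ([(2, [7, 3, 4, 6, 1])], [8, 4, 1, 7, 3]), ([(2, [7, 5, 3, 4, 2])], [8, 0, 7, 5, 3]),
    ([(4, [7, 5, 3, 0, 4])], [12, 3, 5, 3, 0]), ([(1, [9, 0, 7, 5, 1])], [9, 0, 7, 7, 0]),
    ([(1, [9, 4, 1, 7, 1])], [9, 4, 3, 6, 1]), ([(1, [12, 3, 5, 1, 1])], [12, 3, 7, 0, 1]),
    ([(2, [6, 3, 6, 1, 5])], [7, 4, 1, 5, 6]), ([(2, [7, 0, 3, 5, 6])], [9, 4, 7, 0, 3]),
    ([(2, [7, 7, 0, 5, 2])], [7, 0, 5, 6, 5]), ([(2, [9, 0, 7, 3, 2])], [9, 4, 5, 3, 2]),
    ([(2, [12, 3, 3, 2, 1])], [12, 7, 1, 2, 1]), ([(1, [7, 5, 3, 6, 1])], [6, 5, 3, 6, 3]),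
    ([(1, [7, 7, 0, 7, 1])], [7, 3, 6, 7, 0]), ([(2, [7, 3, 6, 3, 2])], [7, 7, 4, 3, 2]),
    ([(1, [7, 5, 5, 3, 2])], [7, 5, 7, 2, 2]), ([(1, [7, 5, 7, 0, 3])], [7, 7, 6, 0, 3]),
    ([(8, [3, 3, 3, 3, 3])], [7, 5, 5, 5, 1]), ([(4, [7, 1, 7, 1, 3])], [9, 3, 1, 3, 7]),
    ([(4, [7, 5, 1, 3, 3])], [11, 3, 5, 1, 3])]"

lemma cert_ok_23: "cert_ok 23 basis_23 cert_23"
  by code_simp

text \<open>Six permutations for the first spike and two for the second give eight equations for
  eight unknowns; \<open>units_23\<close> shows that they are independent.\<close>

definition spec_23 :: spec
  where "spec_23 = [([15, 7, 1, 0, 0], [[0], [1], [2], [0, 1], [0, 2], [1, 0]]),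
    ([15, 3, 3, 1, 1], [[0], [2]])]"

lemma rows_23: "rows basis_23 spec_23 = [
    [True, False, False, False, True, True, True, True],
    [True, False, True, False, False, True, False, True],
    [False, False, False, True, False, True, True, True],
    [True, False, True, False, True, False, False, True],
    [False, False, False, False, False, True, False, True],
    [True, True, True, True, False, True, True, True],
    [False, False, True, False, False, False, False, True],
    [False, False, True, False, False, False, False, False]]"
  by code_simp

lemma units_23: "units_ok (length basis_23) (rows basis_23 spec_23)
    [[1, 4, 7], [1, 2, 4, 5], [7], [0, 2, 3, 6], [1, 3, 4, 6, 7], [4, 6, 7], [0, 3, 4, 6], [6, 7]]"
  unfolding rows_23 by code_simp

lemma spec_ok_23: "spec_ok basis_23 spec_23"
  by code_simp

section \<open>The transfer in degree \<open>7 * 2\<^sup>s - 5\<close>\<close>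

lemma subst_subst:
  assumes "\<And>i. i < k \<Longrightarrow> w i \<in> PP l" "f \<in> PP k"
  shows "subst v (subst w f) = subst (\<lambda>i. subst v (w i)) f"
  using assms(2)
proof (induction rule: PP_induct)
  case (lvar i f)
  then have "subst w f \<in> PP l" using assms(1) by (intro subst_PP)
  then show ?case using lvar assms(1) by (simp add: subst_lvar_mult subst_mult[of _ l])
qed simp_all

definition mat_sub :: "bit mat \<Rightarrow> nat \<Rightarrow> laurent"
  where "mat_sub g j = (\<Sum>i<dim_row g. Poly_Mapping.single 0 (g $$ (i, j)) * xv i)"

lemma substitute_mat_sub: "substitute g = subst (mat_sub g)"
  by (simp add: substitute_eq_subst mat_sub_def[abs_def])

lemma single_0_bit: "Poly_Mapping.single 0 c = (if c = 1 then 1 else (0 :: laurent))"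
  by (cases c) simp_all

lemma mat_sub_poly_part: "dim_row g = k \<Longrightarrow> mat_sub g j \<in> poly_part k 1"
  unfolding mat_sub_def by (intro sum_poly_part) (auto simp: single_0_bit intro: lvar_pow_poly_part)

lemma linear_form_mat_sub: "linear_form (mat_sub g j)"
proof -
  have "linear_form (\<Sum>i\<in>I. Poly_Mapping.single 0 (c i) * xv i)" if "finite I" for I c
    using that
  proof (induction I rule: finite_induct)
    case (insert i I)
    have "linear_form (Poly_Mapping.single 0 (c i) * xv i)"
      by (cases "c i") (auto simp: linear_form_def[of 0] single_0_bit)
    with insert show ?case by (simp add: linear_form_add)
  qed (simp add: linear_form_def)
  then show ?thesis by (simp add: mat_sub_def)
qed

lemma subst_mat_sub:
  assumes "g \<in> carrier_mat k k" "h \<in> carrier_mat k k" "j < k"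
  shows "subst (mat_sub g) (mat_sub h j) = mat_sub (g * h) j"
proof -
  have sc: "Poly_Mapping.single 0 (\<Sum>i\<in>I. c i * e i) = (\<Sum>i\<in>I. Poly_Mapping.single 0 (c i) * Poly_Mapping.single 0 (e i) :: laurent)"
    for I :: "nat set" and c e :: "nat \<Rightarrow> bit"
    by (induction I rule: infinite_finite_induct) (simp_all add: single_add mult_single)
  have xs: "subst (mat_sub g) (Poly_Mapping.single 0 c * xv i) = Poly_Mapping.single 0 c * mat_sub g i" for c i
    by (simp add: single_0_bit)
  have "subst (mat_sub g) (mat_sub h j) = (\<Sum>i<k. Poly_Mapping.single 0 (h $$ (i, j)) * mat_sub g i)"
    using assms by (simp add: mat_sub_def[of h] subst_sum xs)
  also have "\<dots> = (\<Sum>i<k. \<Sum>m<k. Poly_Mapping.single 0 (g $$ (m, i)) * Poly_Mapping.single 0 (h $$ (i, j)) * xv m)"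
    using assms by (simp add: mat_sub_def sum_distrib_left mult_ac)
  also have "\<dots> = (\<Sum>m<k. \<Sum>i<k. Poly_Mapping.single 0 (g $$ (m, i)) * Poly_Mapping.single 0 (h $$ (i, j)) * xv m)"
    by (rule sum.swap)
  also have "\<dots> = (\<Sum>m<k. Poly_Mapping.single 0 ((g * h) $$ (m, j)) * xv m)"
    using assms by (intro sum.cong refl) (simp add: scalar_prod_def sc sum_distrib_right atLeast0LessThan)
  also have "\<dots> = mat_sub (g * h) j" using assms by (simp add: mat_sub_def)
  finally show ?thesis .
qed

lemma mat_sub_one: "j < k \<Longrightarrow> mat_sub (1\<^sub>m k) j = xv j"
  unfolding mat_sub_def by (subst sum.remove[of _ j]) (auto intro!: sum.neutral)

lemma substitute_hit_part:
  assumes "g \<in> carrier_mat k k" "f \<in> hit_part k d"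
  shows "substitute g f \<in> hit_part k d"
proof -
  have "mat_sub g i \<in> poly_part k 1" for i using assms(1) by (intro mat_sub_poly_part) auto
  then show ?thesis
    using assms(2) unfolding hit_part_eq substitute_mat_sub
    by (auto intro!: subst_hits[of k] subst_poly_part[of k] linear_form_mat_sub poly_part_PP)
qed

text \<open>Invariance of the zero class means equality of sets, not just inclusion; the
  substitution by the inverse matrix supplies preimages.\<close>

lemma substitute_image_hit_part:
  assumes "g \<in> GL k"
  shows "substitute g ` hit_part k d = hit_part k d"
proof
  from assms have g: "g \<in> carrier_mat k k" and "invertible_mat g" by (simp_all add: GL_def)
  then obtain h where h: "g * h = 1\<^sub>m k" "h * g = 1\<^sub>m (dim_row h)"
    by (auto simp: invertible_mat_def inverts_mat_def)
  have hc: "h \<in> carrier_mat k k"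
    using arg_cong[OF h(1), of dim_col] arg_cong[OF h(2), of dim_col] g by auto
  show "substitute g ` hit_part k d \<subseteq> hit_part k d" using substitute_hit_part[OF g] by blast
  show "hit_part k d \<subseteq> substitute g ` hit_part k d"
  proof
    fix f assume f: "f \<in> hit_part k d"
    then have "f \<in> PP k" by (auto simp: hit_part_eq intro: poly_part_PP)
    moreover have "mat_sub h i \<in> PP k" for i using hc by (intro poly_part_PP[OF mat_sub_poly_part]) auto
    ultimately have "subst (mat_sub g) (subst (mat_sub h) f) = subst (\<lambda>j. subst (mat_sub g) (mat_sub h j)) f"
      by (intro subst_subst)
    also have "\<dots> = f"
      using \<open>f \<in> PP k\<close> by (rule subst_id) (simp add: subst_mat_sub[OF g hc] h(1) mat_sub_one)
    finally have "substitute g (substitute h f) = f" by (simp add: substitute_mat_sub)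
    then show "f \<in> substitute g ` hit_part k d" using substitute_hit_part[OF hc f] by force
  qed
qed

lemma hit_part_coset: "f \<in> hit_part k d \<Longrightarrow> (+) f ` hit_part k d = hit_part k d"
proof -
  assume f: "f \<in> hit_part k d"
  have *: "f + h \<in> hit_part k d" if "h \<in> hit_part k d" for h
    using f that by (auto simp: hit_part_eq intro: add_hits add_poly_part)
  then show ?thesis using pm_add_cancel[of f] by (force simp: image_iff)
qed

text \<open>Both sides reduce to the zero class, since every class in the image of the transfer is
  invariant.\<close>

lemma transfer_zero:
  assumes "\<And>f. f \<in> poly_part (Suc l) d \<Longrightarrow> (\<And>v. v \<in> gens (Suc l) \<Longrightarrow> subst v f + f \<in> hits (Suc l)) \<Longrightarrow> f \<in> hits (Suc l)"
  shows "singer_transfer (Suc l) d ` Tor_F2 (Suc l) (int (Suc l) + d) = QP_invariants (Suc l) d"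
proof -
  define k where "k = Suc l"
  define H where "H = hit_part k d"
  have 0: "0 \<in> H" by (simp add: H_def hit_part_eq)
  have coset: "(+) f ` H = H"
    if "f \<in> poly_part k d" "\<And>v. v \<in> gens k \<Longrightarrow> subst v f + f \<in> hits k" for f
    unfolding H_def using assms that by (intro hit_part_coset) (simp add: hit_part_eq k_def)
  have "QP_invariants k d = {H}"
  proof (intro equalityI subsetI)
    fix c assume "c \<in> QP_invariants k d"
    then obtain f where f: "f \<in> poly_part k d" "c = (+) f ` H" and inv: "\<And>g. g \<in> GL k \<Longrightarrow> substitute g ` c = c"
      by (auto simp: QP_invariants_def QP_def H_def)
    have "subst v f + f \<in> hits k" if "v \<in> gens k" for v
    proof -
      from gens_substitute[OF that] obtain g where g: "g \<in> GL k" "\<forall>f\<in>PP k. substitute g f = subst v f" by blast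
      have "f \<in> c" using 0 f(2) by force
      then have "substitute g f \<in> c" using inv[OF g(1)] by blast
      then obtain h where "h \<in> H" "subst v f = f + h"
        using f g(2) poly_part_PP[OF f(1)] by auto
      then show ?thesis by (simp add: add.commute[of "f + h"] H_def hit_part_eq)
    qed
    then show "c \<in> {H}" using coset[OF f(1)] f(2) by simp
  next
    fix c assume "c \<in> {H}"
    moreover have "H \<in> QP k d" unfolding QP_def
      using 0 by (intro CollectI exI[of _ 0]) (simp add: H_def hit_part_eq)
    ultimately show "c \<in> QP_invariants k d" by (simp add: QP_invariants_def H_def substitute_image_hit_part)
  qed
  moreover have "singer_transfer k d ` Tor_F2 k (int k + d) = {H}"
  proof -
    have "singer_transfer k d c = H" if "c \<in> Tor_F2 k (int k + d)" for c
      using transfer_class[of c l d] that coset unfolding k_def H_def by (auto simp: add.commute)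
    \<comment> \<open>The class of the zero cycle shows that Tor is not empty; otherwise the image
      would be empty instead of consisting of the zero class.\<close>
    moreover have "bar_boundary act (0 :: laurent bar) = 0" by (simp add: bar_boundary_def)
    then have "(0 :: laurent bar) \<in> bar_cycles act (poly_part 0) k (int k + d)"
      by (simp add: bar_cycles_def bar_chains_def bar_relations_def)
    then have "Tor_F2 k (int k + d) \<noteq> {}" unfolding Tor_F2_def Tor_def by blast
    ultimately show ?thesis by auto
  qed
  ultimately show ?thesis by (simp add: k_def)
qed

lemma invariants_zero:
  assumes "1 \<le> s" "f \<in> poly_part 5 (7 * 2 ^ s - 5)" "\<And>v. v \<in> gens 5 \<Longrightarrow> subst v f + f \<in> hits 5"
  shows "f \<in> hits 5"
  using assms
proof (induction s arbitrary: f rule: less_induct)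
  case (less s)
  consider "s = 1" | "s = 2" | "3 \<le> s" using less.prems(1) by linarith
  then show ?case
  proof cases
    case 1
    then show ?thesis using invariants_vanish[OF cert_ok_9 spec_ok_9 units_9, of f] less.prems by simp
  next
    case 2
    then show ?thesis using invariants_vanish[OF cert_ok_23 spec_ok_23 units_23, of f] less.prems by simp
  next
    case 3
    define d :: int where "d = 7 * 2 ^ (s - 1) - 5"
    have "(2 :: int) ^ s = 2 * 2 ^ (s - 1)" using 3 by (simp flip: power_Suc)
    then have d: "7 * 2 ^ s - 5 = 2 * d + int 5" by (simp add: d_def)
    show ?thesis
    proof (rule kameko_invariants[where k = 5 and d = d])
      show "f \<in> poly_part 5 (2 * d + int 5)" using less.prems(2) unfolding d .
      show "\<not> mersenne_sum r m" if "r < 5" "int r + 2 * int m = 2 * d + int 5" for r m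
        using not_mersenne_sum_5[OF 3, of r m] that unfolding d by blast
      show "g \<in> hits 5" if "g \<in> poly_part 5 d" "\<And>v. v \<in> gens 5 \<Longrightarrow> subst v g + g \<in> hits 5" for g
        using less.IH[of "s - 1" g] 3 that unfolding d_def by simp
    qed (rule less.prems(3))
  qed
qed

theorem theorem1p2:
  fixes s :: nat and d :: int
  assumes "s > 0" and "d = 7 * 2 ^ s - 5"
  shows "singer_transfer 5 d ` Tor_F2 5 (5 + d) = QP_invariants 5 d"
  using transfer_zero[of 4 d] invariants_zero[of s] assms by simp

end
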